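(* Let $\Phi_1,\Phi_2\in\mathscr{L}\cup\mathscr{U}$ with $\Phi_2/\Phi_1$ non-decreasing, let $\alpha,\beta>-1$, and define for $1\le t<\infty$ $$\gamma(t)=\frac{\Phi_2^{-1}(t^{n+1+\beta})}{\Phi_1^{-1}(t^{n+1+\alpha})}.$$ (i) If $\gamma$ is equivalent to $1$ on $[1,\infty)$ (i.e. there are $0<c\le C$ with $c\le\gamma(t)\le C$ for all $t\ge1$), then $\mathcal{M}(A^{\Phi_1}_\alpha(\mathbb{B}^n),A^{\Phi_2}_\beta(\mathbb{B}^n))=H^\infty(\mathbb{B}^n)$. (ii) If $\gamma$ is non-increasing on $[1,\infty)$ and $\lim_{t\to\infty}\gamma(t)=0$, then $\mathcal{M}(A^{\Phi_1}_\alpha(\mathbb{B}^n),A^{\Phi_2}_\beta(\mathbb{B}^n))=\{0\}$.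
   Context: $\mathbb{B}^n$ is the open unit ball of $\mathbb{C}^n$. $d\nu$ is Lebesgue measure on $\mathbb{B}^n$ and $d\nu_\alpha(z)=c_\alpha(1-|z|^2)^\alpha d\nu(z)$ with $\nu_\alpha(\mathbb{B}^n)=1$. A growth function is a continuous non-decreasing function from $[0,\infty)$ onto $[0,\infty)$, normalized so that $\Phi(1)=1$. $\Phi$ is of upper type $q>0$ if $\Phi(st)\le Ct^q\Phi(s)$ for all $s>0,t\ge1$; of lower type $p>0$ if $\Phi(st)\le Ct^p\Phi(s)$ for all $s>0$, $0<t\le1$. $\mathscr{U}=\bigcup_{q\ge1}\mathscr{U}^q$ where $\mathscr{U}^q$ is the set of growth functions of upper type $q$ with $\Phi(t)/t$ non-decreasing; $\mathscr{L}=\bigcup_{0<p\le1}\mathscr{L}_p$ where $\mathscr{L}_p$ is the set of growth functions of lower type $p$ with $\Phi(t)/t$ non-increasing. $A^\Phi_\alpha(\mathbb{B}^n)$ is the set of holomorphic $f$ on $\mathbb{B}^n$ with $\int\Phi(|f|)\,d\nu_\alpha<\infty$, with Luxemburg quasi-norm $\|f\|^{lux}_{\Phi,\alpha}=\inf\{\lambda>0:\int_{\mathbb{B}^n}\Phi(|f|/\lambda)\,d\nu_\alpha\le1\}$. $H^\infty(\mathbb{B}^n)$ is the space of bounded holomorphic functions on $\mathbb{B}^n$. The multiplier set $\mathcal{M}(A^{\Phi_1}_\alpha(\mathbb{B}^n),A^{\Phi_2}_\beta(\mathbb{B}^n))$ is the set of holomorphic $g$ on $\mathbb{B}^n$ for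 which there is $C>0$ with $fg\in A^{\Phi_2}_\beta(\mathbb{B}^n)$ and $\|fg\|^{lux}_{\Phi_2,\beta}\le C\|f\|^{lux}_{\Phi_1,\alpha}$ for all $f\in A^{\Phi_1}_\alpha(\mathbb{B}^n)$. *)

theory Defs
  imports "HOL-Analysis.Analysis"
begin

definition growth_fun :: "(real \<Rightarrow> real) \<Rightarrow> bool" where
  "growth_fun \<Phi> \<longleftrightarrow> continuous_on {0..} \<Phi> \<and> mono_on {0..} \<Phi> \<and>
     \<Phi> ` {0..} = {0..} \<and> \<Phi> 1 = 1"

definition upper_type :: "(real \<Rightarrow> real) \<Rightarrow> real \<Rightarrow> bool" where
  "upper_type \<Phi> q \<longleftrightarrow> (\<exists>C>0. \<forall>s>0. \<forall>t\<ge>1. \<Phi> (s * t) \<le> C * t powr q * \<Phi> s)"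

definition lower_type :: "(real \<Rightarrow> real) \<Rightarrow> real \<Rightarrow> bool" where
  "lower_type \<Phi> p \<longleftrightarrow> (\<exists>C>0. \<forall>s>0. \<forall>t. 0 < t \<and> t \<le> 1 \<longrightarrow> \<Phi> (s * t) \<le> C * t powr p * \<Phi> s)"

definition class_U_q :: "real \<Rightarrow> (real \<Rightarrow> real) set" where
  "class_U_q q = {\<Phi>. growth_fun \<Phi> \<and> upper_type \<Phi> q \<and> mono_on {0<..} (\<lambda>t. \<Phi> t / t)}"

definition class_L_p :: "real \<Rightarrow> (real \<Rightarrow> real) set" where
  "class_L_p p = {\<Phi>. growth_fun \<Phi> \<and> lower_type \<Phi> p \<and> antimono_on {0<..} (\<lambda>t. \<Phi> t / t)}"

definition class_U :: "(real \<Rightarrow> real) set" where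
  "class_U = (\<Union>q\<in>{1..}. class_U_q q)"

definition class_L :: "(real \<Rightarrow> real) set" where
  "class_L = (\<Union>p\<in>{0<..1}. class_L_p p)"

text \<open>Inverse of a growth function: the least preimage (a genuine inverse when \<Phi> is strictly increasing).\<close>
definition growth_inv :: "(real \<Rightarrow> real) \<Rightarrow> real \<Rightarrow> real" where
  "growth_inv \<Phi> y = Inf {x. 0 \<le> x \<and> y \<le> \<Phi> x}"

definition holo_on :: "(complex^'n \<Rightarrow> complex) \<Rightarrow> (complex^'n) set \<Rightarrow> bool" where
  "holo_on f S \<longleftrightarrow> (\<forall>z\<in>S. \<exists>L. (f has_derivative L) (at z) \<and> (\<forall>(c::complex) v. L (c *s v) = c * L v))"

definition bergman_weight :: "real \<Rightarrow> complex^'n \<Rightarrow> real" where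
  "bergman_weight \<alpha> z = (if z \<in> ball 0 1 then (1 - (norm z)\<^sup>2) powr \<alpha> else 0)"

definition bergman_const :: "real \<Rightarrow> 'n::finite itself \<Rightarrow> real" where
  "bergman_const \<alpha> _ = 1 / enn2real (\<integral>\<^sup>+ z. ennreal (bergman_weight \<alpha> (z :: complex^'n)) \<partial>lborel)"

definition nu :: "real \<Rightarrow> (complex^'n::finite) measure" where
  "nu \<alpha> = density lborel (\<lambda>z. ennreal (bergman_const \<alpha> TYPE('n) * bergman_weight \<alpha> z))"

definition modular :: "(real \<Rightarrow> real) \<Rightarrow> real \<Rightarrow> (complex^'n::finite \<Rightarrow> complex) \<Rightarrow> ennreal" where
  "modular \<Phi> \<alpha> f = (\<integral>\<^sup>+ z. ennreal (\<Phi> (cmod (f z))) \<partial>nu \<alpha>)"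

definition bergman_orlicz :: "(real \<Rightarrow> real) \<Rightarrow> real \<Rightarrow> (complex^'n::finite \<Rightarrow> complex) set" where
  "bergman_orlicz \<Phi> \<alpha> = {f. holo_on f (ball 0 1) \<and> modular \<Phi> \<alpha> f < \<infinity>}"

definition lux_norm :: "(real \<Rightarrow> real) \<Rightarrow> real \<Rightarrow> (complex^'n::finite \<Rightarrow> complex) \<Rightarrow> real" where
  "lux_norm \<Phi> \<alpha> f = Inf {r. r > 0 \<and> modular \<Phi> \<alpha> (\<lambda>z. f z / complex_of_real r) \<le> 1}"

definition Hinf :: "(complex^'n::finite \<Rightarrow> complex) set" where
  "Hinf = {g. holo_on g (ball 0 1) \<and> bounded (g ` ball 0 1)}"

definition multipliers :: "(real \<Rightarrow> real) \<Rightarrow> real \<Rightarrow> (real \<Rightarrow> real) \<Rightarrow> real \<Rightarrow> (complex^'n::finite \<Rightarrow> complex) set" where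
  "multipliers \<Phi>1 \<alpha> \<Phi>2 \<beta> = {g. holo_on g (ball 0 1) \<and>
     (\<exists>C>0. \<forall>f \<in> bergman_orlicz \<Phi>1 \<alpha>. (\<lambda>z. f z * g z) \<in> bergman_orlicz \<Phi>2 \<beta> \<and>
        lux_norm \<Phi>2 \<beta> (\<lambda>z. f z * g z) \<le> C * lux_norm \<Phi>1 \<alpha> f)}"

end

theory Submission
  imports Defs "HOL-Complex_Analysis.Complex_Analysis"
begin

text \<open>
  Let \<open>d a = 1 - |a|\<^sup>2\<close>. A growth function of positive lower type satisfies the pointwise estimate
  \<open>|f a| \<le> K \<Phi>\<^sup>-\<^sup>1 (d a powr -(n + 1 + \<alpha>))\<close> whenever the modular of \<open>f\<close> is at most 1: it is a
  sub-mean-value property on a complex ellipsoid about \<open>a\<close> with semi-axis of order \<open>d a\<close> in the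
  direction of \<open>a\<close> and of order \<open>sqrt (d a)\<close> orthogonally to it. Conversely the functions
  \<open>\<Phi>\<^sup>-\<^sup>1 (d a powr -(n + 1 + \<alpha>)) (d a / (1 - \<langle>z, a\<rangle>)) ^ k\<close> attain this bound at \<open>a\<close> and, for large \<open>k\<close>,
  have bounded norm by a Forelli--Rudin estimate. Testing a multiplier \<open>g\<close> on them and applying the
  pointwise estimate to the product gives \<open>|g a| \<le> C \<gamma> (1 / d a)\<close>, so \<open>g\<close> is bounded in case (i) and
  vanishes by the maximum principle in case (ii). If \<open>\<gamma>\<close> is bounded below, the pointwise estimate and
  the monotonicity of \<open>\<Phi>2 / \<Phi>1\<close> give \<open>\<Phi>2 |f| (d powr \<beta>) \<le> C \<Phi>1 |f| (d powr \<alpha>)\<close> pointwise, hence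
  every bounded holomorphic function is a multiplier.
\<close>

section \<open>Lebesgue measure under linear maps\<close>

text \<open>The exponent n + 1 + \<alpha> is a volume count: the ellipsoid has 2 real semi-axes of
  order d and 2n - 2 of order sqrt d, hence volume of order d^(n+1), and the weight is of order
  d^\<alpha> on it. Type conditions take their place: lower type absorbs a constant factor of a
  modular into a dilation of the function, and upper type undoes a dilation at the price of a
  constant. A second obstacle is that \<open>growth_inv\<close> is only a least preimage. It
  satisfies \<open>\<Phi> (growth_inv \<Phi> y) = y\<close>, but bounding x through
  \<open>growth_inv\<close> at \<Phi> x costs a constant factor. A third is the range -1 < \<alpha>
  < 0, where the weight is unbounded, so that the weighted volume of a boundary region cannot be
  bounded by its volume times a supremum of the weight.\<close>

lemma translation_invariant_measure_unique:
  fixes \<mu> :: "'a::euclidean_space measure"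
  assumes sets_\<mu> [measurable_cong]: "sets \<mu> = sets borel" and sf: "sigma_finite_measure \<mu>"
    and inv: "\<And>y. distr \<mu> borel ((+) y) = \<mu>"
    and B [measurable]: "B \<in> sets borel" and C [measurable]: "C \<in> sets borel"
  shows "emeasure lborel C * emeasure \<mu> B = emeasure \<mu> (uminus -` C) * emeasure lborel B"
proof -
  interpret \<mu>: sigma_finite_measure \<mu> by fact
  interpret P: pair_sigma_finite lborel \<mu> ..
  have shift: "(\<integral>\<^sup>+y. F y \<partial>\<mu>) = (\<integral>\<^sup>+y. F (x + y) \<partial>\<mu>)" if [measurable]: "F \<in> borel_measurable borel"
    for F :: "'a \<Rightarrow> ennreal" and x
    by (subst inv[of x, symmetric], subst nn_integral_distr) auto
  have shift': "(\<integral>\<^sup>+y. F y \<partial>lborel) = (\<integral>\<^sup>+y. F (y - x) \<partial>lborel)"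
    if [measurable]: "F \<in> borel_measurable borel" for F :: "'a \<Rightarrow> ennreal" and x
    by (subst lborel_distr_plus[of "-x", symmetric], subst nn_integral_distr) auto
  have neg: "uminus -` C \<in> sets borel"
    using measurable_sets[of uminus borel borel C] by simp
  have s2: "(\<integral>\<^sup>+x. indicator C x * indicator B (x + y) \<partial>lborel)
      = (\<integral>\<^sup>+x. indicator C (x - y) * indicator B x \<partial>lborel)" for y
    using shift'[of "\<lambda>x. indicator C x * indicator B (x + y)" y] by simp
  have s3: "(\<integral>\<^sup>+y. indicator C (x - y) * indicator B x \<partial>\<mu>)
      = (\<integral>\<^sup>+y. indicator (uminus -` C) y * indicator B x \<partial>\<mu>)" for x
    using shift[of "\<lambda>y. indicator C (x - y) * indicator B x" x] by (simp add: indicator_def)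
  \<comment> \<open>Uniqueness of Haar measure: invariance of \<mu>, then of Lebesgue measure, then
    of \<mu> again is applied to one double integral, with Fubini in between, and the two measures
    end up exchanged.\<close>
  have "emeasure lborel C * emeasure \<mu> B = (\<integral>\<^sup>+x. \<integral>\<^sup>+y. indicator C x * indicator B y \<partial>\<mu> \<partial>lborel)"
    by (simp add: nn_integral_cmult nn_integral_multc)
  also have "\<dots> = (\<integral>\<^sup>+x. \<integral>\<^sup>+y. indicator C x * indicator B (x + y) \<partial>\<mu> \<partial>lborel)"
    by (intro nn_integral_cong shift[of "\<lambda>y. indicator C _ * indicator B y"]) auto
  also have "\<dots> = (\<integral>\<^sup>+y. \<integral>\<^sup>+x. indicator C x * indicator B (x + y) \<partial>lborel \<partial>\<mu>)"
    by (rule P.Fubini'[symmetric]) measurable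
  also have "\<dots> = (\<integral>\<^sup>+y. \<integral>\<^sup>+x. indicator C (x - y) * indicator B x \<partial>lborel \<partial>\<mu>)"
    by (rule nn_integral_cong) (rule s2)
  also have "\<dots> = (\<integral>\<^sup>+x. \<integral>\<^sup>+y. indicator C (x - y) * indicator B x \<partial>\<mu> \<partial>lborel)"
    by (rule P.Fubini') measurable
  also have "\<dots> = (\<integral>\<^sup>+x. \<integral>\<^sup>+y. indicator (uminus -` C) y * indicator B x \<partial>\<mu> \<partial>lborel)"
    by (rule nn_integral_cong) (rule s3)
  also have "\<dots> = emeasure \<mu> (uminus -` C) * emeasure lborel B"
    using neg by (simp add: nn_integral_cmult nn_integral_multc sets_\<mu>)
  finally show ?thesis .
qed

text \<open>Translating the image by y amounts to translating the source by \<open>K y\<close>, so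
  the image of Lebesgue measure under \<open>L\<close> is translation invariant and therefore
  proportional to Lebesgue measure. The factor is kept as a ratio of two volumes, cross-multiplied,
  and is not identified with a determinant: for an isometry the two volumes agree.\<close>

lemma nn_integral_linear_bij:
  fixes L :: "'a::euclidean_space \<Rightarrow> 'a"
  assumes L: "linear L" and K: "linear K" and LK: "\<And>x. L (K x) = x" and KL: "\<And>x. K (L x) = x"
    and F [measurable]: "F \<in> borel_measurable borel"
  shows "emeasure lborel (ball 0 1 :: 'a set) * (\<integral>\<^sup>+x. F (L x) \<partial>lborel)
       = emeasure lborel {x. norm (L x) < 1} * (\<integral>\<^sup>+x. F x \<partial>lborel)"
proof -
  have cont: "continuous_on UNIV L" "continuous_on UNIV K"
    using L K by (simp_all add: linear_continuous_on linear_conv_bounded_linear)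
  have Lm [measurable]: "L \<in> borel_measurable borel" and Km [measurable]: "K \<in> borel_measurable borel"
    using cont by (simp_all add: borel_measurable_continuous_onI)
  define \<mu> where "\<mu> = distr lborel borel L"
  have sets_\<mu> [measurable_cong]: "sets \<mu> = sets borel" by (simp add: \<mu>_def)
  have sf: "sigma_finite_measure \<mu>"
  proof
    have "emeasure \<mu> (cball 0 (real n)) \<noteq> \<infinity>" for n
    proof -
      have "L -` cball 0 (real n) = K ` cball 0 (real n)"
      proof (intro set_eqI iffI)
        fix x assume "x \<in> L -` cball 0 (real n)"
        then show "x \<in> K ` cball 0 (real n)" using KL[of x] by (intro image_eqI[of _ _ "L x"]) auto
      qed (auto simp: LK)
      moreover have "compact (K ` cball 0 (real n))"
        by (intro compact_continuous_image continuous_on_subset[OF cont(2)]) auto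
      ultimately have "emeasure lborel (L -` cball 0 (real n)) < \<infinity>"
        by (metis emeasure_bounded_finite compact_imp_bounded)
      then show ?thesis by (simp add: \<mu>_def emeasure_distr)
    qed
    moreover have "(\<Union>n. cball 0 (real n)) = (UNIV :: 'a set)"
      by (auto simp: real_arch_simple)
    ultimately show "\<exists>A::'a set set. countable A \<and> A \<subseteq> sets \<mu> \<and> \<Union> A = space \<mu> \<and> (\<forall>a\<in>A. emeasure \<mu> a \<noteq> \<infinity>)"
      by (intro exI[of _ "range (\<lambda>n. cball 0 (real n))"]) (auto simp: \<mu>_def)
  qed
  have inv: "distr \<mu> borel ((+) y) = \<mu>" for y
  proof -
    have "distr \<mu> borel ((+) y) = distr lborel borel (L \<circ> (+) (K y))"
      unfolding \<mu>_def by (subst distr_distr) (auto intro!: distr_cong simp: linear_add[OF L] LK)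
    also have "\<dots> = distr (distr lborel borel ((+) (K y))) borel L"
      by (subst distr_distr) auto
    finally show ?thesis by (simp add: lborel_distr_plus \<mu>_def)
  qed
  \<comment> \<open>The unit ball is symmetric, so the reflected set in the uniqueness lemma is the
    ball itself.\<close>
  have neg: "uminus -` ball 0 1 = (ball 0 1 :: 'a set)" by auto
  have ball: "emeasure \<mu> (ball 0 1) = emeasure lborel {x. norm (L x) < 1}"
    by (simp add: \<mu>_def emeasure_distr vimage_def)
  have "density \<mu> (\<lambda>_. emeasure lborel (ball 0 1 :: 'a set)) = density lborel (\<lambda>_. emeasure \<mu> (ball 0 1))"
  proof (rule measure_eqI)
    fix B :: "'a set" assume "B \<in> sets (density \<mu> (\<lambda>_. emeasure lborel (ball 0 1 :: 'a set)))"
    then have [measurable]: "B \<in> sets borel" by (simp add: \<mu>_def)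
    show "emeasure (density \<mu> (\<lambda>_. emeasure lborel (ball 0 1 :: 'a set))) B = emeasure (density lborel (\<lambda>_. emeasure \<mu> (ball 0 1))) B"
      using translation_invariant_measure_unique[OF sets_\<mu> sf inv, of B "ball 0 1"]
      by (simp add: emeasure_density nn_integral_cmult neg)
  qed (simp add: \<mu>_def)
  then have "integral\<^sup>N (density \<mu> (\<lambda>_. emeasure lborel (ball 0 1 :: 'a set))) F = integral\<^sup>N (density lborel (\<lambda>_. emeasure \<mu> (ball 0 1))) F"
    by simp
  then have "emeasure lborel (ball 0 1 :: 'a set) * (\<integral>\<^sup>+x. F x \<partial>\<mu>) = emeasure \<mu> (ball 0 1) * (\<integral>\<^sup>+x. F x \<partial>lborel)"
    by (simp add: nn_integral_density nn_integral_cmult)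
  then show ?thesis by (simp add: ball) (simp add: \<mu>_def nn_integral_distr)
qed

lemma emeasure_lborel_unit_ball_bounds:
  "0 < emeasure lborel (ball 0 1 :: 'a::euclidean_space set)" "emeasure lborel (ball 0 1 :: 'a set) < \<infinity>"
  by (simp_all add: emeasure_ball)

lemma nn_integral_norm_preserving:
  fixes L :: "'a::euclidean_space \<Rightarrow> 'a"
  assumes L: "linear L" and K: "linear K" and LK: "\<And>x. L (K x) = x" and KL: "\<And>x. K (L x) = x"
    and norm: "\<And>x. norm (L x) = norm x"
    and F: "F \<in> borel_measurable borel"
  shows "(\<integral>\<^sup>+x. F (L x) \<partial>lborel) = (\<integral>\<^sup>+x. F x \<partial>lborel)"
proof -
  have "{x::'a. norm x < 1} = ball 0 1" by auto
  then show ?thesis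
    using nn_integral_linear_bij[OF L K LK KL F] emeasure_lborel_unit_ball_bounds[where 'a='a]
    by (auto simp: norm ennreal_mult_cancel_left)
qed

section \<open>Reflections and stretches along one real direction\<close>

definition reflection :: "'a::euclidean_space \<Rightarrow> 'a \<Rightarrow> 'a" where
  "reflection v x = x - (2 * (x \<bullet> v) / (v \<bullet> v)) *\<^sub>R v"

lemma linear_reflection: "linear (reflection v)"
  unfolding reflection_def by (rule linearI) (auto simp: algebra_simps inner_add_left add_divide_distrib scaleR_add_left)

lemma inner_reflection: "reflection v x \<bullet> reflection v y = x \<bullet> y"
  by (cases "v = 0") (simp_all add: reflection_def inner_diff_left inner_diff_right inner_commute field_simps)

lemma reflection_reflection [simp]: "reflection v (reflection v x) = x"
proof (cases "v = 0")
  case False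
  then show ?thesis
    by (simp add: reflection_def inner_diff_left field_simps scaleR_left.diff)
qed (simp add: reflection_def)

text \<open>For vectors of equal length, \<open>a - b\<close> is normal to their bisecting
  hyperplane. If \<open>a = b\<close> the vector is 0, and division by zero turns
  \<open>reflection 0\<close> into the identity, as required.\<close>

lemma reflection_swap:
  assumes "norm a = norm b" shows "reflection (a - b) a = b"
proof (cases "a = b")
  case False
  have "a \<bullet> a = b \<bullet> b" using assms by (simp add: norm_eq)
  then have "2 * (a \<bullet> (a - b)) = (a - b) \<bullet> (a - b)"
    by (simp add: inner_diff_left inner_diff_right inner_commute)
  moreover have "(a - b) \<bullet> (a - b) \<noteq> 0" using False by simp
  ultimately show ?thesis by (simp add: reflection_def)
qed (simp add: reflection_def)

text \<open>For a unit vector \<open>a\<close>, the component along \<open>a\<close> is multiplied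
  by \<open>s\<close> and the orthogonal complement is fixed, so the Jacobian is
  \<open>s\<close>.\<close>

definition stretch :: "'a::euclidean_space \<Rightarrow> real \<Rightarrow> 'a \<Rightarrow> 'a" where
  "stretch a s x = x + ((s - 1) * (x \<bullet> a)) *\<^sub>R a"

lemma continuous_stretch: "continuous_on UNIV (stretch a s)"
  unfolding stretch_def by (intro continuous_intros)

text \<open>A reflection moves \<open>a\<close> to a basis vector, where the stretch is a diagonal map.\<close>

lemma nn_integral_stretch:
  fixes a :: "'a::euclidean_space"
  assumes a: "norm a = 1" and s: "s > 0" and F [measurable]: "F \<in> borel_measurable borel"
  shows "ennreal s * (\<integral>\<^sup>+x. F (stretch a s x) \<partial>lborel) = (\<integral>\<^sup>+x. F x \<partial>lborel)"
proof -
  obtain b :: 'a where b: "b \<in> Basis" using nonempty_Basis by blast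
  define R where "R = reflection (a - b)"
  have Ra: "R a = b" unfolding R_def using a b by (intro reflection_swap) simp
  have RR: "R (R x) = x" for x by (simp add: R_def)
  have Rlin: "linear R" unfolding R_def by (rule linear_reflection)
  have Rnorm: "norm (R x) = norm x" for x by (simp add: R_def norm_eq inner_reflection)
  have Rint: "(\<integral>\<^sup>+x. G (R x) \<partial>lborel) = (\<integral>\<^sup>+x. G x \<partial>lborel)" if "G \<in> borel_measurable borel" for G
    using that by (rule nn_integral_norm_preserving[OF Rlin Rlin RR RR Rnorm])
  have [measurable]: "R \<in> borel_measurable borel" "stretch a s \<in> borel_measurable borel" "stretch b s \<in> borel_measurable borel"
    using Rlin continuous_stretch
    by (auto intro!: borel_measurable_continuous_onI simp: linear_continuous_on linear_conv_bounded_linear)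
  have conj: "R (stretch a s x) = stretch b s (R x)" for x
  proof -
    have "R x \<bullet> b = x \<bullet> a" unfolding Ra[symmetric] by (simp add: R_def inner_reflection)
    then show ?thesis by (simp add: stretch_def linear_add[OF Rlin] linear_scale[OF Rlin] Ra)
  qed
  define c where "c = (\<lambda>j::'a. if j = b then s else 1)"
  have st: "stretch b s x = 0 + (\<Sum>j\<in>Basis. (c j * (x \<bullet> j)) *\<^sub>R j)" for x
  proof -
    have "(\<Sum>j\<in>Basis. (c j * (x \<bullet> j)) *\<^sub>R j) = (\<Sum>j\<in>Basis. (x \<bullet> j) *\<^sub>R j + (if j = b then ((s-1) * (x \<bullet> j)) *\<^sub>R j else 0))"
      by (intro sum.cong) (auto simp: c_def algebra_simps)
    also have "\<dots> = x + ((s-1) * (x \<bullet> b)) *\<^sub>R b"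
      using b by (simp add: sum.distrib euclidean_representation)
    finally show ?thesis by (simp add: stretch_def)
  qed
  have prod: "(\<Prod>j\<in>Basis. \<bar>c j\<bar>) = s"
    using b s by (simp add: c_def if_distrib prod.delta cong: if_cong)
  have D: "lborel = density (distr lborel borel (stretch b s)) (\<lambda>_. ennreal s)"
    using lborel_affine_euclidean[of c 0] s unfolding st[symmetric] prod by (simp add: c_def)
  then have sb: "(\<integral>\<^sup>+x. G x \<partial>lborel) = ennreal s * (\<integral>\<^sup>+x. G (stretch b s x) \<partial>lborel)"
    if [measurable]: "G \<in> borel_measurable borel" for G
  proof -
    have "(\<integral>\<^sup>+x. G x \<partial>lborel) = (\<integral>\<^sup>+x. G x \<partial>density (distr lborel borel (stretch b s)) (\<lambda>_. ennreal s))"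
      by (simp add: D[symmetric])
    also have "\<dots> = ennreal s * (\<integral>\<^sup>+x. G (stretch b s x) \<partial>lborel)"
      by (simp add: nn_integral_density nn_integral_distr nn_integral_cmult)
    finally show ?thesis .
  qed
  have "(\<integral>\<^sup>+x. F x \<partial>lborel) = (\<integral>\<^sup>+x. F (R x) \<partial>lborel)" by (simp add: Rint)
  also have "\<dots> = ennreal s * (\<integral>\<^sup>+x. F (R (stretch b s x)) \<partial>lborel)" by (rule sb) simp
  also have "\<dots> = ennreal s * (\<integral>\<^sup>+x. F (R (stretch b s (R x))) \<partial>lborel)"
    using Rint[of "\<lambda>x. F (R (stretch b s x))"] by simp
  finally show ?thesis by (simp add: conj[symmetric] RR)
qed

section \<open>The Hermitian product and complex ellipsoids\<close>

text \<open>Linear in the first argument and conjugate-linear in the second, so that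
  \<open>\<lambda>z. cdot z a\<close> is holomorphic. The real part is the Euclidean inner product,
  which is how real Euclidean facts enter.\<close>

definition cdot :: "complex^'n::finite \<Rightarrow> complex^'n \<Rightarrow> complex" where
  "cdot z a = (\<Sum>i\<in>UNIV. z $ i * cnj (a $ i))"

lemma cdot_simps:
  "cdot (x + y) a = cdot x a + cdot y a" "cdot (x - y) a = cdot x a - cdot y a"
  "cdot x (a + b) = cdot x a + cdot x b" "cdot x (a - b) = cdot x a - cdot x b"
  "cdot (c *s x) a = c * cdot x a" "cdot x (c *s a) = cnj c * cdot x a"
  "cdot (r *\<^sub>R x) a = r *\<^sub>R cdot x a" "cdot x (r *\<^sub>R a) = r *\<^sub>R cdot x a"
  "cdot 0 a = 0" "cdot a 0 = 0"
  unfolding cdot_def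
  by (simp_all add: algebra_simps sum.distrib sum_subtractf sum_distrib_left scaleR_conv_of_real[where 'a=complex])

lemma Re_cdot: "Re (cdot x y) = x \<bullet> y"
  by (simp add: cdot_def inner_vec_def inner_complex_def)

lemma cdot_commute: "cdot x y = cnj (cdot y x)"
  by (simp add: cdot_def mult.commute)

lemma cdot_self: "cdot x x = of_real ((norm x)\<^sup>2)"
  by (rule complex_eqI) (simp_all add: Re_cdot power2_norm_eq_inner, simp add: cdot_def)

lemma norm_smult_vec: "norm (c *s x) = cmod c * norm (x :: complex^'n::finite)"
proof -
  have "complex_of_real ((norm (c *s x))\<^sup>2) = of_real ((cmod c * norm x)\<^sup>2)"
    by (simp only: cdot_self[symmetric] cdot_simps)
       (simp add: cdot_self power_mult_distrib complex_norm_square[symmetric] mult.commute[of "cnj c"])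
  then show ?thesis by (simp only: of_real_eq_iff) (simp add: power2_eq_iff_nonneg)
qed

lemma scaleR_eq_smult: "r *\<^sub>R x = complex_of_real r *s (x :: complex^'n::finite)"
  by (simp add: vec_eq_iff scaleR_conv_of_real[where 'a=complex])

text \<open>A scalar \<open>c\<close> rotates \<open>x\<close> until the product is real and
  nonnegative; then the real Cauchy-Schwarz inequality applies. As \<open>sgn 0 = 0\<close>, only
  \<open>cmod c \<le> 1\<close> holds in general, which suffices.\<close>

lemma norm_cdot_le: "cmod (cdot x y) \<le> norm x * norm y"
proof -
  define c where "c = cnj (sgn (cdot x y))"
  have c: "cmod c \<le> 1" by (simp add: c_def norm_sgn)
  have "cdot (c *s x) y = of_real (cmod (cdot x y))"
    by (simp add: c_def cdot_simps sgn_eq complex_norm_square[symmetric] power2_eq_square mult.commute)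
  then have "cmod (cdot x y) = (c *s x) \<bullet> y" by (metis Re_cdot Re_complex_of_real)
  also have "\<dots> \<le> norm (c *s x) * norm y" by (rule norm_cauchy_schwarz)
  also have "\<dots> \<le> norm x * norm y"
    using c by (intro mult_right_mono) (auto simp: norm_smult_vec mult_left_le_one_le)
  finally show ?thesis .
qed

lemma continuous_on_cdot [continuous_intros]:
  "continuous_on S f \<Longrightarrow> continuous_on S (\<lambda>x. cdot (f x) a)"
  unfolding cdot_def by (intro continuous_intros)

lemma continuous_on_smult [continuous_intros]:
  fixes g :: "'a::topological_space \<Rightarrow> complex^'n::finite"
  assumes "continuous_on S c" "continuous_on S g"
  shows "continuous_on S (\<lambda>x. c x *s g x)"
  unfolding vector_scalar_mult_def using assms by (intro continuous_intros)

lemma DIM_complex_vec: "DIM(complex^'n::finite) = 2 * CARD('n)"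
  by simp

text \<open>For a unit vector \<zeta>, the complex line through \<zeta> is scaled by
  \<open>s\<close> and its orthogonal complement by \<open>t\<close>, so the unit ball is mapped to
  a complex ellipsoid. The map is complex linear, hence preserves holomorphy under
  composition.\<close>

definition ellip :: "complex^'n::finite \<Rightarrow> real \<Rightarrow> real \<Rightarrow> complex^'n \<Rightarrow> complex^'n" where
  "ellip \<zeta> s t x = s *\<^sub>R (cdot x \<zeta> *s \<zeta>) + t *\<^sub>R (x - cdot x \<zeta> *s \<zeta>)"

lemma linear_ellip: "linear (ellip \<zeta> s t)"
  by (rule linearI) (simp_all add: ellip_def cdot_simps algebra_simps vector_sadd_rdistrib scaleR_conv_of_real[where 'a=complex] scaleR_eq_smult vector_add_ldistrib vector_ssub_ldistrib)

lemma ellip_smult: "ellip \<zeta> s t (c *s x) = c *s ellip \<zeta> s t x"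
  by (simp add: ellip_def cdot_simps scaleR_eq_smult algebra_simps vector_add_ldistrib vector_ssub_ldistrib)

lemma cdot_ellip: "norm \<zeta> = 1 \<Longrightarrow> cdot (ellip \<zeta> s t x) \<zeta> = s * cdot x \<zeta>"
  by (simp add: ellip_def cdot_simps cdot_self scaleR_conv_of_real[where 'a=complex])

lemma norm_add_square: "(norm (x + y))\<^sup>2 = (norm x)\<^sup>2 + 2 * Re (cdot x y) + (norm (y::complex^'n::finite))\<^sup>2"
  by (simp add: Re_cdot power2_norm_eq_inner inner_add_left inner_add_right inner_commute)

lemma norm_ellip:
  assumes "norm \<zeta> = 1"
  shows "(norm (ellip \<zeta> s t x))\<^sup>2 = s\<^sup>2 * (cmod (cdot x \<zeta>))\<^sup>2 + t\<^sup>2 * ((norm x)\<^sup>2 - (cmod (cdot x \<zeta>))\<^sup>2)"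
proof -
  define c where "c = cdot x \<zeta>"
  have cc: "cdot \<zeta> x = cnj c" by (simp add: c_def cdot_commute[of \<zeta>])
  have orth: "cdot (c *s \<zeta>) (x - c *s \<zeta>) = 0"
    unfolding cdot_simps cc cdot_self norm_smult_vec assms by (simp add: complex_norm_square[symmetric])
  have p: "(norm (c *s \<zeta>))\<^sup>2 = (cmod c)\<^sup>2" by (simp add: norm_smult_vec assms)
  have "(norm x)\<^sup>2 = (norm (c *s \<zeta> + (x - c *s \<zeta>)))\<^sup>2" by simp
  also have "\<dots> = (cmod c)\<^sup>2 + (norm (x - c *s \<zeta>))\<^sup>2"
    unfolding norm_add_square orth p by simp
  finally have q: "(norm (x - c *s \<zeta>))\<^sup>2 = (norm x)\<^sup>2 - (cmod c)\<^sup>2" by simp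
  have "(norm (ellip \<zeta> s t x))\<^sup>2 = s\<^sup>2 * (norm (c *s \<zeta>))\<^sup>2 + t\<^sup>2 * (norm (x - c *s \<zeta>))\<^sup>2"
    unfolding ellip_def norm_add_square c_def[symmetric]
    by (simp add: cdot_simps(7,8) orth power_mult_distrib)
  then show ?thesis by (simp add: q p c_def[symmetric])
qed

text \<open>The vectors \<zeta> and i\<zeta> form a real orthonormal basis of the complex line, so
  scaling that line by s/t is a pair of real stretches. This is where the Jacobian comes
  from.\<close>

lemma ellip_eq_stretch:
  assumes "norm \<zeta> = 1" "t > 0"
  shows "ellip \<zeta> s t x = 0 + t *\<^sub>R stretch \<zeta> (s / t) (stretch (\<i> *s \<zeta>) (s / t) x)"
proof -
  have i: "\<zeta> \<bullet> (\<i> *s \<zeta>) = 0" "(\<i> *s \<zeta>) \<bullet> \<zeta> = 0"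
    by (simp_all add: Re_cdot[symmetric] cdot_simps cdot_self)
  have P: "cdot x \<zeta> *s \<zeta> = (x \<bullet> \<zeta>) *\<^sub>R \<zeta> + (x \<bullet> (\<i> *s \<zeta>)) *\<^sub>R (\<i> *s \<zeta>)"
    unfolding Re_cdot[symmetric] cdot_simps
    by (subst complex_eq[of "cdot x \<zeta>"]) (simp add: scaleR_eq_smult vector_sadd_rdistrib mult.commute)
  have "t * (s / t - 1) = s - t" using assms by (simp add: field_simps)
  then have "t *\<^sub>R stretch \<zeta> (s / t) (stretch (\<i> *s \<zeta>) (s / t) x)
    = t *\<^sub>R x + (s - t) *\<^sub>R ((x \<bullet> \<zeta>) *\<^sub>R \<zeta> + (x \<bullet> (\<i> *s \<zeta>)) *\<^sub>R (\<i> *s \<zeta>))"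
    by (simp add: stretch_def inner_add_left i scaleR_add_right mult.assoc[symmetric])
  also have "\<dots> = ellip \<zeta> s t x"
    by (simp add: ellip_def P[symmetric] algebra_simps)
  finally show ?thesis by simp
qed

lemma nn_integral_scaleR_lborel:
  fixes F :: "'a::euclidean_space \<Rightarrow> ennreal"
  assumes [measurable]: "F \<in> borel_measurable borel" and "t > 0"
  shows "ennreal (t ^ DIM('a)) * (\<integral>\<^sup>+x. F (a + t *\<^sub>R x) \<partial>lborel) = (\<integral>\<^sup>+x. F x \<partial>lborel)"
  using assms(2)
  by (subst (2) lborel_affine[of t a]) (auto simp: nn_integral_density nn_integral_distr nn_integral_cmult ennreal_power)

lemma nn_integral_translate_lborel:
  fixes F :: "'a::euclidean_space \<Rightarrow> ennreal"
  assumes [measurable]: "F \<in> borel_measurable borel"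
  shows "(\<integral>\<^sup>+x. F (a + x) \<partial>lborel) = (\<integral>\<^sup>+x. F x \<partial>lborel)"
  using nn_integral_scaleR_lborel[OF assms, of 1 a] by simp

text \<open>The dilation contributes t^(2n) and each of the two stretches s/t, in total s^2
  t^(2n-2).\<close>

lemma nn_integral_ellip:
  fixes F :: "complex^'n::finite \<Rightarrow> ennreal"
  assumes \<zeta>: "norm \<zeta> = 1" and st: "s > 0" "t > 0" and F [measurable]: "F \<in> borel_measurable borel"
  shows "ennreal ((s / t)\<^sup>2 * t ^ (2 * CARD('n))) * (\<integral>\<^sup>+x. F (a + ellip \<zeta> s t x) \<partial>lborel) = (\<integral>\<^sup>+x. F x \<partial>lborel)"
proof -
  have [measurable]: "stretch b r \<in> borel_measurable borel" for b :: "complex^'n" and r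
    using continuous_stretch by (rule borel_measurable_continuous_onI)
  have i: "norm (\<i> *s \<zeta>) = 1" using \<zeta> by (simp add: norm_smult_vec)
  have "(\<integral>\<^sup>+x. F x \<partial>lborel) = ennreal (t ^ (2 * CARD('n))) * (\<integral>\<^sup>+x. F (a + t *\<^sub>R x) \<partial>lborel)"
    using nn_integral_scaleR_lborel[OF F st(2), of a] by (simp add: mult.commute)
  also have "(\<integral>\<^sup>+x. F (a + t *\<^sub>R x) \<partial>lborel) = ennreal (s / t) * (\<integral>\<^sup>+x. F (a + t *\<^sub>R stretch \<zeta> (s / t) x) \<partial>lborel)"
    using \<zeta> st by (subst nn_integral_stretch[of \<zeta> "s / t" "\<lambda>x. F (a + t *\<^sub>R x)"]) auto
  also have "(\<integral>\<^sup>+x. F (a + t *\<^sub>R stretch \<zeta> (s / t) x) \<partial>lborel)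
     = ennreal (s / t) * (\<integral>\<^sup>+x. F (a + t *\<^sub>R stretch \<zeta> (s / t) (stretch (\<i> *s \<zeta>) (s / t) x)) \<partial>lborel)"
    using i st by (subst nn_integral_stretch[of "\<i> *s \<zeta>" "s / t" "\<lambda>x. F (a + t *\<^sub>R stretch \<zeta> (s / t) x)"]) auto
  also have "\<dots> = ennreal (s / t) * (\<integral>\<^sup>+x. F (a + ellip \<zeta> s t x) \<partial>lborel)"
    using \<zeta> st by (simp add: ellip_eq_stretch)
  finally show ?thesis
    using st by (simp add: power2_eq_square ennreal_mult mult.assoc mult.left_commute del: times_divide_eq_right times_divide_eq_left times_divide_times_eq)
qed

section \<open>Holomorphic functions of several variables\<close>

lemma holo_on_subset: "holo_on f S \<Longrightarrow> T \<subseteq> S \<Longrightarrow> holo_on f T"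
  by (auto simp: holo_on_def)

lemma holo_on_imp_continuous_on: "holo_on f S \<Longrightarrow> continuous_on S f"
  unfolding holo_on_def
  by (meson continuous_at_imp_continuous_on has_derivative_continuous)

lemma holo_on_mult:
  assumes "holo_on f S" "holo_on g S"
  shows "holo_on (\<lambda>z. f z * g z) S"
  unfolding holo_on_def
proof
  fix z assume "z \<in> S"
  then obtain L M where L: "(f has_derivative L) (at z)" "\<And>c v. L (c *s v) = c * L v"
    and M: "(g has_derivative M) (at z)" "\<And>c v. M (c *s v) = c * M v"
    using assms unfolding holo_on_def by metis
  show "\<exists>L. ((\<lambda>z. f z * g z) has_derivative L) (at z) \<and> (\<forall>c v. L (c *s v) = c * L v)"
    by (intro exI conjI allI) (rule has_derivative_mult[OF L(1) M(1)], simp add: L M algebra_simps)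
qed

lemma holo_on_const: "holo_on (\<lambda>z. c) S"
  unfolding holo_on_def by (auto intro!: exI[of _ "\<lambda>_. 0"])

lemma holo_on_cmult: "holo_on f S \<Longrightarrow> holo_on (\<lambda>z. c * f z) S"
  by (rule holo_on_mult[OF holo_on_const])

lemma holo_on_divide_const: "holo_on f S \<Longrightarrow> holo_on (\<lambda>z. f z / c) S"
  using holo_on_cmult[of f S "1 / c"] by simp

lemma holo_on_cong_open:
  assumes "open S" "holo_on f S" "\<And>z. z \<in> S \<Longrightarrow> f z = g z"
  shows "holo_on g S"
  unfolding holo_on_def
proof
  fix z assume z: "z \<in> S"
  then obtain L where L: "(f has_derivative L) (at z)" "\<forall>c v. L (c *s v) = c * L v"
    using assms(2) unfolding holo_on_def by metis
  have "(g has_derivative L) (at z)"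
    by (rule has_derivative_transform_within_open[OF L(1) assms(1) z]) (rule assms(3))
  with L(2) show "\<exists>L. (g has_derivative L) (at z) \<and> (\<forall>c v. L (c *s v) = c * L v)"
    by blast
qed

lemma holo_on_compose_field:
  assumes f: "holo_on f S" and h: "\<And>z. z \<in> S \<Longrightarrow> h field_differentiable at (f z)"
  shows "holo_on (\<lambda>z. h (f z)) S"
  unfolding holo_on_def
proof
  fix z assume z: "z \<in> S"
  then obtain L where L: "(f has_derivative L) (at z)" "\<And>c v. L (c *s v) = c * L v"
    using f unfolding holo_on_def by metis
  obtain d where "(h has_derivative (*) d) (at (f z))"
    using h[OF z] by (auto simp: field_differentiable_def has_field_derivative_def)
  then have "((\<lambda>z. h (f z)) has_derivative (\<lambda>v. d * L v)) (at z)"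
    using has_derivative_compose[OF L(1)] by blast
  then show "\<exists>L. ((\<lambda>z. h (f z)) has_derivative L) (at z) \<and> (\<forall>c v. L (c *s v) = c * L v)"
    by (intro exI conjI) (auto simp: L)
qed

lemma holo_on_cdot: "holo_on (\<lambda>z. cdot z a) S"
proof -
  have "linear (\<lambda>z. cdot z a)" by (rule linearI) (simp_all add: cdot_simps)
  then have "((\<lambda>z. cdot z a) has_derivative (\<lambda>z. cdot z a)) (at z)" for z
    by (simp add: linear_imp_has_derivative)
  then show ?thesis unfolding holo_on_def by (blast intro: cdot_simps)
qed

lemma holo_on_affine:
  assumes f: "holo_on f S" and A: "linear A" "\<And>c v. A (c *s v) = c *s A v"
    and sub: "\<And>u. u \<in> T \<Longrightarrow> z + A u \<in> S"
  shows "holo_on (\<lambda>u. f (z + A u)) T"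
  unfolding holo_on_def
proof
  fix u assume "u \<in> T"
  then obtain L where L: "(f has_derivative L) (at (z + A u))" "\<And>c v. L (c *s v) = c * L v"
    using f sub unfolding holo_on_def by metis
  have "((\<lambda>u. z + A u) has_derivative A) (at u)"
    using linear_imp_has_derivative[OF A(1)] by (auto intro!: derivative_eq_intros)
  from has_derivative_compose[OF this L(1)]
  show "\<exists>L. ((\<lambda>u. f (z + A u)) has_derivative L) (at u) \<and> (\<forall>c v. L (c *s v) = c * L v)"
    by (intro exI conjI) (auto simp: L A)
qed

text \<open>The gate to one-variable theory: Cauchy's formula and the maximum principle are both
  applied to such slices.\<close>

lemma holo_on_line:
  assumes f: "holo_on f S" and sub: "\<And>c. c \<in> T \<Longrightarrow> z + c *s w \<in> S" and c: "c \<in> T"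
  shows "(\<lambda>c. f (z + c *s w)) field_differentiable at c"
proof -
  obtain L where L: "(f has_derivative L) (at (z + c *s w))" "\<And>c v. L (c *s v) = c * L v"
    using f sub[OF c] unfolding holo_on_def by metis
  have "linear (\<lambda>c::complex. c *s w)"
    by (rule linearI) (simp_all add: vector_sadd_rdistrib scaleR_eq_smult scaleR_conv_of_real[where 'a=complex])
  then have "((\<lambda>c. z + c *s w) has_derivative (\<lambda>c. c *s w)) (at c)"
    using linear_imp_has_derivative by (auto intro!: derivative_eq_intros)
  from has_derivative_compose[OF this L(1)]
  have "((\<lambda>c. f (z + c *s w)) has_derivative (\<lambda>c. L w * c)) (at c)"
    by (simp add: L mult.commute)
  then show ?thesis by (auto simp: field_differentiable_def has_field_derivative_def)
qed

section \<open>The mean value inequality on balls\<close>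

lemma norm_le_circle_average:
  assumes h: "continuous_on (cball 0 1) h" "h holomorphic_on ball 0 1"
  shows "ennreal (cmod (h 0)) \<le> (\<integral>\<^sup>+t. ennreal (cmod (h (cis (2 * pi * t)))) * indicator {0..1} t \<partial>lborel)"
proof -
  have cp: "circlepath 0 1 t = cis (2 * pi * t)" for t
    by (simp add: circlepath cis_conv_exp mult_ac)
  have vd: "vector_derivative (circlepath 0 1) (at t) = 2 * of_real pi * \<i> * cis (2 * pi * t)" for t
    by (simp add: vector_derivative_circlepath cis_conv_exp mult_ac)
  have "((\<lambda>u. h u / (u - 0)) has_contour_integral 2 * of_real pi * \<i> * h 0) (circlepath 0 1)"
    by (rule Cauchy_integral_circlepath) (use h in auto)
  then have "((\<lambda>t. h (circlepath 0 1 t) / circlepath 0 1 t * vector_derivative (circlepath 0 1) (at t))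
      has_integral 2 * of_real pi * \<i> * h 0) {0..1}"
    by (simp add: has_contour_integral)
  \<comment> \<open>At the centre 0, the denominator in Cauchy's formula cancels against the factor
    \<open>cis (2 * pi * t)\<close> of the derivative of the circle.\<close>
  then have "((\<lambda>t. h (cis (2 * pi * t)) * (2 * of_real pi * \<i>)) has_integral h 0 * (2 * of_real pi * \<i>)) {0..1}"
    by (simp add: cp vd mult_ac)
  then have "((\<lambda>t. h (cis (2 * pi * t)) * (2 * of_real pi * \<i>) * inverse (2 * of_real pi * \<i>)) has_integral
      h 0 * (2 * of_real pi * \<i>) * inverse (2 * of_real pi * \<i>)) {0..1}"
    by (rule has_integral_mult_left)
  moreover have k: "2 * of_real pi * \<i> \<noteq> (0::complex)" by simp
  ultimately have I: "((\<lambda>t. h (cis (2 * pi * t))) has_integral h 0) {0..1}"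
    by (simp only: mult.assoc[of _ "2 * of_real pi * \<i>" "inverse _"] right_inverse[OF k] mult_1_right)
  have cont: "continuous_on {0..1} (\<lambda>t::real. h (cis (2 * pi * t)))"
    by (intro continuous_on_compose2[OF h(1)] continuous_intros) auto
  then have c2: "((\<lambda>t. cmod (h (cis (2 * pi * t)))) has_integral integral {0..1} (\<lambda>t. cmod (h (cis (2 * pi * t))))) {0..1}"
    by (intro integrable_integral integrable_continuous_interval continuous_intros)
  from nn_integral_has_integral_lebesgue'[OF _ c2]
  have "(\<integral>\<^sup>+t. ennreal (cmod (h (cis (2 * pi * t)))) * indicator {0..1} t \<partial>lborel)
    = ennreal (integral {0..1} (\<lambda>t. cmod (h (cis (2 * pi * t)))))" by simp
  moreover have "cmod (h 0) \<le> integral {0..1} (\<lambda>t. cmod (h (cis (2 * pi * t))))"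
    using integral_norm_bound_integral[OF has_integral_integrable[OF I] has_integral_integrable[OF c2]] integral_unique[OF I] by simp
  ultimately show ?thesis by (simp add: ennreal_leI)
qed

lemma nn_integral_rotation:
  fixes F :: "complex^'n::finite \<Rightarrow> ennreal"
  assumes F: "F \<in> borel_measurable borel" and c: "cmod c = 1"
  shows "(\<integral>\<^sup>+x. F (c *s x) \<partial>lborel) = (\<integral>\<^sup>+x. F x \<partial>lborel)"
proof -
  have lin: "linear (\<lambda>x::complex^'n. b *s x)" for b
    by (rule linearI) (simp_all add: vector_add_ldistrib scaleR_eq_smult mult.commute)
  have "cnj c * c = 1" "c * cnj c = 1" using c by (simp_all add: complex_norm_square[symmetric] mult.commute[of "cnj c"])
  then show ?thesis
    by (intro nn_integral_norm_preserving[OF lin[of c] lin[of "cnj c"] _ _ _ F]) (simp_all add: norm_smult_vec c)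
qed

text \<open>The circle bound for the slice through z in direction u is integrated over u. After
  Fubini, each rotation by \<open>cis (2 * pi * t)\<close> preserves Lebesgue measure, so the inner
  integral is the same for every t.\<close>

lemma holo_mean_value:
  fixes h :: "complex^'n::finite \<Rightarrow> complex"
  assumes h: "holo_on h (cball z r)" and r: "r > 0"
  shows "ennreal (cmod (h z)) * emeasure lborel (ball z r) \<le> (\<integral>\<^sup>+w. ennreal (cmod (h w)) * indicator (ball z r) w \<partial>lborel)"
proof -
  \<comment> \<open>The indicator makes \<open>G\<close> Borel on the whole space, although
    \<open>h\<close> is known to be continuous only on the closed ball.\<close>
  define G where "G = (\<lambda>w. ennreal (indicator (ball z r) w *\<^sub>R cmod (h w)))"
  have "continuous_on (ball z r) (\<lambda>w. cmod (h w))"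
    by (intro continuous_on_norm holo_on_imp_continuous_on holo_on_subset[OF h]) auto
  then have "(\<lambda>w. indicator (ball z r) w *\<^sub>R cmod (h w)) \<in> borel_measurable borel"
    by (intro borel_measurable_continuous_on_indicator) auto
  then have G [measurable]: "G \<in> borel_measurable borel" unfolding G_def by measurable
  have Geq: "G w = ennreal (cmod (h w)) * indicator (ball z r) w" for w
    by (simp add: G_def indicator_def)
  have [measurable]: "(\<lambda>(t::real, u::complex^'n). z + cis (2 * pi * t) *s u) \<in> borel_measurable borel"
    by (intro borel_measurable_continuous_onI) (auto simp: case_prod_unfold intro!: continuous_intros)
  then have m [measurable]: "(\<lambda>(t::real, u::complex^'n). z + cis (2 * pi * t) *s u) \<in> borel_measurable (lborel \<Otimes>\<^sub>M lborel)"
    by (simp add: lborel_prod)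
  have shift: "ball z r = (\<lambda>u. z + u) ` ball 0 r" by (simp add: image_add_ball)
  have point: "ennreal (cmod (h z)) * indicator (ball 0 r) u \<le> (\<integral>\<^sup>+t. G (z + cis (2 * pi * t) *s u) * indicator {0..1} t \<partial>lborel)" for u
  proof (cases "u \<in> ball 0 r")
    case True
    have sub: "z + c *s u \<in> cball z r" if "c \<in> cball 0 1" for c
      using that True mult_mono[of "cmod c" 1 "norm u" r] by (simp add: dist_norm norm_smult_vec)
    have sub': "z + c *s u \<in> ball z r" if "c \<in> cball 0 1" for c
      using that True mult_right_mono[of "cmod c" 1 "norm u"] by (simp add: dist_norm norm_smult_vec)
    have fd: "(\<lambda>c. h (z + c *s u)) field_differentiable at c" if "c \<in> cball 0 1" for c
      using holo_on_line[OF h sub that] by simp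
    have "ennreal (cmod (h (z + 0 *s u))) \<le> (\<integral>\<^sup>+t. ennreal (cmod (h (z + cis (2 * pi * t) *s u))) * indicator {0..1} t \<partial>lborel)"
      by (rule norm_le_circle_average)
         (use fd in \<open>auto simp: holomorphic_on_def intro!: continuous_at_imp_continuous_on field_differentiable_imp_continuous_at
            intro: field_differentiable_at_within\<close>)
    also have "\<dots> = (\<integral>\<^sup>+t. G (z + cis (2 * pi * t) *s u) * indicator {0..1} t \<partial>lborel)"
      using sub' by (intro nn_integral_cong) (auto simp: Geq)
    finally show ?thesis using True by simp
  qed simp
  have "ennreal (cmod (h z)) * emeasure lborel (ball z r) = ennreal (cmod (h z)) * emeasure lborel (ball (0::complex^'n) r)"
    using r by (simp add: emeasure_ball)
  also have "\<dots> = (\<integral>\<^sup>+u. ennreal (cmod (h z)) * indicator (ball 0 r) u \<partial>(lborel :: (complex^'n) measure))"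
    by (simp add: nn_integral_cmult_indicator)
  also have "\<dots> \<le> (\<integral>\<^sup>+u. \<integral>\<^sup>+t. G (z + cis (2 * pi * t) *s u) * indicator {0..1} t \<partial>lborel \<partial>lborel)"
    by (rule nn_integral_mono) (rule point)
  also have "\<dots> = (\<integral>\<^sup>+t. \<integral>\<^sup>+u. G (z + cis (2 * pi * t) *s u) * indicator {0..1} t \<partial>lborel \<partial>lborel)"
    by (rule lborel_pair.Fubini') measurable
  also have "\<dots> = (\<integral>\<^sup>+t. (\<integral>\<^sup>+w. G w \<partial>lborel) * indicator {0..1} t \<partial>(lborel :: real measure))"
  proof (rule nn_integral_cong)
    fix t :: real
    have "(\<integral>\<^sup>+u. G (z + cis (2 * pi * t) *s u) \<partial>lborel) = (\<integral>\<^sup>+w. G w \<partial>lborel)"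
      using nn_integral_rotation[of "\<lambda>u. G (z + u)" "cis (2 * pi * t)"] nn_integral_translate_lborel[OF G, of z] by simp
    moreover have "(\<lambda>u. G (z + cis (2 * pi * t) *s u)) \<in> borel_measurable borel"
      by (rule measurable_compose[OF _ G]) (intro borel_measurable_continuous_onI continuous_intros)
    ultimately show "(\<integral>\<^sup>+u. G (z + cis (2 * pi * t) *s u) * indicator {0..1} t \<partial>lborel) = (\<integral>\<^sup>+w. G w \<partial>lborel) * indicator {0..1} t"
      by (simp add: nn_integral_multc)
  qed
  also have "\<dots> = (\<integral>\<^sup>+w. G w \<partial>lborel)"
    by (simp add: nn_integral_cmult)
  finally show ?thesis by (simp add: Geq)
qed

section \<open>Growth functions\<close>

lemma growth_fun_mono: "growth_fun \<Phi> \<Longrightarrow> 0 \<le> x \<Longrightarrow> x \<le> y \<Longrightarrow> \<Phi> x \<le> \<Phi> y"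
  unfolding growth_fun_def by (elim conjE) (rule mono_onD[of "{0..}" \<Phi>], auto)

lemma growth_fun_nonneg: "growth_fun \<Phi> \<Longrightarrow> 0 \<le> x \<Longrightarrow> 0 \<le> \<Phi> x"
  using imageI[of x "{0..}" \<Phi>] by (simp add: growth_fun_def)

lemma growth_fun_0: assumes "growth_fun \<Phi>" shows "\<Phi> 0 = 0"
proof -
  have "0 \<in> \<Phi> ` {0..}" using assms by (simp add: growth_fun_def)
  then obtain x where "x \<ge> 0" "\<Phi> x = 0" by auto
  then show ?thesis
    using growth_fun_mono[OF assms, of 0 x] growth_fun_nonneg[OF assms, of 0] by simp
qed

text \<open>Monotonicity alone would let \<Phi> vanish on an initial interval. Upper type excludes
  this: dilating such an x beyond 1 would give \<open>\<Phi> 1 = 0\<close>. Positivity is needed to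
  clear the denominator \<Phi>1.\<close>

lemma growth_fun_pos:
  assumes \<Phi>: "growth_fun \<Phi>" and "upper_type \<Phi> q" and x: "x > 0"
  shows "\<Phi> x > 0"
proof (rule ccontr)
  assume "\<not> \<Phi> x > 0"
  then have 0: "\<Phi> x = 0" using growth_fun_nonneg[OF \<Phi>, of x] x by simp
  obtain C where C: "\<And>s t. s > 0 \<Longrightarrow> t \<ge> 1 \<Longrightarrow> \<Phi> (s * t) \<le> C * t powr q * \<Phi> s"
    using assms by (auto simp: upper_type_def)
  have "1 \<le> x * max 1 (1 / x)" using x by (simp add: max_def field_simps)
  then have "\<Phi> 1 \<le> \<Phi> (x * max 1 (1 / x))" by (intro growth_fun_mono[OF \<Phi>]) auto
  also have "\<dots> \<le> 0" using C[OF x, of "max 1 (1 / x)"] 0 by simp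
  finally show False using \<Phi> by (simp add: growth_fun_def)
qed

text \<open>One type is part of the class; the other, with exponent 1, is the monotonicity of
  \<Phi>(t)/t rewritten. From here on both classes are treated alike, through their two
  types.\<close>

lemma class_L_U_types:
  assumes "\<Phi> \<in> class_L \<union> class_U"
  obtains p q where "growth_fun \<Phi>" "p > 0" "lower_type \<Phi> p" "upper_type \<Phi> q"
  using assms
proof
  assume "\<Phi> \<in> class_L"
  then obtain p where p: "p > 0" "growth_fun \<Phi>" "lower_type \<Phi> p" and anti: "antimono_on {0<..} (\<lambda>t. \<Phi> t / t)"
    by (auto simp: class_L_def class_L_p_def)
  have "\<Phi> (s * t) \<le> 1 * t powr 1 * \<Phi> s" if "s > 0" "t \<ge> 1" for s t
    using that monotone_onD[OF anti, of s "s * t"] by (simp add: field_simps)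
  then have "upper_type \<Phi> 1" unfolding upper_type_def by (intro exI[of _ 1]) auto
  with p show ?thesis by (intro that)
next
  assume "\<Phi> \<in> class_U"
  then obtain q where q: "growth_fun \<Phi>" "upper_type \<Phi> q" and mono: "mono_on {0<..} (\<lambda>t. \<Phi> t / t)"
    by (auto simp: class_U_def class_U_q_def)
  have "\<Phi> (s * t) \<le> 1 * t powr 1 * \<Phi> s" if "s > 0" "0 < t" "t \<le> 1" for s t
    using that monotone_onD[OF mono, of "s * t" s] by (simp add: field_simps)
  then have "lower_type \<Phi> 1" unfolding lower_type_def by (intro exI[of _ 1]) auto
  with q show ?thesis by (intro that[of 1 q]) simp_all
qed

text \<open>Stands in for convexity: any prescribed factor \<epsilon> is gained by shrinking the
  argument by a \<open>K\<close> that does not depend on x.\<close>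

lemma lower_type_small:
  assumes \<Phi>: "growth_fun \<Phi>" "lower_type \<Phi> p" "p > 0" and \<epsilon>: "\<epsilon> > 0"
  obtains K where "K \<ge> 1" "\<And>x. x \<ge> 0 \<Longrightarrow> \<Phi> (x / K) \<le> \<epsilon> * \<Phi> x"
proof -
  obtain C where C: "C > 0" "\<And>s t. s > 0 \<Longrightarrow> 0 < t \<Longrightarrow> t \<le> 1 \<Longrightarrow> \<Phi> (s * t) \<le> C * t powr p * \<Phi> s"
    using \<Phi>(2) by (auto simp: lower_type_def)
  \<comment> \<open>Solves C (1/K)^p = \<epsilon>; the maximum with 1 keeps 1/K in the range where
    lower type applies.\<close>
  define K where "K = max 1 ((C / \<epsilon>) powr (1 / p))"
  have K: "K \<ge> 1" by (simp add: K_def)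
  have "C / \<epsilon> = ((C / \<epsilon>) powr (1 / p)) powr p" using C(1) \<epsilon> \<Phi>(3) by (simp add: powr_powr)
  also have "\<dots> \<le> K powr p" using \<Phi>(3) by (intro powr_mono2) (auto simp: K_def)
  finally have "C * (1 / K) powr p \<le> \<epsilon>"
    using C(1) \<epsilon> K by (simp add: powr_divide field_simps)
  then have "\<Phi> (x / K) \<le> \<epsilon> * \<Phi> x" if "x \<ge> 0" for x
  proof (cases "x = 0")
    case False
    then have "\<Phi> (x * (1 / K)) \<le> C * (1 / K) powr p * \<Phi> x" using that K by (intro C) auto
    also have "\<dots> \<le> \<epsilon> * \<Phi> x"
      using \<open>C * (1 / K) powr p \<le> \<epsilon>\<close> growth_fun_nonneg[OF \<Phi>(1) that] by (intro mult_right_mono)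
    finally show ?thesis by simp
  qed (simp add: growth_fun_0[OF \<Phi>(1)])
  with K show ?thesis by (rule that)
qed

lemma upper_type_scale:
  assumes \<Phi>: "growth_fun \<Phi>" "upper_type \<Phi> q" and K: "K \<ge> 0"
  obtains C where "C > 0" "\<And>x. x \<ge> 0 \<Longrightarrow> \<Phi> (K * x) \<le> C * \<Phi> x"
proof -
  obtain C where C: "C > 0" "\<And>s t. s > 0 \<Longrightarrow> t \<ge> 1 \<Longrightarrow> \<Phi> (s * t) \<le> C * t powr q * \<Phi> s"
    using \<Phi>(2) by (auto simp: upper_type_def)
  define t where "t = max 1 \<bar>K\<bar>"
  show ?thesis
  proof (rule that[of "C * t powr q"])
    show "C * t powr q > 0" using C(1) by (simp add: t_def)
    fix x :: real assume x: "x \<ge> 0"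
    show "\<Phi> (K * x) \<le> C * t powr q * \<Phi> x"
    proof (cases "x = 0")
      case True
      then show ?thesis by (simp add: growth_fun_0[OF \<Phi>(1)])
    next
      case False
      then have "\<Phi> (K * x) \<le> \<Phi> (x * t)"
        using x K by (intro growth_fun_mono[OF \<Phi>(1)]) (auto simp: t_def mult.commute[of x] intro!: mult_right_mono)
      also have "\<dots> \<le> C * t powr q * \<Phi> x" using False x by (intro C) (auto simp: t_def)
      finally show ?thesis .
    qed
  qed
qed

text \<open>Continuity makes the set in the infimum closed, so the infimum is attained. The third
  claim needs the strict inequality: on a flat piece of \<Phi>, a point with
  \<open>\<Phi> x = y\<close> may lie above the least preimage.\<close>

lemma growth_inv:
  assumes \<Phi>: "growth_fun \<Phi>" and y: "y \<ge> 0"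
  shows growth_inv_nonneg: "0 \<le> growth_inv \<Phi> y" and growth_inv_right: "\<Phi> (growth_inv \<Phi> y) = y"
    and growth_inv_greater: "\<And>x. 0 \<le> x \<Longrightarrow> \<Phi> x < y \<Longrightarrow> x \<le> growth_inv \<Phi> y"
proof -
  let ?X = "{x. 0 \<le> x \<and> y \<le> \<Phi> x}"
  have "closed ({0..} \<inter> \<Phi> -` {y..})"
    using \<Phi> by (intro continuous_closed_preimage) (auto simp: growth_fun_def)
  moreover have "{0..} \<inter> \<Phi> -` {y..} = ?X" by auto
  ultimately have closed: "closed ?X" by simp
  have "y \<in> \<Phi> ` {0..}" using \<Phi> y by (simp add: growth_fun_def)
  then obtain x0 where x0: "x0 \<ge> 0" "\<Phi> x0 = y" by auto
  have bdd: "bdd_below ?X" by (intro bdd_belowI[of _ 0]) auto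
  have ne: "?X \<noteq> {}" using x0 by auto
  have in_X: "growth_inv \<Phi> y \<in> ?X"
    unfolding growth_inv_def by (rule closed_contains_Inf[OF ne bdd closed])
  have "growth_inv \<Phi> y \<le> x0" unfolding growth_inv_def using x0 by (intro cInf_lower bdd) auto
  then have "\<Phi> (growth_inv \<Phi> y) \<le> \<Phi> x0" using in_X by (intro growth_fun_mono[OF \<Phi>]) auto
  then show "0 \<le> growth_inv \<Phi> y" "\<Phi> (growth_inv \<Phi> y) = y" using in_X x0 by auto
  show "x \<le> growth_inv \<Phi> y" if "0 \<le> x" "\<Phi> x < y" for x
    using in_X that growth_fun_mono[OF \<Phi>, of "growth_inv \<Phi> y" x] by (cases "x \<le> growth_inv \<Phi> y") auto
qed

lemma growth_inv_pos:
  assumes "growth_fun \<Phi>" "y > 0" shows "growth_inv \<Phi> y > 0"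
  using growth_inv(1,2)[OF assms(1), of y] growth_fun_0[OF assms(1)] assms(2)
  by (cases "growth_inv \<Phi> y = 0") auto

text \<open>Lower type is invoked with 1/(2C), not 1/C: the spare factor 2 yields the strict
  inequality that \<open>growth_inv_greater\<close> demands.\<close>

lemma le_growth_inv:
  assumes \<Phi>: "growth_fun \<Phi>" "lower_type \<Phi> p" "p > 0" and C: "C > 0"
  obtains K where "K \<ge> 1" "\<And>x y. x \<ge> 0 \<Longrightarrow> y > 0 \<Longrightarrow> \<Phi> x \<le> C * y \<Longrightarrow> x \<le> K * growth_inv \<Phi> y"
proof -
  obtain K where K: "K \<ge> 1" "\<And>x. x \<ge> 0 \<Longrightarrow> \<Phi> (x / K) \<le> 1 / (2 * C) * \<Phi> x"
    using lower_type_small[OF \<Phi>, of "1 / (2 * C)"] C by auto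
  have "x \<le> K * growth_inv \<Phi> y" if "x \<ge> 0" "y > 0" "\<Phi> x \<le> C * y" for x y
  proof -
    have "\<Phi> (x / K) \<le> 1 / (2 * C) * \<Phi> x" using K that by simp
    also have "\<dots> \<le> 1 / (2 * C) * (C * y)" using that C by (intro mult_left_mono) auto
    also have "\<dots> < y" using C that by simp
    finally have "x / K \<le> growth_inv \<Phi> y" using that K by (intro growth_inv(3)[OF \<Phi>(1)]) auto
    then show ?thesis using K by (simp add: field_simps)
  qed
  with K(1) show ?thesis by (rule that)
qed

text \<open>No subharmonicity of powers of \<open>|h|\<close> is needed: at a maximum point \<open>u0\<close> of
  \<open>(1 - |u|) powr (2n/p) * |h u|\<close> the function is bounded by a multiple of \<open>M = |h u0|\<close> on a ball of
  radius comparable to \<open>1 - |u0|\<close>, so the mean value property forces \<open>|h| > M / 2\<close> on a fixed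
  proportion of that ball.\<close>

lemma growth_subharmonic:
  assumes \<Phi>: "growth_fun \<Phi>" "lower_type \<Phi> p" "p > 0"
  obtains C where "C > 0" "\<And>h :: complex^'n::finite \<Rightarrow> complex. holo_on h (cball 0 1) \<Longrightarrow>
    ennreal (\<Phi> (cmod (h 0) / 2)) \<le> ennreal C * (\<integral>\<^sup>+w. ennreal (\<Phi> (cmod (h w))) * indicator (ball 0 1) w \<partial>lborel)"
proof -
  obtain C0 where C0: "C0 > 0" "\<And>s t. s > 0 \<Longrightarrow> 0 < t \<Longrightarrow> t \<le> 1 \<Longrightarrow> \<Phi> (s * t) \<le> C0 * t powr p * \<Phi> s"
    using \<Phi>(2) by (auto simp: lower_type_def)
  define n where "n = CARD('n)"
  have n: "n > 0" by (simp add: n_def)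
  \<comment> \<open>Chosen so that lower type turns the weight (2\<rho>)^\<kappa> into
    (2\<rho>)^(2n), which is proportional to the volume of a ball of radius \<rho> in real dimension
    2n.\<close>
  define \<kappa> where "\<kappa> = 2 * real n / p"
  have \<kappa>: "\<kappa> > 0" using n \<Phi>(3) by (simp add: \<kappa>_def)
  \<comment> \<open>On the ball about \<open>u0\<close> the distance to the sphere is at least
    \<rho>, against 2\<rho> at \<open>u0\<close>; so maximality loses a factor 2^\<kappa>.\<close>
  define K where "K = 2 powr \<kappa>"
  have K: "K > 0" by (simp add: K_def)
  define \<beta> where "\<beta> = measure lborel (ball (0::complex^'n) 1)"
  have \<beta>: "\<beta> > 0" by (simp add: \<beta>_def)
  define C where "C = C0 * 4 ^ n * (2 * K / \<beta>)"
  have C: "C > 0" using C0 K \<beta> by (simp add: C_def)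
  have "ennreal (\<Phi> (cmod (h 0) / 2)) \<le> ennreal C * (\<integral>\<^sup>+w. ennreal (\<Phi> (cmod (h w))) * indicator (ball 0 1) w \<partial>lborel)"
    if h: "holo_on h (cball 0 1)" for h :: "complex^'n \<Rightarrow> complex"
  proof (cases "h 0 = 0")
    case False
    define H where "H = (\<lambda>u::complex^'n. (1 - norm u) powr \<kappa> * cmod (h u))"
    have "continuous_on (cball 0 1) H"
      unfolding H_def using holo_on_imp_continuous_on[OF h] \<kappa>
      by (intro continuous_on_mult continuous_on_powr' continuous_on_norm continuous_on_diff continuous_on_const continuous_on_id) auto
    then obtain u0 where u0: "u0 \<in> cball 0 1" "\<And>u. u \<in> cball 0 1 \<Longrightarrow> H u \<le> H u0"
      using continuous_attains_sup[of "cball 0 1" H] by (auto simp: compact_cball)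
    define M where "M = cmod (h u0)"
    define \<rho> where "\<rho> = (1 - norm u0) / 2"
    have H0: "cmod (h 0) \<le> H u0" using u0(2)[of 0] by (simp add: H_def)
    then have "H u0 > 0" using False zero_less_norm_iff[of "h 0"] by linarith
    then have M: "M > 0" and "norm u0 \<noteq> 1" by (auto simp: H_def M_def zero_less_mult_iff)
    then have \<rho>: "\<rho> > 0" "2 * \<rho> \<le> 1" using u0(1) by (auto simp: \<rho>_def)
    have two\<rho>: "2 * \<rho> = 1 - norm u0" by (simp add: \<rho>_def)
    define B where "B = ball u0 \<rho>"
    have norm_B: "norm w \<le> 1 - \<rho>" if "w \<in> cball u0 \<rho>" for w
      using that norm_triangle_ineq2[of w u0] by (simp add: dist_norm norm_minus_commute \<rho>_def field_simps)
    have sub1: "cball u0 \<rho> \<subseteq> ball 0 1"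
    proof
      fix w assume "w \<in> cball u0 \<rho>"
      from norm_B[OF this] \<rho> show "w \<in> ball 0 1" by simp
    qed
    then have sub: "cball u0 \<rho> \<subseteq> cball 0 1" using ball_subset_cball by blast
    have B: "B \<subseteq> ball 0 1" using sub1 ball_subset_cball by (auto simp: B_def)
    have bound: "cmod (h w) \<le> K * M" if "w \<in> B" for w
    proof -
      have "\<rho> \<le> 1 - norm w" using norm_B[of w] that by (auto simp: B_def)
      have "\<rho> powr \<kappa> * cmod (h w) \<le> H w"
        unfolding H_def using \<open>\<rho> \<le> 1 - norm w\<close> \<rho> \<kappa> by (intro mult_right_mono powr_mono2) auto
      also have "\<dots> \<le> (2 * \<rho>) powr \<kappa> * M" using u0(2)[of w] that sub by (force simp: H_def M_def two\<rho> B_def subset_eq)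
      finally show ?thesis using \<rho> by (simp add: K_def powr_mult)
    qed
    define E where "E = {w \<in> B. cmod (h w) > M / 2}"
    have "open (B \<inter> (\<lambda>w. cmod (h w)) -` {M / 2<..})"
      by (rule continuous_open_preimage)
         (auto simp: B_def intro!: continuous_on_norm holo_on_imp_continuous_on holo_on_subset[OF h] subset_trans[OF ball_subset_cball sub])
    moreover have "B \<inter> (\<lambda>w. cmod (h w)) -` {M / 2<..} = E" by (auto simp: E_def)
    ultimately have "open E" by simp
    then have Em [measurable]: "E \<in> sets borel" by simp
    have Bm [measurable]: "B \<in> sets borel" by (simp add: B_def)
    define b where "b = measure lborel B"
    define e where "e = measure lborel E"
    have "bounded B" "E \<subseteq> B" by (auto simp: B_def E_def)
    then have "bounded E" by (rule bounded_subset)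
    have be: "emeasure lborel B = ennreal b" "emeasure lborel E = ennreal e"
      using emeasure_bounded_finite[OF \<open>bounded B\<close>] emeasure_bounded_finite[OF \<open>bounded E\<close>]
      by (auto simp: b_def e_def emeasure_eq_ennreal_measure)
    have e0: "e \<ge> 0" "b \<ge> 0" by (simp_all add: e_def b_def)
    have b_eq: "b = \<rho> ^ (2 * n) * \<beta>"
      using \<rho> by (simp add: b_def B_def \<beta>_def content_ball n_def mult.commute)
    \<comment> \<open>|h| is at most M/2 off \<open>E\<close> and at most K M on it, so M b is at
      most M b / 2 + K M e, that is, e is at least b / (2K).\<close>
    have "ennreal (M * b) = ennreal M * emeasure lborel B" using M e0 by (simp add: be ennreal_mult)
    also have "\<dots> \<le> (\<integral>\<^sup>+w. ennreal (cmod (h w)) * indicator B w \<partial>lborel)"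
      unfolding M_def B_def by (rule holo_mean_value[OF holo_on_subset[OF h sub] \<rho>(1)])
    also have "\<dots> \<le> (\<integral>\<^sup>+w. ennreal (M / 2) * indicator B w + ennreal (K * M) * indicator E w \<partial>lborel)"
    proof (rule nn_integral_mono)
      fix w
      show "ennreal (cmod (h w)) * indicator B w \<le> ennreal (M / 2) * indicator B w + ennreal (K * M) * indicator E w"
        using bound[of w] M K by (auto simp: indicator_def E_def ennreal_plus[symmetric] simp del: ennreal_plus intro!: ennreal_leI)
    qed
    also have "\<dots> = ennreal (M / 2) * ennreal b + ennreal (K * M) * ennreal e"
      by (simp add: nn_integral_add nn_integral_cmult_indicator be)
    also have "\<dots> = ennreal (M / 2 * b + K * M * e)"
      using M K e0 by (simp add: ennreal_mult[symmetric] ennreal_plus[symmetric] del: ennreal_plus)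
    finally have "M * b \<le> M / 2 * b + K * M * e"
      using M K e0 by (subst (asm) ennreal_le_iff) auto
    then have "M * b \<le> M * (2 * K * e)" by (simp add: algebra_simps)
    then have be_le: "b \<le> 2 * K * e" using M by simp
    \<comment> \<open>The halving on the left matches the threshold M/2 that defines
      \<open>E\<close>; lower type is then applied at s = M/2, where \<Phi> is a lower bound for
      \<Phi>(|h|) on \<open>E\<close>.\<close>
    have "cmod (h 0) / 2 \<le> (M / 2) * (2 * \<rho>) powr \<kappa>"
      using H0 unfolding H_def M_def two\<rho> by (simp add: mult.commute)
    then have "\<Phi> (cmod (h 0) / 2) \<le> \<Phi> ((M / 2) * (2 * \<rho>) powr \<kappa>)"
      by (intro growth_fun_mono[OF \<Phi>(1)]) auto
    also have "\<dots> \<le> C0 * ((2 * \<rho>) powr \<kappa>) powr p * \<Phi> (M / 2)"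
      using M \<rho> \<kappa> by (intro C0) (auto intro!: powr_le1)
    also have "((2 * \<rho>) powr \<kappa>) powr p = (2 * \<rho>) ^ (2 * n)"
      using \<Phi>(3) \<rho> powr_realpow[of "2 * \<rho>" "2 * n"] by (simp add: powr_powr \<kappa>_def)
    also have "C0 * (2 * \<rho>) ^ (2 * n) * \<Phi> (M / 2) = C0 * 4 ^ n / \<beta> * b * \<Phi> (M / 2)"
      using \<beta> by (simp add: b_eq power_mult_distrib power_mult)
    also have "\<dots> \<le> C0 * 4 ^ n / \<beta> * (2 * K * e) * \<Phi> (M / 2)"
      using C0 \<beta> be_le M by (intro mult_right_mono mult_left_mono growth_fun_nonneg[OF \<Phi>(1)]) auto
    also have "\<dots> = C * (\<Phi> (M / 2) * e)" by (simp add: C_def)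
    finally have "ennreal (\<Phi> (cmod (h 0) / 2)) \<le> ennreal (C * (\<Phi> (M / 2) * e))"
      by (rule ennreal_leI)
    also have "\<dots> = ennreal C * (ennreal (\<Phi> (M / 2)) * emeasure lborel E)"
      using C M e0 growth_fun_nonneg[OF \<Phi>(1), of "M / 2"] by (simp add: be ennreal_mult)
    also have "ennreal (\<Phi> (M / 2)) * emeasure lborel E = (\<integral>\<^sup>+w. ennreal (\<Phi> (M / 2)) * indicator E w \<partial>lborel)"
      by (simp add: nn_integral_cmult_indicator)
    also have "\<dots> \<le> (\<integral>\<^sup>+w. ennreal (\<Phi> (cmod (h w))) * indicator (ball 0 1) w \<partial>lborel)"
    proof (rule nn_integral_mono)
      fix w
      have "\<Phi> (M / 2) \<le> \<Phi> (cmod (h w))" if "w \<in> E"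
        using that M by (intro growth_fun_mono[OF \<Phi>(1)]) (auto simp: E_def)
      then show "ennreal (\<Phi> (M / 2)) * indicator E w \<le> ennreal (\<Phi> (cmod (h w))) * indicator (ball 0 1) w"
        using B \<open>E \<subseteq> B\<close> by (auto simp: indicator_def ennreal_leI)
    qed
    finally show ?thesis by (meson mult_left_mono zero_le)
  qed (simp add: growth_fun_0[OF \<Phi>(1)])
  with C show ?thesis by (rule that)
qed

section \<open>The pointwise estimate\<close>

lemma borel_measurable_bergman_weight [measurable]: "bergman_weight \<alpha> \<in> borel_measurable borel"
  unfolding bergman_weight_def[abs_def] mem_ball_0 by measurable

lemma bergman_weight_nonneg: "0 \<le> bergman_weight \<alpha> z"
  by (simp add: bergman_weight_def)

text \<open>The modular stripped of its normalizing constant and written against Lebesgue measure,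
  ready for linear changes of variables.\<close>

definition weighted_integral :: "(real \<Rightarrow> real) \<Rightarrow> real \<Rightarrow> (complex^'n::finite \<Rightarrow> complex) \<Rightarrow> ennreal" where
  "weighted_integral \<Phi> \<alpha> f = (\<integral>\<^sup>+z. ennreal (\<Phi> (cmod (f z))) * ennreal (bergman_weight \<alpha> z) \<partial>lborel)"

lemma continuous_on_growth_comp:
  assumes "growth_fun \<Phi>" "continuous_on S f"
  shows "continuous_on S (\<lambda>z. \<Phi> (cmod (f z)))"
  using assms by (intro continuous_on_compose2[of "{0..}" \<Phi> S] continuous_on_norm) (auto simp: growth_fun_def)

lemma borel_measurable_growth_comp:
  fixes f :: "complex^'n::finite \<Rightarrow> complex"
  assumes "growth_fun \<Phi>" "continuous_on (ball 0 1) f"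
  shows "(\<lambda>z. indicator (ball 0 1) z *\<^sub>R \<Phi> (cmod (f z))) \<in> borel_measurable borel"
  by (intro borel_measurable_continuous_on_indicator continuous_on_growth_comp assms) simp

text \<open>Nothing is known about f outside the ball, not even measurability. Since the weight
  vanishes there, an indicator may be inserted, and the integrand becomes Borel.\<close>

lemma growth_comp_weight:
  "ennreal (\<Phi> (cmod (f z))) * ennreal (bergman_weight \<alpha> z)
    = ennreal (indicator (ball 0 1) z *\<^sub>R \<Phi> (cmod (f z))) * ennreal (bergman_weight \<alpha> z)"
  by (simp add: bergman_weight_def indicator_def)

lemma borel_measurable_weighted_integrand:
  fixes f :: "complex^'n::finite \<Rightarrow> complex"
  assumes "growth_fun \<Phi>" "continuous_on (ball 0 1) f"
  shows "(\<lambda>z. ennreal (\<Phi> (cmod (f z))) * ennreal (bergman_weight \<alpha> z)) \<in> borel_measurable borel"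
proof -
  note [measurable] = borel_measurable_growth_comp[OF assms]
  show ?thesis unfolding growth_comp_weight[of \<Phi> f _ \<alpha>] by measurable
qed

lemma modular_eq_weighted_integral:
  fixes f :: "complex^'n::finite \<Rightarrow> complex"
  assumes "growth_fun \<Phi>" "continuous_on (ball 0 1) f"
  shows "modular \<Phi> \<alpha> f = ennreal (bergman_const \<alpha> TYPE('n)) * weighted_integral \<Phi> \<alpha> f"
proof -
  note [measurable] = borel_measurable_growth_comp[OF assms]
  define c where "c = bergman_const \<alpha> TYPE('n)"
  have c: "c \<ge> 0" by (simp add: c_def bergman_const_def)
  have m: "(\<lambda>z. ennreal (\<Phi> (cmod (f z)) * indicat_real (ball 0 1) z)) \<in> borel_measurable borel"
    using measurable_compose[OF borel_measurable_growth_comp[OF assms] measurable_ennreal] by (simp add: mult.commute)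
  have "AE z in nu \<alpha>. z \<in> (ball 0 1 :: (complex^'n) set)"
    unfolding nu_def by (subst AE_density) (auto simp: bergman_weight_def)
  then have "modular \<Phi> \<alpha> f = (\<integral>\<^sup>+z. ennreal (indicator (ball 0 1) z *\<^sub>R \<Phi> (cmod (f z))) \<partial>nu \<alpha>)"
    unfolding modular_def by (intro nn_integral_cong_AE) auto
  also have "\<dots> = (\<integral>\<^sup>+z. ennreal c * (ennreal (\<Phi> (cmod (f z))) * ennreal (bergman_weight \<alpha> z)) \<partial>lborel)"
    unfolding nu_def growth_comp_weight[of \<Phi> f _ \<alpha>]
    by (subst nn_integral_density) (auto simp: c_def[symmetric] c ennreal_mult bergman_weight_nonneg mult_ac m)
  also have "\<dots> = ennreal c * weighted_integral \<Phi> \<alpha> f"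
    unfolding weighted_integral_def
    by (rule nn_integral_cmult) (simp add: borel_measurable_weighted_integrand assms)
  finally show ?thesis by (simp add: c_def)
qed

lemma unit_direction:
  fixes z :: "'a::euclidean_space"
  obtains \<zeta> where "norm \<zeta> = 1" "z = norm z *\<^sub>R \<zeta>"
proof (cases "z = 0")
  case True
  obtain b :: 'a where "b \<in> Basis" using nonempty_Basis by blast
  then show ?thesis using True that[of b] by simp
next
  case False
  then show ?thesis using that[of "sgn z"] by (simp add: norm_sgn sgn_div_norm)
qed

text \<open>The exponent may have either sign, so the smaller of the two endpoint powers is taken as
  the constant.\<close>

lemma powr_bounded_quotient:
  fixes \<alpha> :: real
  assumes "0 < a" "a \<le> b"
  obtains c where "c > 0" "\<And>x y. y > 0 \<Longrightarrow> a * y \<le> x \<Longrightarrow> x \<le> b * y \<Longrightarrow> c * y powr \<alpha> \<le> x powr \<alpha>"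
proof
  show "min (a powr \<alpha>) (b powr \<alpha>) > 0" using assms by simp
  fix x y :: real assume y: "y > 0" and x: "a * y \<le> x" "x \<le> b * y"
  have "0 < a * y" using assms y by simp
  then have x0: "x > 0" using x by linarith
  show "min (a powr \<alpha>) (b powr \<alpha>) * y powr \<alpha> \<le> x powr \<alpha>"
  proof (cases "\<alpha> \<ge> 0")
    case True
    have "min (a powr \<alpha>) (b powr \<alpha>) * y powr \<alpha> \<le> (a * y) powr \<alpha>"
      using assms y by (simp add: powr_mult mult_right_mono)
    also have "\<dots> \<le> x powr \<alpha>" using x True \<open>0 < a * y\<close> by (intro powr_mono2) auto
    finally show ?thesis .
  next
    case False
    have "min (a powr \<alpha>) (b powr \<alpha>) * y powr \<alpha> \<le> (b * y) powr \<alpha>"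
      using assms y by (simp add: powr_mult mult_right_mono)
    also have "\<dots> \<le> x powr \<alpha>" using x False x0 by (intro powr_mono2') auto
    finally show ?thesis .
  qed
qed

text \<open>The function is pulled back from the ellipsoid about z to the unit ball, where
  \<open>growth_subharmonic\<close> applies at the centre. Transforming back divides by the
  Jacobian, of order \<delta>^(n+1), and by the weight, of order \<delta>^\<alpha>.\<close>

lemma weighted_pointwise_bound:
  assumes \<Phi>: "growth_fun \<Phi>" "lower_type \<Phi> p" "p > 0"
  obtains C where "C > 0" "\<And>(f :: complex^'n::finite \<Rightarrow> complex) z. holo_on f (ball 0 1) \<Longrightarrow> z \<in> ball 0 1 \<Longrightarrow>
    ennreal (\<Phi> (cmod (f z) / 2)) \<le>
      ennreal (C * (1 - (norm z)\<^sup>2) powr (- (real CARD('n) + 1 + \<alpha>))) * weighted_integral \<Phi> \<alpha> f"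
proof -
  obtain C1 where C1: "C1 > 0" "\<And>h :: complex^'n \<Rightarrow> complex. holo_on h (cball 0 1) \<Longrightarrow>
    ennreal (\<Phi> (cmod (h 0) / 2)) \<le> ennreal C1 * (\<integral>\<^sup>+w. ennreal (\<Phi> (cmod (h w))) * indicator (ball 0 1) w \<partial>lborel)"
    using growth_subharmonic[OF \<Phi>, where 'n='n] by blast
  obtain c where c: "c > 0" "\<And>x y. y > 0 \<Longrightarrow> (1/4) * y \<le> x \<Longrightarrow> x \<le> 2 * y \<Longrightarrow> c * y powr \<alpha> \<le> x powr \<alpha>"
    using powr_bounded_quotient[of "1/4" 2 \<alpha>] by auto
  define n where "n = CARD('n)"
  define C where "C = C1 * (16 ^ n / c)"
  have C: "C > 0" using C1 c by (simp add: C_def)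
  have "ennreal (\<Phi> (cmod (f z) / 2)) \<le>
      ennreal (C * (1 - (norm z)\<^sup>2) powr (- (real CARD('n) + 1 + \<alpha>))) * weighted_integral \<Phi> \<alpha> f"
    if f: "holo_on f (ball 0 1)" and z: "z \<in> ball 0 1" for f :: "complex^'n \<Rightarrow> complex" and z
  proof -
    obtain \<zeta> where \<zeta>: "norm \<zeta> = 1" "z = norm z *\<^sub>R \<zeta>" by (rule unit_direction)
    define \<delta> where "\<delta> = 1 - (norm z)\<^sup>2"
    have \<delta>: "\<delta> > 0" "\<delta> \<le> 1" using z by (auto simp: \<delta>_def power_less_one_iff)
    define s t where "s = \<delta> / 4" and "t = sqrt \<delta> / 4"
    have st: "s > 0" "t > 0" using \<delta> by (auto simp: s_def t_def)
    have t2: "t\<^sup>2 = \<delta> / 16" using \<delta> by (simp add: t_def power_divide)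
    have s2: "s\<^sup>2 \<le> t\<^sup>2" using \<delta> by (simp add: t2 s_def power_divide) (simp add: power2_eq_square)
    \<comment> \<open>The term 2 Re<z, e> in |z + e|^2 sees only the component of e along z, which
      is at most s = \<delta>/4, while |e|^2 is at most t^2 = \<delta>/16. Hence 1 - |z + e|^2 stays
      comparable to \<delta>, although e itself may be as long as sqrt \<delta> / 4.\<close>
    have key: "(1/4) * \<delta> \<le> 1 - (norm (z + ellip \<zeta> s t u))\<^sup>2 \<and> 1 - (norm (z + ellip \<zeta> s t u))\<^sup>2 \<le> 2 * \<delta>"
      if u: "u \<in> cball 0 1" for u
    proof -
      have u1: "norm u \<le> 1" using u by simp
      have cu: "cmod (cdot u \<zeta>) \<le> 1" using norm_cdot_le[of u \<zeta>] \<zeta> u1 by simp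
      have cu': "(cmod (cdot u \<zeta>))\<^sup>2 \<le> (norm u)\<^sup>2" using norm_cdot_le[of u \<zeta>] \<zeta> by (simp add: power_mono)
      have "(norm (ellip \<zeta> s t u))\<^sup>2 = s\<^sup>2 * (cmod (cdot u \<zeta>))\<^sup>2 + t\<^sup>2 * ((norm u)\<^sup>2 - (cmod (cdot u \<zeta>))\<^sup>2)"
        by (rule norm_ellip[OF \<zeta>(1)])
      also have "\<dots> \<le> t\<^sup>2 * (cmod (cdot u \<zeta>))\<^sup>2 + t\<^sup>2 * ((norm u)\<^sup>2 - (cmod (cdot u \<zeta>))\<^sup>2)"
        using s2 by (intro add_right_mono mult_right_mono) auto
      also have "\<dots> = t\<^sup>2 * (norm u)\<^sup>2" by (simp add: algebra_simps)
      also have "\<dots> \<le> t\<^sup>2 * 1" using u1 by (intro mult_left_mono) (auto simp: power_le_one)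
      finally have e: "(norm (ellip \<zeta> s t u))\<^sup>2 \<le> \<delta> / 16" by (simp add: t2)
      have "cdot z (ellip \<zeta> s t u) = norm z * cnj (s * cdot u \<zeta>)"
        by (subst \<zeta>(2)) (simp add: cdot_simps cdot_commute[of \<zeta>] cdot_ellip[OF \<zeta>(1)] scaleR_conv_of_real[where 'a=complex])
      then have "cmod (cdot z (ellip \<zeta> s t u)) = norm z * s * cmod (cdot u \<zeta>)"
        using st by (simp add: norm_mult)
      also have "\<dots> \<le> 1 * s * 1" using z cu st by (intro mult_mono) auto
      finally have "\<bar>Re (cdot z (ellip \<zeta> s t u))\<bar> \<le> \<delta> / 4"
        using abs_Re_le_cmod[of "cdot z (ellip \<zeta> s t u)"] by (simp add: s_def)
      moreover have "(norm (z + ellip \<zeta> s t u))\<^sup>2 = (norm z)\<^sup>2 + 2 * Re (cdot z (ellip \<zeta> s t u)) + (norm (ellip \<zeta> s t u))\<^sup>2"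
        by (rule norm_add_square)
      moreover have "(1/4) * d \<le> 1 - w" "1 - w \<le> 2 * d"
        if "d = 1 - y" "\<bar>r\<bar> \<le> d / 4" "w = y + 2 * r + e" "0 \<le> e" "e \<le> d / 16" for d y w r e :: real
        using that by linarith+
      ultimately show ?thesis using e zero_le_power2[of "norm (ellip \<zeta> s t u)"] \<delta>_def by blast
    qed
    have in_ball: "z + ellip \<zeta> s t u \<in> ball 0 1" if "u \<in> cball 0 1" for u
    proof -
      have "(norm (z + ellip \<zeta> s t u))\<^sup>2 < 1" using key[OF that] \<delta> by linarith
      then show ?thesis by (simp add: power_less_one_iff abs_square_less_1)
    qed
    define h where "h = (\<lambda>u. f (z + ellip \<zeta> s t u))"
    have "holo_on h (cball 0 1)"
      unfolding h_def by (rule holo_on_affine[OF f linear_ellip ellip_smult in_ball])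
    from C1(2)[OF this] have 1: "ennreal (\<Phi> (cmod (f z) / 2)) \<le> ennreal C1 * (\<integral>\<^sup>+u. ennreal (\<Phi> (cmod (h u))) * indicator (ball 0 1) u \<partial>lborel)"
      by (simp add: h_def linear_0[OF linear_ellip])
    define F where "F = (\<lambda>w. ennreal (\<Phi> (cmod (f w))) * ennreal (bergman_weight \<alpha> w))"
    have F [measurable]: "F \<in> borel_measurable borel"
      unfolding F_def by (intro borel_measurable_weighted_integrand \<Phi> holo_on_imp_continuous_on f)
    define k where "k = 1 / (c * \<delta> powr \<alpha>)"
    have k: "k > 0" using c \<delta> by (simp add: k_def)
    have "continuous_on UNIV (\<lambda>u. z + ellip \<zeta> s t u)"
      using linear_ellip[of \<zeta> s t] by (intro continuous_intros) (simp add: linear_continuous_on linear_conv_bounded_linear)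
    then have [measurable]: "(\<lambda>u. z + ellip \<zeta> s t u) \<in> borel_measurable borel" by (rule borel_measurable_continuous_onI)
    have "(\<integral>\<^sup>+u. ennreal (\<Phi> (cmod (h u))) * indicator (ball 0 1) u \<partial>lborel) \<le> (\<integral>\<^sup>+u. ennreal k * F (z + ellip \<zeta> s t u) \<partial>lborel)"
    proof (rule nn_integral_mono)
      fix u :: "complex^'n"
      show "ennreal (\<Phi> (cmod (h u))) * indicator (ball 0 1) u \<le> ennreal k * F (z + ellip \<zeta> s t u)"
      proof (cases "u \<in> ball 0 1")
        case True
        then have u: "u \<in> cball 0 1" by simp
        have "c * \<delta> powr \<alpha> \<le> bergman_weight \<alpha> (z + ellip \<zeta> s t u)"
          using in_ball[OF u] key[OF u] c(2)[OF \<delta>(1)] by (simp add: bergman_weight_def)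
        then have "1 \<le> k * bergman_weight \<alpha> (z + ellip \<zeta> s t u)"
          using c \<delta> by (simp add: k_def field_simps)
        then have "\<Phi> (cmod (h u)) \<le> \<Phi> (cmod (h u)) * (k * bergman_weight \<alpha> (z + ellip \<zeta> s t u))"
          using growth_fun_nonneg[OF \<Phi>(1), of "cmod (h u)"] by (simp add: mult_le_cancel_left1)
        then have "ennreal (\<Phi> (cmod (h u))) \<le> ennreal (k * (\<Phi> (cmod (h u)) * bergman_weight \<alpha> (z + ellip \<zeta> s t u)))"
          by (intro ennreal_leI) (simp add: mult_ac)
        also have "\<dots> = ennreal k * F (z + ellip \<zeta> s t u)"
          using k growth_fun_nonneg[OF \<Phi>(1), of "cmod (h u)"] bergman_weight_nonneg[of \<alpha> "z + ellip \<zeta> s t u"]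
          by (simp add: F_def ennreal_mult h_def)
        finally show ?thesis using True by simp
      qed simp
    qed
    also have "\<dots> = ennreal k * (\<integral>\<^sup>+u. F (z + ellip \<zeta> s t u) \<partial>lborel)" by (simp add: nn_integral_cmult)
    finally have 2: "(\<integral>\<^sup>+u. ennreal (\<Phi> (cmod (h u))) * indicator (ball 0 1) u \<partial>lborel) \<le> \<dots>" .
    have J: "(s / t)\<^sup>2 * t ^ (2 * CARD('n)) = \<delta> ^ (n + 1) / 16 ^ n"
      using \<delta> by (simp add: power_mult t2 power_divide n_def) (simp add: s_def t_def power_divide power2_eq_square field_simps)
    define j where "j = 16 ^ n / \<delta> ^ (n + 1)"
    have j: "j > 0" "j * (\<delta> ^ (n + 1) / 16 ^ n) = 1" using \<delta> by (simp_all add: j_def)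
    have "(\<integral>\<^sup>+u. F (z + ellip \<zeta> s t u) \<partial>lborel) = ennreal j * (ennreal (\<delta> ^ (n + 1) / 16 ^ n) * (\<integral>\<^sup>+u. F (z + ellip \<zeta> s t u) \<partial>lborel))"
      unfolding mult.assoc[symmetric] using j \<delta> by (simp add: ennreal_mult[symmetric] del: power_Suc)
    also have "\<dots> = ennreal j * weighted_integral \<Phi> \<alpha> f"
      using nn_integral_ellip[OF \<zeta>(1) st F, of z] unfolding J by (simp add: weighted_integral_def F_def)
    finally have 3: "(\<integral>\<^sup>+u. F (z + ellip \<zeta> s t u) \<partial>lborel) = ennreal j * weighted_integral \<Phi> \<alpha> f" .
    have pw: "\<delta> powr (- (real CARD('n) + 1 + \<alpha>)) = 1 / (\<delta> ^ (n + 1) * \<delta> powr \<alpha>)"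
    proof -
      have "\<delta> powr (real CARD('n) + 1 + \<alpha>) = \<delta> powr real (n + 1) * \<delta> powr \<alpha>"
        by (simp add: powr_add[symmetric] n_def add_ac)
      also have "\<delta> powr real (n + 1) = \<delta> ^ (n + 1)" using \<delta> by (intro powr_realpow)
      finally show ?thesis by (simp only: powr_minus_divide)
    qed
    have "ennreal (\<Phi> (cmod (f z) / 2)) \<le> ennreal C1 * (ennreal k * (ennreal j * weighted_integral \<Phi> \<alpha> f))"
      by (rule order_trans[OF 1 mult_left_mono[OF 2[unfolded 3]]]) simp
    also have "\<dots> = ennreal (C1 * k * j) * weighted_integral \<Phi> \<alpha> f"
      using C1 k j by (simp add: ennreal_mult mult.assoc)
    also have "C1 * k * j = C * \<delta> powr (- (real CARD('n) + 1 + \<alpha>))"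
      unfolding pw by (simp add: C_def k_def j_def)
    finally show ?thesis by (simp add: \<delta>_def)
  qed
  with C show ?thesis by (rule that)
qed

section \<open>The Forelli--Rudin estimate\<close>

text \<open>As \<alpha> < 0, moving the singularity from \<open>c\<close> up to the left end
  \<open>m\<close> of the effective interval only increases the integrand. What remains is the
  integral of t^\<alpha> over a segment of length at most r, finite because \<alpha> > -1.\<close>

lemma nn_integral_powr_shift_le:
  assumes \<alpha>: "-1 < \<alpha>" "\<alpha> < 0" and r: "0 < r" and c: "c \<ge> 0"
  shows "(\<integral>\<^sup>+t. ennreal ((t - c) powr \<alpha>) * indicator ({1 - r<..1} \<inter> {c<..}) t \<partial>lborel) \<le> ennreal (r powr (\<alpha> + 1) / (\<alpha> + 1))"
proof -
  define m where "m = max c (1 - r)"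
  show ?thesis
  proof (cases "m \<le> 1")
    case True
    have "(\<integral>\<^sup>+t. ennreal ((t - c) powr \<alpha>) * indicator ({1 - r<..1} \<inter> {c<..}) t \<partial>lborel)
      \<le> (\<integral>\<^sup>+t. ennreal ((t - m) powr \<alpha>) * indicator {m..1} t \<partial>lborel)"
      using \<alpha> by (intro nn_integral_mono) (auto simp: indicator_def m_def intro!: ennreal_leI powr_mono2')
    also have "\<dots> = (\<integral>\<^sup>+t. ennreal (((m + t) - m) powr \<alpha>) * indicator {m..1} (m + t) \<partial>lborel)"
      by (rule nn_integral_translate_lborel[symmetric]) measurable
    also have "\<dots> = (\<integral>\<^sup>+t. ennreal (t powr \<alpha>) * indicator {0..1 - m} t \<partial>lborel)"
      by (intro nn_integral_cong) (auto simp: indicator_def)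
    also have "\<dots> = ennreal ((1 - m) powr (\<alpha> + 1) / (\<alpha> + 1))"
      using nn_integral_has_integral_lebesgue'[OF _ has_integral_powr_from_0[of \<alpha> "1 - m"]] \<alpha> True by simp
    also have "\<dots> \<le> ennreal (r powr (\<alpha> + 1) / (\<alpha> + 1))"
      using \<alpha> True by (intro ennreal_leI divide_right_mono powr_mono2) (auto simp: m_def)
    finally show ?thesis .
  next
    case False
    then have "{1 - r<..1} \<inter> {c<..} = {}" using r by (auto simp: m_def)
    then show ?thesis by simp
  qed
qed

text \<open>For negative exponents the weight is singular at the sphere; averaging over the dilations
  by \<open>t \<in> [1 - r, 1]\<close> replaces it by its mean over a radial segment of length \<open>r\<close>.\<close>

lemma weight_dilation_average:
  fixes S S' :: "(complex^'n::finite) set"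
  assumes \<alpha>: "-1 < \<alpha>" "\<alpha> < 0" and r: "0 < r" "r \<le> 1 / 2"
    and S [measurable]: "S \<in> sets borel" and S' [measurable]: "S' \<in> sets borel"
    and dil: "\<And>t z. 1 - r \<le> t \<Longrightarrow> t \<le> 1 \<Longrightarrow> z \<in> S \<Longrightarrow> t *\<^sub>R z \<in> S'"
  shows "(\<integral>\<^sup>+z. ennreal (bergman_weight \<alpha> z) * indicator S z \<partial>lborel)
    \<le> ennreal (4 ^ CARD('n) * r powr \<alpha> / (\<alpha> + 1)) * emeasure lborel S'"
proof -
  define F where "F = (\<lambda>z. ennreal (bergman_weight \<alpha> z) * indicator S z)"
  have F [measurable]: "F \<in> borel_measurable borel" unfolding F_def by measurable
  define I where "I = integral\<^sup>N lborel F"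
  define T where "T = {1 - r<..1}"
  have T: "t > 0" "1 - r \<le> t" "t \<le> 1" "1 / t \<le> 2" if "t \<in> T" for t
    using that r by (auto simp: T_def field_simps)
  have eT: "emeasure lborel T = ennreal r" using r by (simp add: T_def)
  have [measurable]: "T \<in> sets borel" by (simp add: T_def)
  have fm [measurable]: "(\<lambda>(t::real, y::complex^'n). F ((1 / t) *\<^sub>R y)) \<in> borel_measurable (lborel \<Otimes>\<^sub>M lborel)"
    by measurable
  \<comment> \<open>Substituting z = y/t costs t^(-2n), at most 2^(2n) = 4^n because t is at least
    1/2.\<close>
  have scale: "I * indicator T t \<le> ennreal (4 ^ CARD('n)) * (\<integral>\<^sup>+y. F ((1 / t) *\<^sub>R y) * indicator T t \<partial>lborel)" for t
  proof (cases "t \<in> T")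
    case True
    have "I = ennreal ((1 / t) ^ DIM(complex^'n)) * (\<integral>\<^sup>+y. F (0 + (1 / t) *\<^sub>R y) \<partial>lborel)"
      unfolding I_def using T[OF True] by (intro nn_integral_scaleR_lborel[symmetric]) auto
    also have "\<dots> \<le> ennreal (4 ^ CARD('n)) * (\<integral>\<^sup>+y. F (0 + (1 / t) *\<^sub>R y) \<partial>lborel)"
    proof (intro mult_right_mono ennreal_leI)
      have "(1 / t) ^ DIM(complex^'n) \<le> 2 ^ DIM(complex^'n)" using T[OF True] by (intro power_mono) auto
      also have "\<dots> = (2 ^ 2) ^ CARD('n)" by (simp only: DIM_complex_vec power_mult)
      finally show "(1 / t) ^ DIM(complex^'n) \<le> 4 ^ CARD('n)" by simp
    qed simp
    finally show ?thesis using True by simp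
  qed simp
  \<comment> \<open>For fixed y, the quantity 1 - |y/t|^2 is at least t - |y|, so the singular
    weight is dominated by a power of t - |y|, whose integral in t is bounded uniformly in
    y.\<close>
  have inner: "(\<integral>\<^sup>+t. F ((1 / t) *\<^sub>R y) * indicator T t \<partial>lborel) \<le> ennreal (r powr (\<alpha> + 1) / (\<alpha> + 1)) * indicator S' y" for y
  proof -
    have "F ((1 / t) *\<^sub>R y) * indicator T t \<le> ennreal ((t - norm y) powr \<alpha>) * indicator ({1 - r<..1} \<inter> {norm y<..}) t * indicator S' y" for t
    proof (cases "t \<in> T \<and> (1 / t) *\<^sub>R y \<in> S \<and> (1 / t) *\<^sub>R y \<in> ball 0 1")
      case True
      then have t: "t > 0" "t \<le> 1" using T by auto
      have "t *\<^sub>R ((1 / t) *\<^sub>R y) \<in> S'" using True T by (intro dil) auto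
      then have y: "y \<in> S'" using t by simp
      have ny: "norm y < t" using True t by (simp add: field_simps)
      define x where "x = norm y / t"
      have x: "0 \<le> x" "x < 1" using ny t by (auto simp: x_def)
      have "t - norm y = t * (1 - x)" using t by (simp add: x_def field_simps)
      also have "\<dots> \<le> 1 * (1 - x)" using t x by (intro mult_right_mono) auto
      also have "\<dots> \<le> 1 - x\<^sup>2" using x by (simp add: power2_eq_square mult_left_le_one_le)
      finally have "(1 - x\<^sup>2) powr \<alpha> \<le> (t - norm y) powr \<alpha>"
        using \<alpha> ny by (intro powr_mono2') auto
      then have "F ((1 / t) *\<^sub>R y) \<le> ennreal ((t - norm y) powr \<alpha>)"
        using True t by (auto simp: F_def bergman_weight_def x_def power_divide intro!: ennreal_leI)
      then show ?thesis using True y ny by (simp add: T_def)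
    next
      case False
      then have 0: "F ((1 / t) *\<^sub>R y) * indicator T t = 0" by (auto simp: F_def bergman_weight_def indicator_def)
      show ?thesis unfolding 0 by (rule zero_le)
    qed
    then have "(\<integral>\<^sup>+t. F ((1 / t) *\<^sub>R y) * indicator T t \<partial>lborel)
      \<le> (\<integral>\<^sup>+t. ennreal ((t - norm y) powr \<alpha>) * indicator ({1 - r<..1} \<inter> {norm y<..}) t * indicator S' y \<partial>lborel)"
      by (intro nn_integral_mono)
    also have "\<dots> = (\<integral>\<^sup>+t. ennreal ((t - norm y) powr \<alpha>) * indicator ({1 - r<..1} \<inter> {norm y<..}) t \<partial>lborel) * indicator S' y"
      by (rule nn_integral_multc) measurable
    also have "\<dots> \<le> ennreal (r powr (\<alpha> + 1) / (\<alpha> + 1)) * indicator S' y"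
      using \<alpha> r by (intro mult_right_mono nn_integral_powr_shift_le) auto
    finally show ?thesis .
  qed
  have "ennreal r * I = (\<integral>\<^sup>+t. I * indicator T t \<partial>lborel)"
    by (simp add: nn_integral_cmult_indicator eT mult.commute)
  also have "\<dots> \<le> (\<integral>\<^sup>+t. ennreal (4 ^ CARD('n)) * (\<integral>\<^sup>+y. F ((1 / t) *\<^sub>R y) * indicator T t \<partial>lborel) \<partial>lborel)"
    by (intro nn_integral_mono scale)
  also have "\<dots> = ennreal (4 ^ CARD('n)) * (\<integral>\<^sup>+t. (\<integral>\<^sup>+y. F ((1 / t) *\<^sub>R y) * indicator T t \<partial>lborel) \<partial>lborel)"
    by (rule nn_integral_cmult) measurable
  also have "(\<integral>\<^sup>+t. (\<integral>\<^sup>+y. F ((1 / t) *\<^sub>R y) * indicator T t \<partial>lborel) \<partial>lborel)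
     = (\<integral>\<^sup>+y. (\<integral>\<^sup>+t. F ((1 / t) *\<^sub>R y) * indicator T t \<partial>lborel) \<partial>lborel)"
    by (rule lborel_pair.Fubini'[symmetric]) measurable
  also have "\<dots> \<le> (\<integral>\<^sup>+y. ennreal (r powr (\<alpha> + 1) / (\<alpha> + 1)) * indicator S' y \<partial>lborel)"
    by (intro nn_integral_mono inner)
  also have "\<dots> = ennreal (r powr (\<alpha> + 1) / (\<alpha> + 1)) * emeasure lborel S'"
    by (simp add: nn_integral_cmult_indicator)
  finally have le: "ennreal r * I \<le> ennreal (4 ^ CARD('n)) * (ennreal (r powr (\<alpha> + 1) / (\<alpha> + 1)) * emeasure lborel S')"
    by (simp add: mult_left_mono)
  have "I = ennreal (1 / r) * (ennreal r * I)"
    using r by (simp add: mult.assoc[symmetric] ennreal_mult[symmetric])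
  also have "\<dots> \<le> ennreal (1 / r) * (ennreal (4 ^ CARD('n)) * (ennreal (r powr (\<alpha> + 1) / (\<alpha> + 1)) * emeasure lborel S'))"
    by (rule mult_left_mono[OF le]) simp
  also have "\<dots> = ennreal (1 / r * (4 ^ CARD('n) * (r powr (\<alpha> + 1) / (\<alpha> + 1)))) * emeasure lborel S'"
    using r \<alpha> by (simp add: ennreal_mult mult.assoc del: times_divide_eq_right times_divide_eq_left)
  also have "1 / r * (4 ^ CARD('n) * (r powr (\<alpha> + 1) / (\<alpha> + 1))) = 4 ^ CARD('n) * r powr \<alpha> / (\<alpha> + 1)"
    using r by (simp add: powr_add)
  finally show ?thesis by (simp add: I_def F_def)
qed

definition carleson_box :: "complex^'n::finite \<Rightarrow> real \<Rightarrow> (complex^'n) set" where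
  "carleson_box a r = {z \<in> ball 0 1. cmod (1 - cdot z a) < r}"

lemma open_carleson_box: "open (carleson_box a r)"
proof -
  have "open ({z. norm z < 1} \<inter> {z. cmod (1 - cdot z a) < r})"
    by (intro open_Int open_Collect_less continuous_intros)
  moreover have "{z. norm z < 1} \<inter> {z. cmod (1 - cdot z a) < r} = carleson_box a r"
    by (auto simp: carleson_box_def)
  ultimately show ?thesis by simp
qed

lemma measurable_carleson_box [measurable]: "carleson_box a r \<in> sets borel"
  by (simp add: open_carleson_box)

text \<open>The box lies in an ellipsoid centred at the boundary point \<zeta> = a/|a|, the image of
  the ball of radius 2. The condition that 1 - |a| be at most r allows a to be replaced by \<zeta>
  at the price of doubling r.\<close>

lemma emeasure_carleson_box_le:
  obtains C where "C > 0" "\<And>(a :: complex^'n::finite) r. norm a \<le> 1 \<Longrightarrow> 1 - norm a \<le> r \<Longrightarrow> r > 0 \<Longrightarrow>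
    emeasure lborel (carleson_box a r) \<le> ennreal (C * r ^ (CARD('n) + 1))"
proof -
  define b where "b = measure lborel (ball (0::complex^'n) 2)"
  have b: "b > 0" "emeasure lborel (ball (0::complex^'n) 2) = ennreal b"
    using emeasure_bounded_finite[of "ball (0::complex^'n) 2"]
    by (simp_all add: b_def emeasure_eq_ennreal_measure)
  have "emeasure lborel (carleson_box a r) \<le> ennreal (4 ^ CARD('n) * b * r ^ (CARD('n) + 1))"
    if a: "norm a \<le> 1" "1 - norm a \<le> r" "r > 0" for a :: "complex^'n" and r
  proof -
    obtain \<zeta> where \<zeta>: "norm \<zeta> = 1" "a = norm a *\<^sub>R \<zeta>" by (rule unit_direction)
    have cz: "cdot z a = norm a * cdot z \<zeta>" for z
      by (subst \<zeta>(2)) (simp add: cdot_simps scaleR_conv_of_real[where 'a=complex])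
    define s t where "s = 2 * r" and "t = 2 * sqrt r"
    have st: "s > 0" "t > 0" "t\<^sup>2 = 4 * r" using a by (auto simp: s_def t_def power_mult_distrib)
    have sub: "u \<in> ball 0 2" if "\<zeta> + ellip \<zeta> s t u \<in> carleson_box a r" for u
    proof -
      define z where "z = \<zeta> + ellip \<zeta> s t u"
      have z: "norm z < 1" "cmod (1 - cdot z a) < r" using that by (auto simp: z_def carleson_box_def)
      have "cmod (cdot z \<zeta>) \<le> 1" using norm_cdot_le[of z \<zeta>] \<zeta> z by simp
      define w where "w = of_real (1 - norm a) * cdot z \<zeta>"
      have "1 - cdot z \<zeta> = (1 - cdot z a) - w"
        by (simp add: w_def cz algebra_simps)
      then have "cmod (1 - cdot z \<zeta>) \<le> cmod (1 - cdot z a) + cmod w"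
        by (metis norm_triangle_ineq4)
      moreover have "cmod w \<le> (1 - norm a) * 1"
        unfolding w_def norm_mult norm_of_real using a \<open>cmod (cdot z \<zeta>) \<le> 1\<close> by (intro mult_mono) auto
      ultimately have z1: "cmod (1 - cdot z \<zeta>) < 2 * r" using z a by simp
      have "cdot z \<zeta> = 1 + s * cdot u \<zeta>" by (simp add: z_def cdot_simps cdot_ellip cdot_self \<zeta>(1))
      then have "cmod (s * cdot u \<zeta>) < 2 * r" using z1 by (simp add: norm_minus_commute)
      then have "s * cmod (cdot u \<zeta>) < s * 1" using st by (simp add: norm_mult s_def)
      then have u1: "cmod (cdot u \<zeta>) < 1" using st by simp
      \<comment> \<open>Tangential extent: since |z| < 1, |z - \<zeta>|^2 is less than 2 Re(1 - <z,
        \<zeta>>), hence less than 4r = t^2.\<close>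
      have "(norm (ellip \<zeta> s t u))\<^sup>2 = (norm z)\<^sup>2 - 2 * Re (cdot z \<zeta>) + 1"
        using norm_add_square[of z "- \<zeta>"] \<zeta>(1) cdot_simps(2)[of 0 \<zeta>] by (simp add: z_def Re_cdot)
      also have "\<dots> < 2 * Re (1 - cdot z \<zeta>)" using z(1) by (simp add: power_less_one_iff)
      also have "\<dots> \<le> 2 * cmod (1 - cdot z \<zeta>)" using complex_Re_le_cmod[of "1 - cdot z \<zeta>"] by simp
      also have "\<dots> < t\<^sup>2" using z1 st by simp
      finally have "s\<^sup>2 * (cmod (cdot u \<zeta>))\<^sup>2 + t\<^sup>2 * ((norm u)\<^sup>2 - (cmod (cdot u \<zeta>))\<^sup>2) < t\<^sup>2 * 1"
        unfolding norm_ellip[OF \<zeta>(1)] by simp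
      then have "t\<^sup>2 * ((norm u)\<^sup>2 - (cmod (cdot u \<zeta>))\<^sup>2) < t\<^sup>2 * 1"
        using mult_nonneg_nonneg[OF zero_le_power2[of s] zero_le_power2[of "cmod (cdot u \<zeta>)"]] by linarith
      then have "(norm u)\<^sup>2 - (cmod (cdot u \<zeta>))\<^sup>2 < 1"
        using st a by (subst (asm) mult_less_cancel_left_pos) auto
      moreover have "(cmod (cdot u \<zeta>))\<^sup>2 < 1" using u1 by (simp add: power_less_one_iff)
      ultimately have "(norm u)\<^sup>2 < 2\<^sup>2" by simp
      then have "norm u < 2" by (rule power_less_imp_less_base) simp
      then show ?thesis by simp
    qed
    have "emeasure lborel (carleson_box a r) = (\<integral>\<^sup>+z. indicator (carleson_box a r) z \<partial>lborel)"
      by simp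
    also have "\<dots> = ennreal ((s / t)\<^sup>2 * t ^ (2 * CARD('n))) * (\<integral>\<^sup>+u. indicator (carleson_box a r) (\<zeta> + ellip \<zeta> s t u) \<partial>lborel)"
      by (rule nn_integral_ellip[OF \<zeta>(1) st(1,2), symmetric]) measurable
    also have "\<dots> \<le> ennreal ((s / t)\<^sup>2 * t ^ (2 * CARD('n))) * (\<integral>\<^sup>+u. indicator (ball 0 2) (u :: complex^'n) \<partial>lborel)"
      by (rule mult_left_mono[OF nn_integral_mono]) (use sub in \<open>auto simp: indicator_def\<close>)
    also have "(\<integral>\<^sup>+u. indicator (ball 0 2) (u :: complex^'n) \<partial>lborel) = ennreal b" by (simp add: b)
    also have "(s / t)\<^sup>2 * t ^ (2 * CARD('n)) = 4 ^ CARD('n) * r ^ (CARD('n) + 1)"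
      using a by (simp add: power_mult st(3) power_divide power_mult_distrib) (simp add: s_def power2_eq_square)
    also have "ennreal (4 ^ CARD('n) * r ^ (CARD('n) + 1)) * ennreal b = ennreal (4 ^ CARD('n) * b * r ^ (CARD('n) + 1))"
      using a b by (simp add: ennreal_mult[symmetric] mult_ac)
    finally show ?thesis .
  qed
  moreover have "4 ^ CARD('n) * b > 0" using b by simp
  ultimately show ?thesis by (intro that)
qed

lemma weighted_measure_ball_finite:
  assumes \<alpha>: "\<alpha> > -1"
  shows "(\<integral>\<^sup>+z. ennreal (bergman_weight \<alpha> (z :: complex^'n::finite)) \<partial>lborel) < \<infinity>"
proof (cases "\<alpha> \<ge> 0")
  case True
  have "(\<integral>\<^sup>+z. ennreal (bergman_weight \<alpha> (z :: complex^'n)) \<partial>lborel) \<le> (\<integral>\<^sup>+z. indicator (ball 0 1) (z :: complex^'n) \<partial>lborel)"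
  proof (rule nn_integral_mono)
    fix z :: "complex^'n"
    have "(1 - (norm z)\<^sup>2) powr \<alpha> \<le> 1" if "norm z < 1"
      using that True by (intro powr_le1) (auto simp: power_le_one)
    then show "ennreal (bergman_weight \<alpha> z) \<le> indicator (ball 0 1) z"
      by (auto simp: bergman_weight_def indicator_def ennreal_le_1)
  qed
  also have "\<dots> < \<infinity>" using emeasure_lborel_unit_ball_bounds(2)[where 'a="complex^'n"] by simp
  finally show ?thesis .
next
  case False
  have "(\<integral>\<^sup>+z. ennreal (bergman_weight \<alpha> (z :: complex^'n)) \<partial>lborel)
    = (\<integral>\<^sup>+z. ennreal (bergman_weight \<alpha> (z :: complex^'n)) * indicator (ball 0 1) z \<partial>lborel)"
    by (intro nn_integral_cong) (auto simp: bergman_weight_def indicator_def)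
  also have "\<dots> \<le> ennreal (4 ^ CARD('n) * (1/2) powr \<alpha> / (\<alpha> + 1)) * emeasure lborel (ball (0 :: complex^'n) 1)"
  proof (rule weight_dilation_average)
    fix t :: real and z :: "complex^'n"
    assume "1 - 1 / 2 \<le> t" "t \<le> 1" "z \<in> ball 0 1"
    then show "t *\<^sub>R z \<in> ball 0 1" using mult_right_mono[of t 1 "norm z"] by auto
  qed (use \<alpha> False in auto)
  also have "\<dots> < \<infinity>" using emeasure_lborel_unit_ball_bounds[where 'a="complex^'n"]
    by (simp add: ennreal_mult_less_top)
  finally show ?thesis .
qed

lemma weighted_measure_ball_pos:
  "(\<integral>\<^sup>+z. ennreal (bergman_weight \<alpha> (z :: complex^'n::finite)) \<partial>lborel) > 0"
proof (rule ccontr)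
  assume "\<not> ?thesis"
  then have "AE z in lborel. ennreal (bergman_weight \<alpha> (z :: complex^'n)) = 0"
    by (subst nn_integral_0_iff_AE[symmetric]) auto
  then have "AE z in lborel. (z :: complex^'n) \<notin> ball 0 1"
    by eventually_elim (auto simp: bergman_weight_def power_less_one_iff abs_square_eq_1 ennreal_eq_0_iff split: if_splits)
  then have "emeasure lborel (ball (0 :: complex^'n) 1) = 0"
    by (subst (asm) AE_iff_measurable[OF _ refl]) (auto simp: ball_def)
  then show False using emeasure_lborel_unit_ball_bounds[where 'a="complex^'n"] by simp
qed

text \<open>Both infinite and zero total mass would make the constant 0, since
  \<open>enn2real\<close> sends infinity to 0 and 1/0 = 0. So finiteness and positivity of the mass
  are both required.\<close>

lemma bergman_const_pos:
  assumes "\<alpha> > -1" shows "bergman_const \<alpha> TYPE('n::finite) > 0"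
  using weighted_measure_ball_finite[OF assms, where 'n='n] weighted_measure_ball_pos[of \<alpha>, where 'n='n]
  by (simp add: bergman_const_def enn2real_positive_iff)

text \<open>For \<alpha> nonnegative the weight is at most (2r)^\<alpha> on the box, because 1 - |z|
  < r there. For negative \<alpha> that bound points the wrong way, and the dilation average is used
  with the box of size 2r as the enlarged set.\<close>

lemma weighted_carleson_box_le:
  assumes \<alpha>: "\<alpha> > -1"
  obtains C where "C > 0" "\<And>(a :: complex^'n::finite) r. norm a \<le> 1 \<Longrightarrow> 1 - norm a \<le> r \<Longrightarrow> r > 0 \<Longrightarrow>
    (\<integral>\<^sup>+z. ennreal (bergman_weight \<alpha> z) * indicator (carleson_box a r) z \<partial>lborel) \<le> ennreal (C * r powr (real CARD('n) + 1 + \<alpha>))"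
proof -
  define n where "n = CARD('n)"
  obtain C1 where C1: "C1 > 0" "\<And>(a :: complex^'n) r. norm a \<le> 1 \<Longrightarrow> 1 - norm a \<le> r \<Longrightarrow> r > 0 \<Longrightarrow>
    emeasure lborel (carleson_box a r) \<le> ennreal (C1 * r ^ (n + 1))"
    unfolding n_def using emeasure_carleson_box_le[where 'n='n] by blast
  have pw: "r ^ (n + 1) * r powr \<alpha> = r powr (real CARD('n) + 1 + \<alpha>)" if "r > 0" for r :: real
    using that by (simp only: powr_realpow[symmetric] powr_add[symmetric]) (simp add: n_def add_ac)
  show ?thesis
  proof (cases "\<alpha> \<ge> 0")
    case True
    show ?thesis
    proof (rule that[of "2 powr \<alpha> * C1"])
      show "2 powr \<alpha> * C1 > 0" using C1 by simp
      fix a :: "complex^'n" and r :: real assume a: "norm a \<le> 1" "1 - norm a \<le> r" "r > 0"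
      have "bergman_weight \<alpha> z \<le> (2 * r) powr \<alpha>" if "z \<in> carleson_box a r" for z
      proof -
        have z: "norm z < 1" "cmod (1 - cdot z a) < r" using that by (auto simp: carleson_box_def)
        have "cmod (cdot z a) \<le> norm z * norm a" by (rule norm_cdot_le)
        also have "\<dots> \<le> norm z * 1" using a by (intro mult_left_mono) auto
        finally have "1 - norm z < r" using z norm_triangle_ineq2[of 1 "cdot z a"] by simp
        moreover have "1 - (norm z)\<^sup>2 = (1 + norm z) * (1 - norm z)" by (simp add: power2_eq_square algebra_simps)
        then have "1 - (norm z)\<^sup>2 \<le> 2 * (1 - norm z)" using z by (simp only:) (intro mult_right_mono, auto)
        ultimately have "1 - (norm z)\<^sup>2 \<le> 2 * r" by (simp add: order_trans[OF _ mult_left_mono])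
        then show ?thesis using z True by (auto simp: bergman_weight_def power_le_one intro!: powr_mono2)
      qed
      then have "(\<integral>\<^sup>+z. ennreal (bergman_weight \<alpha> z) * indicator (carleson_box a r) z \<partial>lborel)
        \<le> (\<integral>\<^sup>+z. ennreal ((2 * r) powr \<alpha>) * indicator (carleson_box a r) z \<partial>lborel)"
        by (intro nn_integral_mono) (auto simp: indicator_def intro!: ennreal_leI)
      also have "\<dots> = ennreal ((2 * r) powr \<alpha>) * emeasure lborel (carleson_box a r)"
        by (simp add: nn_integral_cmult_indicator)
      also have "\<dots> \<le> ennreal ((2 * r) powr \<alpha>) * ennreal (C1 * r ^ (n + 1))"
        by (intro mult_left_mono C1 a) simp
      also have "\<dots> = ennreal (2 powr \<alpha> * C1 * (r ^ (n + 1) * r powr \<alpha>))"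
        using a C1 by (simp add: ennreal_mult[symmetric] powr_mult mult_ac)
      finally show "(\<integral>\<^sup>+z. ennreal (bergman_weight \<alpha> z) * indicator (carleson_box a r) z \<partial>lborel)
        \<le> ennreal (2 powr \<alpha> * C1 * r powr (real CARD('n) + 1 + \<alpha>))" using pw[OF a(3)] by simp
    qed
  next
    case False
    define K where "K = 4 ^ n / (\<alpha> + 1) * C1 * 2 ^ (n + 1)"
    have K: "K > 0" using \<alpha> C1 by (simp add: K_def)
    define W where "W = enn2real (\<integral>\<^sup>+z. ennreal (bergman_weight \<alpha> (z :: complex^'n)) \<partial>lborel)"
    have W: "(\<integral>\<^sup>+z. ennreal (bergman_weight \<alpha> (z :: complex^'n)) \<partial>lborel) = ennreal W" "W \<ge> 0"
      using weighted_measure_ball_finite[OF \<alpha>, where 'n='n] by (simp_all add: W_def)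
    define N where "N = real CARD('n) + 1 + \<alpha>"
    have N: "N > 0" using \<alpha> by (simp add: N_def)
    define L where "L = W / (1/2) powr N"
    show ?thesis
    proof (rule that[of "K + L"])
      show "K + L > 0" using K W by (simp add: L_def add_pos_nonneg)
      fix a :: "complex^'n" and r :: real assume a: "norm a \<le> 1" "1 - norm a \<le> r" "r > 0"
      have "(\<integral>\<^sup>+z. ennreal (bergman_weight \<alpha> z) * indicator (carleson_box a r) z \<partial>lborel) \<le> ennreal ((K + L) * r powr N)"
      proof (cases "r \<le> 1 / 2")
        case r: True
        have "(\<integral>\<^sup>+z. ennreal (bergman_weight \<alpha> z) * indicator (carleson_box a r) z \<partial>lborel)
          \<le> ennreal (4 ^ CARD('n) * r powr \<alpha> / (\<alpha> + 1)) * emeasure lborel (carleson_box a (2 * r))"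
        proof (rule weight_dilation_average)
          fix t z assume t: "1 - r \<le> t" "t \<le> 1" and z: "z \<in> carleson_box a r"
          have t0: "0 \<le> t" using t r by linarith
          have z': "norm z < 1" "cmod (1 - cdot z a) < r" using z by (auto simp: carleson_box_def)
          have "norm (t *\<^sub>R z) < 1" using mult_right_mono[of t 1 "norm z"] t t0 z' by simp
          have "cmod (cdot z a) \<le> norm z * norm a" by (rule norm_cdot_le)
          also have "\<dots> \<le> 1 * 1" using a z' by (intro mult_mono) auto
          finally have c1: "cmod (cdot z a) \<le> 1" by simp
          \<comment> \<open>Dilating z by t moves <z, a> by at most 1 - t, hence by at most r; this
            is why the box of size 2r contains the dilated points.\<close>
          have "1 - cdot (t *\<^sub>R z) a = (1 - cdot z a) + of_real (1 - t) * cdot z a"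
            by (simp add: cdot_simps scaleR_conv_of_real[where 'a=complex] algebra_simps)
          then have "cmod (1 - cdot (t *\<^sub>R z) a) \<le> cmod (1 - cdot z a) + cmod (of_real (1 - t) * cdot z a)"
            by (metis norm_triangle_ineq)
          moreover have "cmod (of_real (1 - t) * cdot z a) = (1 - t) * cmod (cdot z a)"
            unfolding norm_mult norm_of_real using t by simp
          moreover have "(1 - t) * cmod (cdot z a) \<le> (1 - t)" using c1 t by (intro mult_left_le) auto
          ultimately have "cmod (1 - cdot (t *\<^sub>R z) a) < 2 * r" using z' t by linarith
          with \<open>norm (t *\<^sub>R z) < 1\<close> show "t *\<^sub>R z \<in> carleson_box a (2 * r)" by (simp add: carleson_box_def)
        qed (use \<alpha> False r a in auto)
        also have "\<dots> \<le> ennreal (4 ^ CARD('n) * r powr \<alpha> / (\<alpha> + 1)) * ennreal (C1 * (2 * r) ^ (n + 1))"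
          using a by (intro mult_left_mono C1) auto
        also have "\<dots> = ennreal (K * (r ^ (n + 1) * r powr \<alpha>))"
          using a C1 \<alpha> by (simp add: ennreal_mult[symmetric] K_def power_mult_distrib n_def mult_ac)
        also have "\<dots> \<le> ennreal ((K + L) * r powr N)"
          using pw[OF a(3)] W by (intro ennreal_leI) (auto simp: N_def L_def intro!: mult_right_mono)
        finally show ?thesis .
      next
        case r: False
        have "(\<integral>\<^sup>+z. ennreal (bergman_weight \<alpha> z) * indicator (carleson_box a r) z \<partial>lborel) \<le> (\<integral>\<^sup>+z. ennreal (bergman_weight \<alpha> (z :: complex^'n)) \<partial>lborel)"
          by (intro nn_integral_mono) (auto simp: indicator_def)
        also have "\<dots> = ennreal (L * (1/2) powr N)" by (simp add: W L_def)
        also have "\<dots> \<le> ennreal ((K + L) * r powr N)"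
          using r N K W by (intro ennreal_leI mult_mono powr_mono2) (auto simp: L_def)
        finally show ?thesis .
      qed
      then show "(\<integral>\<^sup>+z. ennreal (bergman_weight \<alpha> z) * indicator (carleson_box a r) z \<partial>lborel)
        \<le> ennreal ((K + L) * r powr (real CARD('n) + 1 + \<alpha>))" by (simp add: N_def)
    qed
  qed
qed

lemma dyadic_scale:
  fixes x \<delta> :: real
  assumes "0 < \<delta>" "\<delta> \<le> x"
  obtains j :: nat where "2 ^ j * \<delta> \<le> x" "x < 2 ^ (j + 1) * \<delta>"
proof -
  obtain m :: nat where "x / \<delta> < 2 ^ m" using real_arch_pow[of 2 "x / \<delta>"] by auto
  then have m: "x < 2 ^ m * \<delta>" using assms by (simp add: field_simps)
  define k where "k = (LEAST m. x < 2 ^ m * \<delta>)"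
  have k: "x < 2 ^ k * \<delta>" unfolding k_def using m by (rule LeastI)
  have "k \<noteq> 0" using k assms by (intro notI) simp
  then obtain j where j: "k = Suc j" using not0_implies_Suc by blast
  then have "\<not> x < 2 ^ j * \<delta>" unfolding k_def using not_less_Least[of j "\<lambda>m. x < 2 ^ m * \<delta>"] by auto
  then show ?thesis using k j that[of j] by simp
qed

text \<open>Dyadic decomposition by the size of |1 - <z, a>|, which is never below \<delta> = 1 -
  |a|. On the j-th shell the kernel is at most (2^j \<delta>)^(-M), and the shell lies in a box of
  weighted measure at most C (2^(j+1) \<delta>)^N. The series is geometric since M > N.\<close>

lemma forelli_rudin:
  assumes \<alpha>: "\<alpha> > -1" and M: "M > real CARD('n::finite) + 1 + \<alpha>"
  obtains C where "C > 0" "\<And>a :: complex^'n. a \<in> ball 0 1 \<Longrightarrow>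
    (\<integral>\<^sup>+z. ennreal (bergman_weight \<alpha> z * cmod (1 - cdot z a) powr (- M)) \<partial>lborel)
      \<le> ennreal (C * (1 - (norm a)\<^sup>2) powr (real CARD('n) + 1 + \<alpha> - M))"
proof -
  define N where "N = real CARD('n) + 1 + \<alpha>"
  obtain C where C: "C > 0" "\<And>(a :: complex^'n) r. norm a \<le> 1 \<Longrightarrow> 1 - norm a \<le> r \<Longrightarrow> r > 0 \<Longrightarrow>
    (\<integral>\<^sup>+z. ennreal (bergman_weight \<alpha> z) * indicator (carleson_box a r) z \<partial>lborel) \<le> ennreal (C * r powr N)"
    unfolding N_def using weighted_carleson_box_le[OF \<alpha>, where 'n='n] by blast
  define q where "q = 2 powr (N - M)"
  have q: "0 < q" "q < 1" using M by (auto simp: q_def N_def powr_less_one)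
  define D where "D = C * 2 powr N * (1 / (1 - q))"
  have D: "D > 0" using C q by (simp add: D_def)
  have "(\<integral>\<^sup>+z. ennreal (bergman_weight \<alpha> z * cmod (1 - cdot z a) powr (- M)) \<partial>lborel)
      \<le> ennreal (D * 2 powr (M - N) * (1 - (norm a)\<^sup>2) powr (N - M))"
    if a: "a \<in> ball 0 1" for a :: "complex^'n"
  proof -
    define \<delta> where "\<delta> = 1 - norm a"
    have \<delta>: "\<delta> > 0" using a by (simp add: \<delta>_def)
    define g where "g = (\<lambda>j. ennreal ((2 ^ j * \<delta>) powr (- M)))"
    define F where "F = (\<lambda>j z. g j * (ennreal (bergman_weight \<alpha> z) * indicator (carleson_box a (2 ^ (j + 1) * \<delta>)) z))"
    have Fm [measurable]: "F j \<in> borel_measurable borel" for j unfolding F_def by measurable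
    have point: "ennreal (bergman_weight \<alpha> z * cmod (1 - cdot z a) powr (- M)) \<le> (\<Sum>j. F j z)" for z
    proof (cases "z \<in> ball 0 1")
      case True
      define x where "x = cmod (1 - cdot z a)"
      have "cmod (cdot z a) \<le> norm z * norm a" by (rule norm_cdot_le)
      also have "\<dots> \<le> 1 * norm a" using True by (intro mult_right_mono) auto
      finally have "\<delta> \<le> x" using norm_triangle_ineq2[of 1 "cdot z a"] by (simp add: \<delta>_def x_def)
      then obtain j where j: "2 ^ j * \<delta> \<le> x" "x < 2 ^ (j + 1) * \<delta>" using dyadic_scale[OF \<delta>] by blast
      have "M > 0" using M \<alpha> by simp
      then have "x powr (- M) \<le> (2 ^ j * \<delta>) powr (- M)" using j \<delta> by (intro powr_mono2') auto
      then have "bergman_weight \<alpha> z * x powr (- M) \<le> (2 ^ j * \<delta>) powr (- M) * bergman_weight \<alpha> z"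
        by (metis bergman_weight_nonneg mult.commute mult_left_mono)
      then have "ennreal (bergman_weight \<alpha> z * x powr (- M)) \<le> ennreal ((2 ^ j * \<delta>) powr (- M) * bergman_weight \<alpha> z)"
        by (rule ennreal_leI)
      also have "\<dots> = F j z" using j True
        by (simp add: F_def g_def ennreal_mult bergman_weight_nonneg carleson_box_def x_def)
      also have "\<dots> \<le> (\<Sum>j. F j z)" using sum_le_suminf[of "\<lambda>j. F j z" "{j}"] by simp
      finally show ?thesis by (simp add: x_def)
    qed (simp add: bergman_weight_def)
    have summand: "g j * ennreal (C * (2 ^ (j + 1) * \<delta>) powr N) = ennreal (C * 2 powr N * \<delta> powr (N - M) * q ^ j)" for j
    proof -
      define y where "y = 2 ^ j * \<delta>"
      have y: "y > 0" using \<delta> by (simp add: y_def)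
      have pj: "(2 ^ j) powr (N - M) = q ^ j"
        unfolding q_def by (simp add: powr_realpow[symmetric] powr_powr mult.commute)
      have "y powr (- M) * (C * (2 * y) powr N) = C * 2 powr N * (y powr (- M) * y powr N)"
        using y by (simp add: powr_mult)
      also have "y powr (- M) * y powr N = y powr (N - M)" by (simp add: powr_add[symmetric])
      also have "y powr (N - M) = q ^ j * \<delta> powr (N - M)" using \<delta> by (simp add: y_def powr_mult pj)
      finally show ?thesis using C by (simp add: g_def y_def[symmetric] mult.assoc ennreal_mult[symmetric]) (simp add: mult_ac)
    qed
    have "(\<integral>\<^sup>+z. ennreal (bergman_weight \<alpha> z * cmod (1 - cdot z a) powr (- M)) \<partial>lborel) \<le> (\<integral>\<^sup>+z. (\<Sum>j. F j z) \<partial>lborel)"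
      by (intro nn_integral_mono point)
    also have "\<dots> = (\<Sum>j. \<integral>\<^sup>+z. F j z \<partial>lborel)" by (rule nn_integral_suminf) simp
    also have "\<dots> \<le> (\<Sum>j. ennreal (C * 2 powr N * \<delta> powr (N - M) * q ^ j))"
    proof (rule suminf_le)
      fix j
      have pos: "1 - norm a \<le> 2 ^ (j + 1) * \<delta>"
        using \<delta> mult_right_mono[of 1 "2 ^ (j + 1)" \<delta>] one_le_power[of "2::real" "j + 1"] by (simp add: \<delta>_def)
      have "(\<integral>\<^sup>+z. F j z \<partial>lborel) = g j * (\<integral>\<^sup>+z. ennreal (bergman_weight \<alpha> z) * indicator (carleson_box a (2 ^ (j + 1) * \<delta>)) z \<partial>lborel)"
        unfolding F_def by (rule nn_integral_cmult) measurable
      also have "\<dots> \<le> g j * ennreal (C * (2 ^ (j + 1) * \<delta>) powr N)"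
        using a \<delta> pos by (intro mult_left_mono C) auto
      finally show "(\<integral>\<^sup>+z. F j z \<partial>lborel) \<le> ennreal (C * 2 powr N * \<delta> powr (N - M) * q ^ j)"
        by (simp only: summand)
    qed auto
    also have "\<dots> = ennreal (\<Sum>j. C * 2 powr N * \<delta> powr (N - M) * q ^ j)"
      using C q by (intro suminf_ennreal2) (auto intro!: summable_mult summable_geometric)
    also have "(\<Sum>j. C * 2 powr N * \<delta> powr (N - M) * q ^ j) = D * \<delta> powr (N - M)"
      using q by (subst suminf_mult) (auto simp: suminf_geometric summable_geometric D_def)
    \<comment> \<open>Passes from 1 - |a| to 1 - |a|^2; the two differ by a factor between 1 and
      2.\<close>
    also have "\<dots> \<le> D * (2 powr (M - N) * (1 - (norm a)\<^sup>2) powr (N - M))"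
    proof (rule mult_left_mono)
      have "1 - (norm a)\<^sup>2 = (1 + norm a) * \<delta>" by (simp add: \<delta>_def power2_eq_square algebra_simps)
      also have "\<dots> \<le> 2 * \<delta>" using a \<delta> by (intro mult_right_mono) auto
      finally have "(1 - (norm a)\<^sup>2) / 2 \<le> \<delta>" by simp
      moreover have "1 - (norm a)\<^sup>2 > 0" using a by (simp add: power_less_one_iff)
      ultimately have "\<delta> powr (N - M) \<le> ((1 - (norm a)\<^sup>2) / 2) powr (N - M)"
        using M by (intro powr_mono2') (auto simp: N_def)
      also have "\<dots> = 2 powr (M - N) * (1 - (norm a)\<^sup>2) powr (N - M)"
        using \<open>1 - (norm a)\<^sup>2 > 0\<close> by (simp add: powr_divide powr_minus_divide[of 2 "N - M", simplified])
      finally show "\<delta> powr (N - M) \<le> 2 powr (M - N) * (1 - (norm a)\<^sup>2) powr (N - M)" .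
    qed (use D in simp)
    finally show ?thesis by (simp add: mult.assoc ennreal_leI)
  qed
  moreover have "D * 2 powr (M - N) > 0" using D by simp
  ultimately show ?thesis unfolding N_def by (intro that[of "D * 2 powr (M - N)"]) (simp_all add: N_def)
qed

section \<open>Modulars, Luxemburg norms and test functions\<close>

lemma weighted_integral_le:
  fixes f g :: "complex^'n::finite \<Rightarrow> complex"
  assumes \<Phi>: "growth_fun \<Phi>" and \<Psi>: "growth_fun \<Psi>" and f: "continuous_on (ball 0 1) f" and \<epsilon>: "\<epsilon> \<ge> 0"
    and le: "\<And>z. z \<in> ball 0 1 \<Longrightarrow>
      \<Phi> (cmod (g z)) * bergman_weight \<beta> z \<le> \<epsilon> * (\<Psi> (cmod (f z)) * bergman_weight \<alpha> z)"
  shows "weighted_integral \<Phi> \<beta> g \<le> ennreal \<epsilon> * weighted_integral \<Psi> \<alpha> f"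
proof -
  have "weighted_integral \<Phi> \<beta> g \<le> (\<integral>\<^sup>+z. ennreal \<epsilon> * (ennreal (\<Psi> (cmod (f z))) * ennreal (bergman_weight \<alpha> z)) \<partial>lborel)"
    unfolding weighted_integral_def
  proof (rule nn_integral_mono)
    fix z :: "complex^'n"
    show "ennreal (\<Phi> (cmod (g z))) * ennreal (bergman_weight \<beta> z) \<le> ennreal \<epsilon> * (ennreal (\<Psi> (cmod (f z))) * ennreal (bergman_weight \<alpha> z))"
    proof (cases "z \<in> ball 0 1")
      case True
      then show ?thesis
        using ennreal_leI[OF le[OF True]] growth_fun_nonneg[OF \<Phi>, of "cmod (g z)"] growth_fun_nonneg[OF \<Psi>, of "cmod (f z)"] \<epsilon>
        by (simp add: ennreal_mult bergman_weight_nonneg)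
    qed (simp add: bergman_weight_def)
  qed
  also have "\<dots> = ennreal \<epsilon> * weighted_integral \<Psi> \<alpha> f"
    unfolding weighted_integral_def
    by (rule nn_integral_cmult) (simp add: borel_measurable_weighted_integrand \<Psi> f)
  finally show ?thesis .
qed

lemma modular_le:
  fixes f g :: "complex^'n::finite \<Rightarrow> complex"
  assumes \<Phi>: "growth_fun \<Phi>" and \<Psi>: "growth_fun \<Psi>"
    and f: "continuous_on (ball 0 1) f" and g: "continuous_on (ball 0 1) g"
    and \<alpha>: "\<alpha> > -1" and \<epsilon>: "\<epsilon> \<ge> 0"
    and le: "\<And>z. z \<in> ball 0 1 \<Longrightarrow>
      \<Phi> (cmod (g z)) * bergman_weight \<beta> z \<le> \<epsilon> * (\<Psi> (cmod (f z)) * bergman_weight \<alpha> z)"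
  shows "modular \<Phi> \<beta> g \<le> ennreal (bergman_const \<beta> TYPE('n) / bergman_const \<alpha> TYPE('n) * \<epsilon>) * modular \<Psi> \<alpha> f"
proof -
  define a b where "a = bergman_const \<alpha> TYPE('n)" and "b = bergman_const \<beta> TYPE('n)"
  have a: "a > 0" and b: "b \<ge> 0"
    using bergman_const_pos[OF \<alpha>, where 'n='n] by (simp_all add: a_def b_def bergman_const_def)
  have "modular \<Phi> \<beta> g = ennreal b * weighted_integral \<Phi> \<beta> g"
    unfolding b_def by (rule modular_eq_weighted_integral[OF \<Phi> g])
  also have "\<dots> \<le> ennreal b * (ennreal \<epsilon> * weighted_integral \<Psi> \<alpha> f)"
    by (intro mult_left_mono weighted_integral_le \<Phi> \<Psi> f \<epsilon> le) auto
  also have "\<dots> = ennreal (b * \<epsilon>) * weighted_integral \<Psi> \<alpha> f"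
    using b \<epsilon> by (simp add: ennreal_mult mult.assoc)
  also have "b * \<epsilon> = b / a * \<epsilon> * a" using a by simp
  also have "ennreal (b / a * \<epsilon> * a) = ennreal (b / a * \<epsilon>) * ennreal a"
    using a b \<epsilon> by (intro ennreal_mult) auto
  also have "ennreal (b / a * \<epsilon>) * ennreal a * weighted_integral \<Psi> \<alpha> f = ennreal (b / a * \<epsilon>) * modular \<Psi> \<alpha> f"
    by (simp only: modular_eq_weighted_integral[OF \<Psi> f] a_def mult.assoc)
  finally show ?thesis by (simp add: a_def b_def)
qed

lemma modular_antimono_scale:
  assumes "growth_fun \<Phi>" "0 < r" "r \<le> s"
  shows "modular \<Phi> \<alpha> (\<lambda>z. f z / complex_of_real s) \<le> modular \<Phi> \<alpha> (\<lambda>z. f z / complex_of_real r)"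
  unfolding modular_def using assms
  by (intro nn_integral_mono ennreal_leI growth_fun_mono[OF assms(1)]) (auto simp: norm_divide divide_left_mono)

text \<open>Turns a modular bound m into a norm bound K that serves every f at once. Using 1/(m + 1)
  covers m = 0 and gives m/(m + 1), which is at most 1.\<close>

lemma modular_scale_le_one:
  assumes \<Phi>: "growth_fun \<Phi>" "lower_type \<Phi> p" "p > 0" and \<alpha>: "\<alpha> > -1" and m: "m \<ge> 0"
  obtains K where "K \<ge> 1" "\<And>f :: complex^'n::finite \<Rightarrow> complex. continuous_on (ball 0 1) f \<Longrightarrow>
    modular \<Phi> \<alpha> f \<le> ennreal m \<Longrightarrow> modular \<Phi> \<alpha> (\<lambda>z. f z / complex_of_real K) \<le> 1"
proof -
  obtain K where K: "K \<ge> 1" "\<And>x. x \<ge> 0 \<Longrightarrow> \<Phi> (x / K) \<le> 1 / (m + 1) * \<Phi> x"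
    using lower_type_small[OF \<Phi>, of "1 / (m + 1)"] m by auto
  have "modular \<Phi> \<alpha> (\<lambda>z. f z / complex_of_real K) \<le> 1"
    if f: "continuous_on (ball 0 1) f" and le: "modular \<Phi> \<alpha> f \<le> ennreal m" for f :: "complex^'n \<Rightarrow> complex"
  proof -
    have "\<Phi> (cmod (f z / complex_of_real K)) * bergman_weight \<alpha> z \<le> 1 / (m + 1) * (\<Phi> (cmod (f z)) * bergman_weight \<alpha> z)" for z
      using mult_right_mono[OF K(2)[of "cmod (f z)"] bergman_weight_nonneg[of \<alpha> z]] K(1) by (simp add: norm_divide)
    then have "modular \<Phi> \<alpha> (\<lambda>z. f z / complex_of_real K)
      \<le> ennreal (bergman_const \<alpha> TYPE('n) / bergman_const \<alpha> TYPE('n) * (1 / (m + 1))) * modular \<Phi> \<alpha> f"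
      using m K(1) by (intro modular_le \<Phi> \<alpha> f continuous_on_divide continuous_on_const) auto
    also have "\<dots> \<le> ennreal (1 / (m + 1)) * ennreal m"
      using bergman_const_pos[OF \<alpha>, where 'n='n] le by (simp add: mult_left_mono)
    also have "\<dots> \<le> 1" using m by (simp add: ennreal_mult[symmetric] ennreal_le_1)
    finally show ?thesis .
  qed
  with K(1) show ?thesis by (rule that)
qed

text \<open>A bound on a modular of f/r gives membership of f itself in the space; upper type pays
  for removing the divisor.\<close>

lemma modular_unscale_finite:
  fixes f :: "complex^'n::finite \<Rightarrow> complex"
  assumes \<Phi>: "growth_fun \<Phi>" "upper_type \<Phi> q" and \<alpha>: "\<alpha> > -1" and f: "continuous_on (ball 0 1) f" and r: "r > 0"
    and fin: "modular \<Phi> \<alpha> (\<lambda>z. f z / complex_of_real r) < \<infinity>"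
  shows "modular \<Phi> \<alpha> f < \<infinity>"
proof -
  obtain C where C: "C > 0" "\<And>x. x \<ge> 0 \<Longrightarrow> \<Phi> (max 1 r * x) \<le> C * \<Phi> x"
    by (rule upper_type_scale[OF \<Phi>, of "max 1 r"]) auto
  have "\<Phi> (cmod (f z)) \<le> C * \<Phi> (cmod (f z / complex_of_real r))" for z
  proof -
    have "1 * cmod (f z) \<le> max 1 r / r * cmod (f z)" using r by (intro mult_right_mono) auto
    then have "\<Phi> (cmod (f z)) \<le> \<Phi> (max 1 r * (cmod (f z) / r))"
      by (intro growth_fun_mono[OF \<Phi>(1)]) auto
    also have "\<dots> \<le> C * \<Phi> (cmod (f z) / r)" using r by (intro C) auto
    finally show ?thesis using r by (simp add: norm_divide)
  qed
  then have "modular \<Phi> \<alpha> f \<le> ennreal (bergman_const \<alpha> TYPE('n) / bergman_const \<alpha> TYPE('n) * C) * modular \<Phi> \<alpha> (\<lambda>z. f z / complex_of_real r)"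
    using C(1) r by (intro modular_le \<Phi> \<alpha> f continuous_on_divide continuous_on_const)
      (auto simp: mult.assoc[symmetric] bergman_weight_nonneg intro!: mult_right_mono)
  also have "\<dots> < \<infinity>" using fin by (simp add: ennreal_mult_less_top)
  finally show ?thesis .
qed

lemma lux_norm_le:
  assumes "r > 0" "modular \<Phi> \<alpha> (\<lambda>z. f z / complex_of_real r) \<le> 1"
  shows "lux_norm \<Phi> \<alpha> f \<le> r"
  unfolding lux_norm_def using assms by (intro cInf_lower bdd_belowI[of _ 0]) auto

text \<open>The infimum of an empty set of reals carries no information, so lower bounds for
  \<open>lux_norm\<close> and the choice of admissible radii depend on this.\<close>

lemma lux_set_nonempty:
  fixes f :: "complex^'n::finite \<Rightarrow> complex"
  assumes \<Phi>: "growth_fun \<Phi>" "lower_type \<Phi> p" "p > 0" and \<alpha>: "\<alpha> > -1" and f: "f \<in> bergman_orlicz \<Phi> \<alpha>"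
  shows "{r. r > 0 \<and> modular \<Phi> \<alpha> (\<lambda>z. f z / complex_of_real r) \<le> 1} \<noteq> {}"
proof -
  have "continuous_on (ball 0 1) f" and fin: "modular \<Phi> \<alpha> f < \<infinity>"
    using f holo_on_imp_continuous_on by (auto simp: bergman_orlicz_def)
  moreover have "modular \<Phi> \<alpha> f \<le> ennreal (enn2real (modular \<Phi> \<alpha> f))" using fin by simp
  ultimately obtain K where "K \<ge> 1" "modular \<Phi> \<alpha> (\<lambda>z. f z / complex_of_real K) \<le> 1"
    using modular_scale_le_one[OF \<Phi> \<alpha> enn2real_nonneg, where 'n='n] by metis
  then show ?thesis by (auto intro!: exI[of _ K])
qed

lemma lux_norm_nonneg:
  assumes "{r. r > 0 \<and> modular \<Phi> \<alpha> (\<lambda>z. f z / complex_of_real r) \<le> 1} \<noteq> {}"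
  shows "0 \<le> lux_norm \<Phi> \<alpha> f"
  unfolding lux_norm_def using assms by (intro cInf_greatest) auto

text \<open>The strict inequality yields an admissible radius below s, so the infimum need not be
  attained.\<close>

lemma modular_le_one_if_lux_norm_less:
  assumes \<Phi>: "growth_fun \<Phi>" and ne: "{r. r > 0 \<and> modular \<Phi> \<alpha> (\<lambda>z. f z / complex_of_real r) \<le> 1} \<noteq> {}"
    and s: "lux_norm \<Phi> \<alpha> f < s"
  shows "modular \<Phi> \<alpha> (\<lambda>z. f z / complex_of_real s) \<le> 1"
proof -
  obtain r where "r > 0" "modular \<Phi> \<alpha> (\<lambda>z. f z / complex_of_real r) \<le> 1" "r < s"
    using cInf_lessD[OF ne s[unfolded lux_norm_def]] by auto
  then show ?thesis using modular_antimono_scale[OF \<Phi>, of r s \<alpha> f] by (meson less_imp_le order_trans)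
qed

text \<open>Inverts the bound on \<Phi>(|f z|/2): \<open>le_growth_inv\<close> absorbs the
  multiplicative constant, and the halving accounts for the final factor 2.\<close>

lemma pointwise_bound:
  assumes \<Phi>: "growth_fun \<Phi>" "lower_type \<Phi> p" "p > 0" and \<alpha>: "\<alpha> > -1"
  obtains K where "K \<ge> 1" "\<And>(f :: complex^'n::finite \<Rightarrow> complex) z. holo_on f (ball 0 1) \<Longrightarrow> modular \<Phi> \<alpha> f \<le> 1 \<Longrightarrow>
    z \<in> ball 0 1 \<Longrightarrow> cmod (f z) \<le> K * growth_inv \<Phi> ((1 - (norm z)\<^sup>2) powr (- (real CARD('n) + 1 + \<alpha>)))"
proof -
  define c where "c = bergman_const \<alpha> TYPE('n)"
  have c: "c > 0" unfolding c_def by (rule bergman_const_pos[OF \<alpha>])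
  define N where "N = real CARD('n) + 1 + \<alpha>"
  obtain C where C: "C > 0" "\<And>(f :: complex^'n \<Rightarrow> complex) z. holo_on f (ball 0 1) \<Longrightarrow> z \<in> ball 0 1 \<Longrightarrow>
    ennreal (\<Phi> (cmod (f z) / 2)) \<le> ennreal (C * (1 - (norm z)\<^sup>2) powr (- N)) * weighted_integral \<Phi> \<alpha> f"
    unfolding N_def using weighted_pointwise_bound[OF \<Phi>, where 'n='n and \<alpha>=\<alpha>] by blast
  have Cc: "C / c > 0" using C c by simp
  obtain K where K: "K \<ge> 1" "\<And>x y. x \<ge> 0 \<Longrightarrow> y > 0 \<Longrightarrow> \<Phi> x \<le> (C / c) * y \<Longrightarrow> x \<le> K * growth_inv \<Phi> y"
    using le_growth_inv[OF \<Phi> Cc] by blast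
  have "cmod (f z) \<le> (2 * K) * growth_inv \<Phi> ((1 - (norm z)\<^sup>2) powr (- N))"
    if f: "holo_on f (ball 0 1)" and m: "modular \<Phi> \<alpha> f \<le> 1" and z: "z \<in> ball 0 1" for f :: "complex^'n \<Rightarrow> complex" and z
  proof -
    define y where "y = (1 - (norm z)\<^sup>2) powr (- N)"
    have y: "y > 0" using z by (simp add: y_def power_less_one_iff abs_square_eq_1)
    have "weighted_integral \<Phi> \<alpha> f = ennreal (1 / c) * (ennreal c * weighted_integral \<Phi> \<alpha> f)"
      using c by (simp add: mult.assoc[symmetric] ennreal_mult[symmetric])
    also have "\<dots> = ennreal (1 / c) * modular \<Phi> \<alpha> f"
      unfolding c_def by (subst modular_eq_weighted_integral[OF \<Phi>(1) holo_on_imp_continuous_on[OF f]]) simp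
    also have "\<dots> \<le> ennreal (1 / c) * 1" using m by (rule mult_left_mono) simp
    finally have w: "weighted_integral \<Phi> \<alpha> f \<le> ennreal (1 / c)" by simp
    have "ennreal (\<Phi> (cmod (f z) / 2)) \<le> ennreal (C * y) * weighted_integral \<Phi> \<alpha> f"
      unfolding y_def by (rule C(2)[OF f z])
    also have "\<dots> \<le> ennreal (C * y) * ennreal (1 / c)" using w by (rule mult_left_mono) simp
    also have "\<dots> = ennreal (C / c * y)" using C c y by (simp add: ennreal_mult[symmetric])
    finally have "\<Phi> (cmod (f z) / 2) \<le> C / c * y" using C c y by (subst (asm) ennreal_le_iff) auto
    then have "cmod (f z) / 2 \<le> K * growth_inv \<Phi> y" by (intro K(2) y) auto
    then show ?thesis by (simp add: y_def)
  qed
  then show ?thesis using K(1) by (intro that[of "2 * K"]) (auto simp: N_def)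
qed

text \<open>A normalized power of the Bergman kernel: the quotient equals 1 at z = a, so s is the
  value there. The power k is left free because it has to grow as the lower type decreases.\<close>

definition test_fun :: "real \<Rightarrow> nat \<Rightarrow> complex^'n::finite \<Rightarrow> complex^'n \<Rightarrow> complex" where
  "test_fun s k a z = of_real s * (of_real (1 - (norm a)\<^sup>2) / (1 - cdot z a)) ^ k"

lemma one_minus_cdot_ge:
  fixes z a :: "complex^'n::finite"
  assumes "z \<in> ball 0 1"
  shows "1 - norm a \<le> cmod (1 - cdot z a)"
proof -
  have "cmod (cdot z a) \<le> norm z * norm a" by (rule norm_cdot_le)
  also have "\<dots> \<le> 1 * norm a" using assms by (intro mult_right_mono) auto
  finally show ?thesis using norm_triangle_ineq2[of 1 "cdot z a"] by simp
qed

lemma holo_on_test_fun: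
  fixes a :: "complex^'n::finite"
  assumes "a \<in> ball 0 1"
  shows "holo_on (test_fun s k a) (ball 0 1)"
proof -
  have "holo_on (\<lambda>z. (\<lambda>w. of_real s * (of_real (1 - (norm a)\<^sup>2) / (1 - w)) ^ k) (cdot z a)) (ball 0 1)"
  proof (rule holo_on_compose_field[OF holo_on_cdot])
    fix z :: "complex^'n" assume "z \<in> ball 0 1"
    then have "cdot z a \<noteq> 1" using one_minus_cdot_ge[of z a] assms by auto
    moreover have "(\<lambda>w. of_real s * (of_real (1 - (norm a)\<^sup>2) / (1 - w)) ^ k) holomorphic_on - {1}"
      by (intro holomorphic_intros) auto
    ultimately show "(\<lambda>w. of_real s * (of_real (1 - (norm a)\<^sup>2) / (1 - w)) ^ k) field_differentiable at (cdot z a)"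
      by (intro holomorphic_on_imp_differentiable_at[of _ "- {1}"]) auto
  qed
  then show ?thesis unfolding test_fun_def[abs_def] .
qed

lemma test_fun_diagonal:
  assumes "a \<in> ball 0 1" shows "test_fun s k a a = of_real s"
proof -
  have "(norm a)\<^sup>2 < 1" using assms by (simp add: power_less_one_iff abs_square_less_1)
  then have "1 - complex_of_real ((norm a)\<^sup>2) \<noteq> 0" by (metis less_irrefl of_real_1 of_real_eq_iff right_minus_eq)
  then show ?thesis by (simp add: test_fun_def cdot_self)
qed

lemma test_fun_modular:
  assumes \<Phi>: "growth_fun \<Phi>" "lower_type \<Phi> p" "p > 0" "upper_type \<Phi> q" and \<alpha>: "\<alpha> > -1"
  obtains m k where "m \<ge> 0" "\<And>a :: complex^'n::finite. a \<in> ball 0 1 \<Longrightarrow>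
    modular \<Phi> \<alpha> (test_fun (growth_inv \<Phi> ((1 - (norm a)\<^sup>2) powr (- (real CARD('n) + 1 + \<alpha>)))) k a) \<le> ennreal m"
proof -
  define N where "N = real CARD('n) + 1 + \<alpha>"
  obtain k :: nat where "N / p < real k" using reals_Archimedean2 by blast
  \<comment> \<open>With M = k p > N, the p-th power of the k-th power of the kernel falls within
    the range of the Forelli-Rudin estimate.\<close>
  then have kp: "real k * p > N" using \<Phi>(3) by (simp add: field_simps)
  define M where "M = real k * p"
  obtain C0 where C0: "C0 > 0" "\<And>s t. s > 0 \<Longrightarrow> 0 < t \<Longrightarrow> t \<le> 1 \<Longrightarrow> \<Phi> (s * t) \<le> C0 * t powr p * \<Phi> s"
    using \<Phi>(2) by (auto simp: lower_type_def)
  obtain C1 where C1: "C1 > 0" "\<And>x. x \<ge> 0 \<Longrightarrow> \<Phi> (2 ^ k * x) \<le> C1 * \<Phi> x"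
    using upper_type_scale[OF \<Phi>(1,4), of "2 ^ k"] by auto
  obtain C2 where C2: "C2 > 0" "\<And>a :: complex^'n. a \<in> ball 0 1 \<Longrightarrow>
    (\<integral>\<^sup>+z. ennreal (bergman_weight \<alpha> z * cmod (1 - cdot z a) powr (- M)) \<partial>lborel) \<le> ennreal (C2 * (1 - (norm a)\<^sup>2) powr (N - M))"
    using forelli_rudin[OF \<alpha>, of M, where 'n='n] kp unfolding N_def M_def by blast
  define c where "c = bergman_const \<alpha> TYPE('n)"
  have c: "c > 0" unfolding c_def by (rule bergman_const_pos[OF \<alpha>])
  have "modular \<Phi> \<alpha> (test_fun (growth_inv \<Phi> ((1 - (norm a)\<^sup>2) powr (- N))) k a) \<le> ennreal (c * (C0 * C1 * C2))"
    if a: "a \<in> ball 0 1" for a :: "complex^'n"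
  proof -
    define d where "d = 1 - (norm a)\<^sup>2"
    have d: "d > 0" using a by (simp add: d_def power_less_one_iff abs_square_less_1)
    define s where "s = growth_inv \<Phi> (d powr (- N))"
    have s: "s > 0" "\<Phi> s = d powr (- N)" using d growth_inv_pos[OF \<Phi>(1)] growth_inv(2)[OF \<Phi>(1)] by (auto simp: s_def)
    have "d = (1 + norm a) * (1 - norm a)" by (simp add: d_def power2_eq_square algebra_simps)
    also have "\<dots> \<le> 2 * (1 - norm a)" using a by (intro mult_right_mono) auto
    finally have d2: "d \<le> 2 * (1 - norm a)" .
    define L where "L = C0 * C1 * d powr (M - N)"
    have L: "L \<ge> 0" using C0 C1 by (simp add: L_def)
    have pt: "\<Phi> (cmod (test_fun s k a z)) * bergman_weight \<alpha> z \<le> L * (bergman_weight \<alpha> z * cmod (1 - cdot z a) powr (- M))" for z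
    proof (cases "z \<in> ball 0 1")
      case True
      define e where "e = cmod (1 - cdot z a)"
      have e: "1 - norm a \<le> e" unfolding e_def by (rule one_minus_cdot_ge[OF True])
      then have e0: "e > 0" using a by auto
      define x where "x = d / e"
      have x: "0 < x" "x \<le> 2" using d e0 d2 e by (auto simp: x_def field_simps)
      have "cmod (test_fun s k a z) = s * x ^ k"
        unfolding test_fun_def norm_mult norm_power norm_divide norm_of_real d_def[symmetric] using s d by (simp add: x_def e_def)
      \<comment> \<open>Lower type admits only factors at most 1, but x = d/e is bounded by 2. So
        x^k is split: (x/2)^k goes to lower type and 2^k to upper type.\<close>
      also have "\<dots> = (2 ^ k * s) * (x / 2) ^ k" by (simp add: power_divide)
      finally have "\<Phi> (cmod (test_fun s k a z)) = \<Phi> ((2 ^ k * s) * (x / 2) ^ k)" by simp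
      also have "\<dots> \<le> C0 * ((x / 2) ^ k) powr p * \<Phi> (2 ^ k * s)"
        using s x by (intro C0) (auto intro!: power_le_one)
      also have "\<dots> \<le> C0 * x powr M * (C1 * \<Phi> s)"
      proof (intro mult_mono C1)
        have "((x / 2) ^ k) powr p \<le> (x ^ k) powr p"
          using x \<Phi>(3) by (intro powr_mono2 power_mono) auto
        also have "\<dots> = x powr M" using x by (simp add: powr_realpow[symmetric] powr_powr M_def)
        finally show "((x / 2) ^ k) powr p \<le> x powr M" .
      qed (use C0 C1 s growth_fun_nonneg[OF \<Phi>(1), of "2 ^ k * s"] in auto)
      also have "x powr M = d powr M * e powr (- M)"
        using d e0 by (simp add: x_def powr_divide powr_minus_divide)
      also have "C0 * (d powr M * e powr (- M)) * (C1 * \<Phi> s) = L * e powr (- M)"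
        by (simp add: L_def s(2) powr_diff powr_minus_divide mult_ac)
      finally have "\<Phi> (cmod (test_fun s k a z)) \<le> L * e powr (- M)" .
      from mult_right_mono[OF this bergman_weight_nonneg[of \<alpha> z]] show ?thesis by (simp add: e_def mult_ac)
    qed (simp add: bergman_weight_def)
    have meas: "(\<lambda>z. ennreal (bergman_weight \<alpha> z * cmod (1 - cdot z a) powr (- M))) \<in> borel_measurable borel"
    proof -
      have "(\<lambda>z. cmod (1 - cdot z a)) \<in> borel_measurable borel"
        by (intro borel_measurable_continuous_onI continuous_intros)
      then show ?thesis by measurable
    qed
    have "weighted_integral \<Phi> \<alpha> (test_fun s k a) \<le> (\<integral>\<^sup>+z. ennreal L * ennreal (bergman_weight \<alpha> z * cmod (1 - cdot z a) powr (- M)) \<partial>lborel)"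
      unfolding weighted_integral_def
    proof (rule nn_integral_mono)
      fix z
      show "ennreal (\<Phi> (cmod (test_fun s k a z))) * ennreal (bergman_weight \<alpha> z) \<le> ennreal L * ennreal (bergman_weight \<alpha> z * cmod (1 - cdot z a) powr (- M))"
        using ennreal_leI[OF pt[of z]] L growth_fun_nonneg[OF \<Phi>(1), of "cmod (test_fun s k a z)"] bergman_weight_nonneg[of \<alpha> z]
        by (simp add: ennreal_mult)
    qed
    also have "\<dots> = ennreal L * (\<integral>\<^sup>+z. ennreal (bergman_weight \<alpha> z * cmod (1 - cdot z a) powr (- M)) \<partial>lborel)"
      using meas by (intro nn_integral_cmult) simp
    also have "\<dots> \<le> ennreal L * ennreal (C2 * d powr (N - M))"
      unfolding d_def by (intro mult_left_mono C2 a) simp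
    \<comment> \<open>The powers of d cancel: d^M from the kernel and d^(-N) = \<Phi> s from the
      height of the test function, against d^(N - M) from Forelli-Rudin. The bound is thus
      independent of a.\<close>
    also have "\<dots> = ennreal (C0 * C1 * C2 * (d powr (M - N) * d powr (N - M)))"
      using L C2 by (simp add: ennreal_mult[symmetric] L_def mult_ac)
    also have "d powr (M - N) * d powr (N - M) = 1" using d by (simp add: powr_add[symmetric])
    finally have "weighted_integral \<Phi> \<alpha> (test_fun s k a) \<le> ennreal (C0 * C1 * C2)" by simp
    then have "ennreal c * weighted_integral \<Phi> \<alpha> (test_fun s k a) \<le> ennreal c * ennreal (C0 * C1 * C2)"
      by (rule mult_left_mono) simp
    also have "\<dots> = ennreal (c * (C0 * C1 * C2))" using c C0 C1 C2 by (simp add: ennreal_mult[symmetric])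
    also have "ennreal c * weighted_integral \<Phi> \<alpha> (test_fun s k a) = modular \<Phi> \<alpha> (test_fun s k a)"
      unfolding c_def by (rule modular_eq_weighted_integral[OF \<Phi>(1) holo_on_imp_continuous_on[OF holo_on_test_fun[OF a]], symmetric])
    finally show ?thesis by (simp add: s_def d_def)
  qed
  moreover have "0 \<le> c * (C0 * C1 * C2)" using c C0 C1 C2 by simp
  ultimately show ?thesis unfolding N_def by (intro that)
qed

section \<open>Multipliers\<close>

text \<open>One-variable maximum principle on the disc of radius \<rho> in the complex line through
  z and 0. For z = 0 an arbitrary unit vector spans the line.\<close>

lemma holo_line_maximum:
  fixes g :: "complex^'n::finite \<Rightarrow> complex"
  assumes g: "holo_on g (ball 0 1)" and \<rho>: "norm z < \<rho>" "\<rho> < 1"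
    and le: "\<And>w. norm w = \<rho> \<Longrightarrow> cmod (g w) \<le> B"
  shows "cmod (g z) \<le> B"
proof -
  obtain \<zeta> where \<zeta>: "norm \<zeta> = 1" "z = norm z *\<^sub>R \<zeta>" by (rule unit_direction)
  have \<rho>0: "\<rho> > 0" using \<rho> norm_ge_zero[of z] by linarith
  have sub: "0 + c *s \<zeta> \<in> ball 0 1" if "c \<in> cball 0 \<rho>" for c
    using that \<rho> by (simp add: norm_smult_vec \<zeta>(1))
  have fd: "(\<lambda>c. g (0 + c *s \<zeta>)) field_differentiable at c" if "c \<in> cball 0 \<rho>" for c
    using holo_on_line[OF g sub that] by simp
  have "cmod ((\<lambda>c. g (0 + c *s \<zeta>)) (of_real (norm z))) \<le> B"
  proof (rule maximum_modulus_frontier[where f="\<lambda>c. g (0 + c *s \<zeta>)" and S="ball 0 \<rho>"])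
    show "(\<lambda>c. g (0 + c *s \<zeta>)) holomorphic_on interior (ball 0 \<rho>)"
      unfolding holomorphic_on_def
    proof
      fix c :: complex assume "c \<in> interior (ball 0 \<rho>)"
      then have "c \<in> cball 0 \<rho>" by (simp add: interior_open)
      then show "(\<lambda>c. g (0 + c *s \<zeta>)) field_differentiable at c within interior (ball 0 \<rho>)"
        by (rule field_differentiable_at_within[OF fd])
    qed
    have "continuous_on (cball 0 \<rho>) (\<lambda>c. g (0 + c *s \<zeta>))"
      using fd by (intro continuous_at_imp_continuous_on ballI field_differentiable_imp_continuous_at) auto
    then show "continuous_on (closure (ball 0 \<rho>)) (\<lambda>c. g (0 + c *s \<zeta>))" using \<rho>0 by simp
    show "cmod (g (0 + c *s \<zeta>)) \<le> B" if "c \<in> frontier (ball 0 \<rho>)" for c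
      using that \<rho>0 by (intro le) (simp add: norm_smult_vec \<zeta>(1))
    show "complex_of_real (norm z) \<in> ball 0 \<rho>" using \<rho> by simp
  qed simp
  then show ?thesis using \<zeta>(2) by (simp only: scaleR_eq_smult[symmetric] add_0)
qed

lemma multiplier_growth:
  fixes \<Phi>1 \<Phi>2 :: "real \<Rightarrow> real" and g :: "complex^'n::finite \<Rightarrow> complex"
  assumes \<Phi>1: "growth_fun \<Phi>1" "lower_type \<Phi>1 p1" "p1 > 0" "upper_type \<Phi>1 q1"
    and \<Phi>2: "growth_fun \<Phi>2" "lower_type \<Phi>2 p2" "p2 > 0"
    and \<alpha>: "\<alpha> > -1" and \<beta>: "\<beta> > -1" and g: "g \<in> multipliers \<Phi>1 \<alpha> \<Phi>2 \<beta>"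
  obtains C where "C > 0" "\<And>a. a \<in> ball 0 1 \<Longrightarrow> cmod (g a) \<le>
    C * (growth_inv \<Phi>2 ((1 - (norm a)\<^sup>2) powr (- (real CARD('n) + 1 + \<beta>)))
       / growth_inv \<Phi>1 ((1 - (norm a)\<^sup>2) powr (- (real CARD('n) + 1 + \<alpha>))))"
proof -
  define N1 N2 where "N1 = real CARD('n) + 1 + \<alpha>" and "N2 = real CARD('n) + 1 + \<beta>"
  define t where "t = (\<lambda>k (a :: complex^'n). test_fun (growth_inv \<Phi>1 ((1 - (norm a)\<^sup>2) powr (- N1))) k a)"
  obtain m k where m: "m \<ge> 0" "\<And>a :: complex^'n. a \<in> ball 0 1 \<Longrightarrow> modular \<Phi>1 \<alpha> (t k a) \<le> ennreal m"
    unfolding N1_def t_def using test_fun_modular[OF \<Phi>1 \<alpha>, where 'n='n] by blast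
  obtain K where K: "K \<ge> 1" "\<And>f :: complex^'n \<Rightarrow> complex. continuous_on (ball 0 1) f \<Longrightarrow>
    modular \<Phi>1 \<alpha> f \<le> ennreal m \<Longrightarrow> modular \<Phi>1 \<alpha> (\<lambda>z. f z / complex_of_real K) \<le> 1"
    using modular_scale_le_one[OF \<Phi>1(1-3) \<alpha> m(1), where 'n='n] by blast
  obtain P where P: "P \<ge> 1" "\<And>(f :: complex^'n \<Rightarrow> complex) z. holo_on f (ball 0 1) \<Longrightarrow> modular \<Phi>2 \<beta> f \<le> 1 \<Longrightarrow>
    z \<in> ball 0 1 \<Longrightarrow> cmod (f z) \<le> P * growth_inv \<Phi>2 ((1 - (norm z)\<^sup>2) powr (- N2))"
    unfolding N2_def using pointwise_bound[OF \<Phi>2 \<beta>, where 'n='n] by blast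
  obtain C where gh: "holo_on g (ball 0 1)" and C: "C > 0"
    "\<And>f. f \<in> bergman_orlicz \<Phi>1 \<alpha> \<Longrightarrow> (\<lambda>z. f z * g z) \<in> bergman_orlicz \<Phi>2 \<beta>"
    "\<And>f. f \<in> bergman_orlicz \<Phi>1 \<alpha> \<Longrightarrow> lux_norm \<Phi>2 \<beta> (\<lambda>z. f z * g z) \<le> C * lux_norm \<Phi>1 \<alpha> f"
    using g by (auto simp: multipliers_def)
  \<comment> \<open>The added 1 puts the norm of the product strictly below \<open>s\<close>, so the
    product divided by \<open>s\<close> has modular at most 1.\<close>
  define s where "s = C * K + 1"
  have s: "s > 0" using C K by (simp add: s_def add_pos_pos)
  have "cmod (g a) \<le> (s * P) * (growth_inv \<Phi>2 ((1 - (norm a)\<^sup>2) powr (- N2)) / growth_inv \<Phi>1 ((1 - (norm a)\<^sup>2) powr (- N1)))"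
    if a: "a \<in> ball 0 1" for a
  proof -
    define f where "f = t k a"
    have f: "holo_on f (ball 0 1)" unfolding f_def t_def by (rule holo_on_test_fun[OF a])
    have fm: "modular \<Phi>1 \<alpha> f \<le> ennreal m" unfolding f_def by (rule m(2)[OF a])
    then have fA: "f \<in> bergman_orlicz \<Phi>1 \<alpha>"
      using f le_less_trans[OF fm] by (simp add: bergman_orlicz_def)
    have "lux_norm \<Phi>1 \<alpha> f \<le> K"
      using K(1) by (intro lux_norm_le K(2) holo_on_imp_continuous_on f fm) auto
    then have "C * lux_norm \<Phi>1 \<alpha> f \<le> C * K" using C(1) by (intro mult_left_mono) auto
    then have "lux_norm \<Phi>2 \<beta> (\<lambda>z. f z * g z) < s"
      using C(3)[OF fA] by (simp add: s_def)
    then have "modular \<Phi>2 \<beta> (\<lambda>z. f z * g z / complex_of_real s) \<le> 1"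
      by (intro modular_le_one_if_lux_norm_less \<Phi>2 lux_set_nonempty[OF \<Phi>2 \<beta>] C(2)[OF fA])
    from P(2)[OF holo_on_divide_const[OF holo_on_mult[OF f gh]] this a]
    have le: "cmod (f a) * cmod (g a) / s \<le> P * growth_inv \<Phi>2 ((1 - (norm a)\<^sup>2) powr (- N2))"
      using s by (simp add: norm_mult norm_divide)
    define y where "y = growth_inv \<Phi>1 ((1 - (norm a)\<^sup>2) powr (- N1))"
    have "(norm a)\<^sup>2 < 1" using a by (simp add: abs_square_less_1)
    then have y: "y > 0" unfolding y_def by (intro growth_inv_pos \<Phi>1) simp
    have "f a = of_real y" unfolding f_def t_def y_def by (rule test_fun_diagonal[OF a])
    then have "y * cmod (g a) / s \<le> P * growth_inv \<Phi>2 ((1 - (norm a)\<^sup>2) powr (- N2))"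
      using le y by simp
    then have "cmod (g a) \<le> (s * P) * (growth_inv \<Phi>2 ((1 - (norm a)\<^sup>2) powr (- N2)) / y)"
      using s y by (simp add: field_simps)
    then show ?thesis by (simp add: y_def)
  qed
  moreover have "s * P > 0" using s P(1) by simp
  ultimately show ?thesis unfolding N1_def N2_def by (intro that)
qed

text \<open>Stated for modulars at most 1 with one \<open>K\<close> for all f: applied to f/s for s
  above the norm of f, it gives the norm inequality by homogeneity.\<close>

lemma bounded_multiplier:
  assumes \<Phi>1: "growth_fun \<Phi>1" "lower_type \<Phi>1 p1" "p1 > 0" "upper_type \<Phi>1 q1"
    and \<Phi>2: "growth_fun \<Phi>2" "lower_type \<Phi>2 p2" "p2 > 0" "upper_type \<Phi>2 q2"
    and mono: "mono_on {0<..} (\<lambda>t. \<Phi>2 t / \<Phi>1 t)"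
    and \<alpha>: "\<alpha> > -1" and \<beta>: "\<beta> > -1"
    and c: "c > 0" and inv: "\<And>d. 0 < d \<Longrightarrow> d \<le> 1 \<Longrightarrow>
      c * growth_inv \<Phi>1 (d powr (- (real CARD('n::finite) + 1 + \<alpha>))) \<le> growth_inv \<Phi>2 (d powr (- (real CARD('n) + 1 + \<beta>)))"
  shows "\<exists>K>0. \<forall>f g :: complex^'n \<Rightarrow> complex. holo_on f (ball 0 1) \<longrightarrow> holo_on g (ball 0 1) \<longrightarrow>
    (\<forall>z\<in>ball 0 1. cmod (g z) \<le> B) \<longrightarrow> modular \<Phi>1 \<alpha> f \<le> 1 \<longrightarrow>
    modular \<Phi>2 \<beta> (\<lambda>z. f z * g z / complex_of_real K) \<le> 1"
proof -
  define N1 N2 where "N1 = real CARD('n) + 1 + \<alpha>" and "N2 = real CARD('n) + 1 + \<beta>"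
  define y1 y2 where "y1 = (\<lambda>d. growth_inv \<Phi>1 (d powr (- N1)))" and "y2 = (\<lambda>d. growth_inv \<Phi>2 (d powr (- N2)))"
  obtain P where P: "P \<ge> 1" "\<And>(f :: complex^'n \<Rightarrow> complex) z. holo_on f (ball 0 1) \<Longrightarrow> modular \<Phi>1 \<alpha> f \<le> 1 \<Longrightarrow>
    z \<in> ball 0 1 \<Longrightarrow> cmod (f z) \<le> P * y1 (1 - (norm z)\<^sup>2)"
    unfolding N1_def y1_def using pointwise_bound[OF \<Phi>1(1-3) \<alpha>, where 'n='n] by blast
  have Pc: "0 \<le> P / c" using P c by simp
  obtain C1 where C1: "C1 > 0" "\<And>x. x \<ge> 0 \<Longrightarrow> \<Phi>2 (P / c * x) \<le> C1 * \<Phi>2 x"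
    using upper_type_scale[OF \<Phi>2(1,4) Pc] by blast
  \<comment> \<open>\<open>B\<close> is arbitrary in the statement, whereas
    \<open>upper_type_scale\<close> asks for a nonnegative factor.\<close>
  have B0: "0 \<le> max 0 B" by simp
  obtain C2 where C2: "C2 > 0" "\<And>x. x \<ge> 0 \<Longrightarrow> \<Phi>2 (max 0 B * x) \<le> C2 * \<Phi>2 x"
    using upper_type_scale[OF \<Phi>2(1,4) B0] by blast
  define m where "m = bergman_const \<beta> TYPE('n) / bergman_const \<alpha> TYPE('n) * (C2 * C1)"
  have m: "m \<ge> 0"
    using bergman_const_pos[OF \<alpha>, where 'n='n] bergman_const_pos[OF \<beta>, where 'n='n] C1 C2 by (simp add: m_def)
  obtain K where K: "K \<ge> 1" "\<And>f :: complex^'n \<Rightarrow> complex. continuous_on (ball 0 1) f \<Longrightarrow>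
    modular \<Phi>2 \<beta> f \<le> ennreal m \<Longrightarrow> modular \<Phi>2 \<beta> (\<lambda>z. f z / complex_of_real K) \<le> 1"
    using modular_scale_le_one[OF \<Phi>2(1-3) \<beta> m, where 'n='n] by blast
  have "modular \<Phi>2 \<beta> (\<lambda>z. f z * g z / complex_of_real K) \<le> 1"
    if f: "holo_on f (ball 0 1)" and g: "holo_on g (ball 0 1)" and B: "\<forall>z\<in>ball 0 1. cmod (g z) \<le> B"
      and fm: "modular \<Phi>1 \<alpha> f \<le> 1" for f g :: "complex^'n \<Rightarrow> complex"
  proof -
    have pt: "\<Phi>2 (cmod (f z * g z)) * bergman_weight \<beta> z \<le> (C2 * C1) * (\<Phi>1 (cmod (f z)) * bergman_weight \<alpha> z)"
      if z: "z \<in> ball 0 1" for z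
    proof (cases "f z = 0")
      case False
      define d where "d = 1 - (norm z)\<^sup>2"
      have d: "0 < d" "d \<le> 1" using z by (auto simp: d_def abs_square_less_1)
      define u where "u = cmod (f z)"
      have u: "0 < u" "u \<le> P * y1 d" using False P(2)[OF f fm z] by (auto simp: u_def d_def)
      have y1: "y1 d > 0" "\<Phi>1 (y1 d) = d powr (- N1)"
        using d growth_inv_pos[OF \<Phi>1(1)] growth_inv(2)[OF \<Phi>1(1)] by (auto simp: y1_def)
      have y2: "y2 d > 0" "\<Phi>2 (y2 d) = d powr (- N2)"
        using d growth_inv_pos[OF \<Phi>2(1)] growth_inv(2)[OF \<Phi>2(1)] by (auto simp: y2_def)
      have "y1 d \<le> y2 d / c"
        using inv[OF d] c by (simp add: y1_def y2_def N1_def N2_def field_simps)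
      then have "P * y1 d \<le> P * (y2 d / c)" using P(1) by (intro mult_left_mono) auto
      then have "\<Phi>2 (P * y1 d) \<le> \<Phi>2 (P / c * y2 d)"
        using P(1) y1 by (intro growth_fun_mono[OF \<Phi>2(1)]) auto
      also have "\<dots> \<le> C1 * d powr (- N2)" using C1(2)[of "y2 d"] y2 by simp
      finally have num: "\<Phi>2 (P * y1 d) \<le> C1 * d powr (- N2)" .
      have "1 * y1 d \<le> P * y1 d" using P(1) y1 by (intro mult_right_mono) auto
      then have den: "d powr (- N1) \<le> \<Phi>1 (P * y1 d)"
        unfolding y1(2)[symmetric] using y1(1) by (intro growth_fun_mono[OF \<Phi>1(1)]) auto
      \<comment> \<open>The quotient is carried from u up to the pointwise bound P y1(d). There
        \<Phi>2 is controlled through y2(d), which dominates c y1(d), and \<Phi>1 is at least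
        d^(-N1) because P is at least 1.\<close>
      have "\<Phi>2 u / \<Phi>1 u \<le> \<Phi>2 (P * y1 d) / \<Phi>1 (P * y1 d)"
        using u by (intro mono_onD[OF mono]) auto
      also have "\<dots> \<le> C1 * d powr (- N2) / d powr (- N1)"
        using num den d C1(1) by (intro frac_le) auto
      also have "\<dots> = C1 * d powr (\<alpha> - \<beta>)" 
      proof -
        \<comment> \<open>The dimensional parts n + 1 cancel, and the remaining power \<alpha> -
          \<beta> is exactly what turns the weight d^\<beta> into d^\<alpha>.\<close>
        have "d powr (- N2) / d powr (- N1) = d powr (- N2 - (- N1))" by (rule powr_diff[symmetric])
        also have "- N2 - (- N1) = \<alpha> - \<beta>" by (simp add: N1_def N2_def)
        finally show ?thesis by (simp only: times_divide_eq_right[symmetric])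
      qed
      finally have le: "\<Phi>2 u \<le> C1 * d powr (\<alpha> - \<beta>) * \<Phi>1 u"
        using growth_fun_pos[OF \<Phi>1(1,4) u(1)] by (simp add: field_simps)
      have "cmod (f z * g z) \<le> max 0 B * u"
      proof -
        have "cmod (g z) \<le> B" using B z by blast
        then show ?thesis
          unfolding norm_mult u_def mult.commute[of "max 0 B"] by (intro mult_left_mono) auto
      qed
      then have "\<Phi>2 (cmod (f z * g z)) \<le> \<Phi>2 (max 0 B * u)" by (intro growth_fun_mono[OF \<Phi>2(1)]) auto
      also have "\<dots> \<le> C2 * \<Phi>2 u" using u by (intro C2) auto
      also have "\<dots> \<le> C2 * (C1 * d powr (\<alpha> - \<beta>) * \<Phi>1 u)" using le C2(1) by (intro mult_left_mono) auto
      finally have "\<Phi>2 (cmod (f z * g z)) * d powr \<beta> \<le> C2 * (C1 * d powr (\<alpha> - \<beta>) * \<Phi>1 u) * d powr \<beta>"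
        by (rule mult_right_mono) simp
      also have "\<dots> = (C2 * C1) * (\<Phi>1 u * (d powr (\<alpha> - \<beta>) * d powr \<beta>))" by (simp add: mult_ac)
      also have "d powr (\<alpha> - \<beta>) * d powr \<beta> = d powr \<alpha>" by (simp add: powr_add[symmetric])
      finally show ?thesis using z by (simp add: bergman_weight_def d_def u_def)
    qed (simp add: growth_fun_0 \<Phi>1 \<Phi>2)
    have cont: "continuous_on (ball 0 1) (\<lambda>z. f z * g z)"
      by (intro holo_on_imp_continuous_on holo_on_mult f g)
    have "modular \<Phi>2 \<beta> (\<lambda>z. f z * g z) \<le> ennreal m * modular \<Phi>1 \<alpha> f"
      unfolding m_def using C1(1) C2(1) pt
      by (intro modular_le \<Phi>1 \<Phi>2 \<alpha> cont holo_on_imp_continuous_on f) auto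
    also have "\<dots> \<le> ennreal m * 1" using fm by (rule mult_left_mono) simp
    finally show ?thesis using K(2)[OF cont] by simp
  qed
  moreover have "K > 0" using K(1) by simp
  ultimately show ?thesis by (intro exI[of _ K] conjI allI impI)
qed

theorem theorem4p2:
  fixes \<Phi>1 \<Phi>2 :: "real \<Rightarrow> real" and \<alpha> \<beta> :: real
    and \<gamma> :: "real \<Rightarrow> real"
  assumes "\<Phi>1 \<in> class_L \<union> class_U" and "\<Phi>2 \<in> class_L \<union> class_U"
    and "mono_on {0<..} (\<lambda>t. \<Phi>2 t / \<Phi>1 t)"
    and "\<alpha> > -1" and "\<beta> > -1"
    and "\<gamma> = (\<lambda>t. growth_inv \<Phi>2 (t powr (real CARD('n::finite) + 1 + \<beta>)) /
                   growth_inv \<Phi>1 (t powr (real CARD('n) + 1 + \<alpha>)))"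
  shows "((\<exists>c C. 0 < c \<and> c \<le> C \<and> (\<forall>t\<ge>1. c \<le> \<gamma> t \<and> \<gamma> t \<le> C)) \<longrightarrow>
            (multipliers \<Phi>1 \<alpha> \<Phi>2 \<beta> :: (complex^'n \<Rightarrow> complex) set) = Hinf)
       \<and> ((antimono_on {1..} \<gamma> \<and> (\<gamma> \<longlongrightarrow> 0) at_top) \<longrightarrow>
            (multipliers \<Phi>1 \<alpha> \<Phi>2 \<beta> :: (complex^'n \<Rightarrow> complex) set) = {g. \<forall>z\<in>ball 0 1. g z = 0})"
proof -
  note \<alpha> = assms(4) and \<beta> = assms(5)
  obtain p1 q1 where \<Phi>1: "growth_fun \<Phi>1" "lower_type \<Phi>1 p1" "p1 > 0" "upper_type \<Phi>1 q1"
    by (rule class_L_U_types[OF assms(1)])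
  obtain p2 q2 where \<Phi>2: "growth_fun \<Phi>2" "lower_type \<Phi>2 p2" "p2 > 0" "upper_type \<Phi>2 q2"
    by (rule class_L_U_types[OF assms(2)])
  define N1 N2 where "N1 = real CARD('n) + 1 + \<alpha>" and "N2 = real CARD('n) + 1 + \<beta>"
  \<comment> \<open>The substitution t = 1/d matches radii in the ball, 0 < d and d at most 1, with
    the domain t at least 1 of \<gamma>.\<close>
  have \<gamma>: "growth_inv \<Phi>2 (d powr (- N2)) / growth_inv \<Phi>1 (d powr (- N1)) = \<gamma> (1 / d)" if "d > 0" for d
  proof -
    have "d powr (- N) = (1 / d) powr N" for N
      using that by (simp add: powr_divide powr_minus_divide)
    then show ?thesis by (simp only: assms(6) N1_def N2_def)
  qed
  have d: "0 < 1 - (norm a)\<^sup>2" "1 - (norm a)\<^sup>2 \<le> 1" if "a \<in> ball 0 1" for a :: "complex^'n"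
    using that by (auto simp: abs_square_less_1)
  have growth: "\<exists>C>0. \<forall>a\<in>ball 0 1. cmod (g a) \<le> C * \<gamma> (1 / (1 - (norm a)\<^sup>2))"
    if g: "g \<in> multipliers \<Phi>1 \<alpha> \<Phi>2 \<beta>" for g :: "complex^'n \<Rightarrow> complex"
  proof -
    obtain C where C: "C > 0" "\<And>a. a \<in> ball 0 1 \<Longrightarrow> cmod (g a) \<le>
      C * (growth_inv \<Phi>2 ((1 - (norm a)\<^sup>2) powr (- N2)) / growth_inv \<Phi>1 ((1 - (norm a)\<^sup>2) powr (- N1)))"
      unfolding N1_def N2_def using multiplier_growth[OF \<Phi>1 \<Phi>2(1-3) \<alpha> \<beta> g] by blast
    have "cmod (g a) \<le> C * \<gamma> (1 / (1 - (norm a)\<^sup>2))" if "a \<in> ball 0 1" for a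
      using C(2)[OF that] \<gamma>[OF d(1)[OF that]] by simp
    with C(1) show ?thesis by blast
  qed
  have holo: "holo_on g (ball 0 1)" if "g \<in> multipliers \<Phi>1 \<alpha> \<Phi>2 \<beta>" for g :: "complex^'n \<Rightarrow> complex"
    using that by (simp add: multipliers_def)
  have part1: "(multipliers \<Phi>1 \<alpha> \<Phi>2 \<beta> :: (complex^'n \<Rightarrow> complex) set) = Hinf"
    if c: "0 < c" "\<And>t. t \<ge> 1 \<Longrightarrow> c \<le> \<gamma> t" "\<And>t. t \<ge> 1 \<Longrightarrow> \<gamma> t \<le> C" for c C
  proof (intro set_eqI iffI)
    fix g :: "complex^'n \<Rightarrow> complex" assume g: "g \<in> multipliers \<Phi>1 \<alpha> \<Phi>2 \<beta>"
    obtain C' where C': "C' > 0" "\<And>a. a \<in> ball 0 1 \<Longrightarrow> cmod (g a) \<le> C' * \<gamma> (1 / (1 - (norm a)\<^sup>2))"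
      using growth[OF g] by blast
    have "cmod (g a) \<le> C' * C" if "a \<in> ball 0 1" for a
    proof -
      have "\<gamma> (1 / (1 - (norm a)\<^sup>2)) \<le> C" using d[OF that] by (intro c(3)) simp
      then have "C' * \<gamma> (1 / (1 - (norm a)\<^sup>2)) \<le> C' * C" using C'(1) by (intro mult_left_mono) auto
      with C'(2)[OF that] show ?thesis by (rule order_trans)
    qed
    then show "g \<in> Hinf" using holo[OF g] by (auto simp: Hinf_def bounded_iff intro!: exI[of _ "C' * C"])
  next
    fix g :: "complex^'n \<Rightarrow> complex" assume "g \<in> Hinf"
    then obtain B where g: "holo_on g (ball 0 1)" and B: "\<forall>z\<in>ball 0 1. cmod (g z) \<le> B"
      by (auto simp: Hinf_def bounded_iff)
    have inv: "c * growth_inv \<Phi>1 (d powr (- (real CARD('n) + 1 + \<alpha>))) \<le> growth_inv \<Phi>2 (d powr (- (real CARD('n) + 1 + \<beta>)))"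
      if "0 < d" "d \<le> 1" for d
    proof -
      have "c \<le> \<gamma> (1 / d)" using that by (intro c(2)) simp
      then have "c \<le> growth_inv \<Phi>2 (d powr (- N2)) / growth_inv \<Phi>1 (d powr (- N1))" by (simp only: \<gamma>[OF that(1)])
      moreover have "growth_inv \<Phi>1 (d powr (- N1)) > 0" using that by (intro growth_inv_pos \<Phi>1) simp
      ultimately show ?thesis by (simp only: pos_le_divide_eq N1_def N2_def)
    qed
    obtain K where K: "K > 0" "\<And>f g :: complex^'n \<Rightarrow> complex. holo_on f (ball 0 1) \<Longrightarrow> holo_on g (ball 0 1) \<Longrightarrow>
      \<forall>z\<in>ball 0 1. cmod (g z) \<le> B \<Longrightarrow> modular \<Phi>1 \<alpha> f \<le> 1 \<Longrightarrow>
      modular \<Phi>2 \<beta> (\<lambda>z. f z * g z / complex_of_real K) \<le> 1"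
      using bounded_multiplier[OF \<Phi>1 \<Phi>2 assms(3) \<alpha> \<beta> c(1) inv, of B] by blast
    have "(\<lambda>z. f z * g z) \<in> bergman_orlicz \<Phi>2 \<beta> \<and> lux_norm \<Phi>2 \<beta> (\<lambda>z. f z * g z) \<le> K * lux_norm \<Phi>1 \<alpha> f"
      if f: "f \<in> bergman_orlicz \<Phi>1 \<alpha>" for f
    proof
      have fh: "holo_on f (ball 0 1)" using f by (simp add: bergman_orlicz_def)
      note ne = lux_set_nonempty[OF \<Phi>1(1-3) \<alpha> f]
      have l0: "0 \<le> lux_norm \<Phi>1 \<alpha> f" by (rule lux_norm_nonneg[OF ne])
      \<comment> \<open>The uniform bound is applied to f/s, whose modular is at most 1 for every s
        above the norm of f.\<close>
      have fg: "modular \<Phi>2 \<beta> (\<lambda>z. f z * g z / complex_of_real (K * s)) \<le> 1" if s: "lux_norm \<Phi>1 \<alpha> f < s" for s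
        using K(2)[OF holo_on_divide_const[OF fh] g B modular_le_one_if_lux_norm_less[OF \<Phi>1(1) ne s]]
        by (simp add: mult.commute)
      \<comment> \<open>The norm may be 0 or not attained; adding 1 supplies a positive radius
        strictly above it.\<close>
      have "modular \<Phi>2 \<beta> (\<lambda>z. f z * g z / complex_of_real (K * (lux_norm \<Phi>1 \<alpha> f + 1))) < \<infinity>"
        using fg[of "lux_norm \<Phi>1 \<alpha> f + 1"] by (simp add: le_less_trans)
      then have "modular \<Phi>2 \<beta> (\<lambda>z. f z * g z) < \<infinity>"
        by (rule modular_unscale_finite[OF \<Phi>2(1,4) \<beta> holo_on_imp_continuous_on[OF holo_on_mult[OF fh g]], rotated])
          (use K(1) l0 in simp)
      then show "(\<lambda>z. f z * g z) \<in> bergman_orlicz \<Phi>2 \<beta>"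
        using holo_on_mult[OF fh g] by (simp add: bergman_orlicz_def)
      have "lux_norm \<Phi>2 \<beta> (\<lambda>z. f z * g z) / K \<le> lux_norm \<Phi>1 \<alpha> f"
      proof (rule dense_ge)
        fix s assume s: "lux_norm \<Phi>1 \<alpha> f < s"
        then have "lux_norm \<Phi>2 \<beta> (\<lambda>z. f z * g z) \<le> K * s"
          using K(1) l0 by (intro lux_norm_le fg) auto
        then show "lux_norm \<Phi>2 \<beta> (\<lambda>z. f z * g z) / K \<le> s" using K(1) by (simp add: field_simps)
      qed
      then show "lux_norm \<Phi>2 \<beta> (\<lambda>z. f z * g z) \<le> K * lux_norm \<Phi>1 \<alpha> f" using K(1) by (simp add: field_simps)
    qed
    then show "g \<in> multipliers \<Phi>1 \<alpha> \<Phi>2 \<beta>" using g K(1) by (auto simp: multipliers_def)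
  qed
  have part2: "(multipliers \<Phi>1 \<alpha> \<Phi>2 \<beta> :: (complex^'n \<Rightarrow> complex) set) = {g. \<forall>z\<in>ball 0 1. g z = 0}"
    if lim: "(\<gamma> \<longlongrightarrow> 0) at_top"
  proof (intro set_eqI iffI)
    fix g :: "complex^'n \<Rightarrow> complex" assume g: "g \<in> multipliers \<Phi>1 \<alpha> \<Phi>2 \<beta>"
    obtain C where C: "C > 0" "\<And>a. a \<in> ball 0 1 \<Longrightarrow> cmod (g a) \<le> C * \<gamma> (1 / (1 - (norm a)\<^sup>2))"
      using growth[OF g] by blast
    have "g z = 0" if z: "z \<in> ball 0 1" for z
    proof -
      have "cmod (g z) \<le> 0 + \<epsilon>" if \<epsilon>: "\<epsilon> > 0" for \<epsilon>
      proof -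
        have "eventually (\<lambda>t. \<gamma> t < \<epsilon> / C) at_top" using order_tendstoD(2)[OF lim] \<epsilon> C(1) by simp
        then obtain T where T: "\<And>t. t \<ge> T \<Longrightarrow> \<gamma> t < \<epsilon> / C" by (auto simp: eventually_at_top_linorder)
        define T' where "T' = max T 1"
        \<comment> \<open>The first entry keeps the sphere outside z; the second makes 1/(1 -
          \<rho>^2) at least T', so that \<gamma> is already below \<epsilon>/C on it.\<close>
        define \<rho> where "\<rho> = max ((1 + norm z) / 2) (sqrt (1 - 1 / T'))"
        have T': "T' \<ge> 1" "T' \<ge> T" by (auto simp: T'_def)
        have \<rho>: "norm z < \<rho>" "\<rho> < 1" using z T' by (auto simp: \<rho>_def less_max_iff_disj)
        have "1 - 1 / T' = (sqrt (1 - 1 / T'))\<^sup>2" using T' by simp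
        also have "\<dots> \<le> \<rho>\<^sup>2" using T' by (intro power_mono) (auto simp: \<rho>_def)
        finally have "1 - \<rho>\<^sup>2 \<le> 1 / T'" by simp
        moreover have "0 \<le> \<rho>" using \<rho> norm_ge_zero[of z] by linarith
        then have "1 - \<rho>\<^sup>2 > 0" using \<rho> by (simp add: abs_square_less_1)
        ultimately have "T' \<le> 1 / (1 - \<rho>\<^sup>2)" using T' by (simp add: field_simps)
        then have "\<gamma> (1 / (1 - \<rho>\<^sup>2)) < \<epsilon> / C" using T' by (intro T) simp
        then have "C * \<gamma> (1 / (1 - \<rho>\<^sup>2)) \<le> \<epsilon>" using C(1) by (simp add: field_simps)
        then have "cmod (g w) \<le> \<epsilon>" if "norm w = \<rho>" for w
          using C(2)[of w] that \<rho> by simp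
        then show ?thesis using holo_line_maximum[OF holo[OF g] \<rho>, of \<epsilon>] by simp
      qed
      then have "cmod (g z) \<le> 0" by (rule field_le_epsilon)
      then show ?thesis by simp
    qed
    then show "g \<in> {g. \<forall>z\<in>ball 0 1. g z = 0}" by simp
  next
    fix g :: "complex^'n \<Rightarrow> complex" assume "g \<in> {g. \<forall>z\<in>ball 0 1. g z = 0}"
    then have g0: "\<And>z. z \<in> ball 0 1 \<Longrightarrow> g z = 0" by simp
    \<comment> \<open>Functions are total and g is arbitrary off the ball, so holomorphy is
      transferred from the constant 0 on the open ball.\<close>
    have gh: "holo_on g (ball 0 1)"
      by (rule holo_on_cong_open[OF open_ball holo_on_const[of 0]]) (simp add: g0)
    have "(\<lambda>z. f z * g z) \<in> bergman_orlicz \<Phi>2 \<beta> \<and> lux_norm \<Phi>2 \<beta> (\<lambda>z. f z * g z) \<le> 1 * lux_norm \<Phi>1 \<alpha> f"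
      if f: "f \<in> bergman_orlicz \<Phi>1 \<alpha>" for f
    proof
      have fh: "holo_on f (ball 0 1)" using f by (simp add: bergman_orlicz_def)
      have h: "holo_on (\<lambda>z. f z * g z) (ball 0 1)" by (rule holo_on_mult[OF fh gh])
      have mod0: "modular \<Phi>2 \<beta> (\<lambda>z. f z * g z / c) = 0" for c
      proof -
        have "weighted_integral \<Phi>2 \<beta> (\<lambda>z. f z * g z / c) = (\<integral>\<^sup>+z. 0 \<partial>(lborel :: (complex^'n) measure))"
          unfolding weighted_integral_def
          by (intro nn_integral_cong) (auto simp: bergman_weight_def g0 growth_fun_0[OF \<Phi>2(1)])
        then show ?thesis
          by (subst modular_eq_weighted_integral[OF \<Phi>2(1) holo_on_imp_continuous_on[OF holo_on_divide_const[OF h]]]) simp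
      qed
      show "(\<lambda>z. f z * g z) \<in> bergman_orlicz \<Phi>2 \<beta>"
        using h mod0[of 1] by (simp add: bergman_orlicz_def)
      have "lux_norm \<Phi>2 \<beta> (\<lambda>z. f z * g z) \<le> 0"
      proof (rule dense_ge)
        fix s :: real assume "0 < s"
        then show "lux_norm \<Phi>2 \<beta> (\<lambda>z. f z * g z) \<le> s" by (rule lux_norm_le) (simp add: mod0)
      qed
      also have "0 \<le> lux_norm \<Phi>1 \<alpha> f"
        by (rule lux_norm_nonneg[OF lux_set_nonempty[OF \<Phi>1(1-3) \<alpha> f]])
      finally show "lux_norm \<Phi>2 \<beta> (\<lambda>z. f z * g z) \<le> 1 * lux_norm \<Phi>1 \<alpha> f" by simp
    qed
    then show "g \<in> multipliers \<Phi>1 \<alpha> \<Phi>2 \<beta>"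
      unfolding multipliers_def using gh by (auto intro!: exI[of _ 1])
  qed
  show ?thesis
  proof (intro conjI impI)
    assume "\<exists>c C. 0 < c \<and> c \<le> C \<and> (\<forall>t\<ge>1. c \<le> \<gamma> t \<and> \<gamma> t \<le> C)"
    then obtain c C where "0 < c" "\<forall>t\<ge>1. c \<le> \<gamma> t \<and> \<gamma> t \<le> C" by blast
    then show "(multipliers \<Phi>1 \<alpha> \<Phi>2 \<beta> :: (complex^'n \<Rightarrow> complex) set) = Hinf"
      by (intro part1[of c C]) auto
  next
    assume "antimono_on {1..} \<gamma> \<and> (\<gamma> \<longlongrightarrow> 0) at_top"
    then show "(multipliers \<Phi>1 \<alpha> \<Phi>2 \<beta> :: (complex^'n \<Rightarrow> complex) set) = {g. \<forall>z\<in>ball 0 1. g z = 0}"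
      by (intro part2) blast
  qed
qed

end
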